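(* Let $n\ge 0$, let $G$ be a group acting by isometries on a proper non-compact $CAT(0)$ space $M$, and let $A$ be a $\mathbb{Z}G$-module of type $FP_n$. Then $$ {}^{\circ}\Sigma^{n}(M;A)=\{e\in\partial M\mid \mathrm{cl}(Ge)\subseteq \Sigma^{n}(M;A)\},$$ where $\mathrm{cl}(Ge)$ is the closure of the $G$-orbit of $e$ in $\partial M$ with respect to the cone topology.
   Context: Setting. $G$ acts on the proper $CAT(0)$ space $(M,d)$ by isometries via $\rho:G\to \mathrm{Isom}(M)$ (no further assumption on $\rho$). $\partial M$ is the set of asymptoty classes of geodesic rays, with the cone topology; $G$ acts on it. For a geodesic ray $\gamma$ with endpoint $\gamma(\infty)=e\in\partial M$, the Busemann function is $\beta_\gamma(x)=\lim_{t\to\infty}(t-d(x,\gamma(t)))$ (so it tends to $+\infty$ towards $e$). Resolutions and control. $fS$ is the set of finite subsets of a set $S$. A based free resolution $\mathbf F\twoheadrightarrow A$ is a resolution by free (left) $\mathbb{Z}G$-modules $F_k$, $k\ge0$, with chosen $\mathbb{Z}G$-bases $X_k$ and augmentation $\epsilon:F_0\to A$; $Y_k=GX_k$ is the induced $\mathbb{Z}$-basis, $X=\bigcup X_k$, $Y=\bigcup Y_k$. It is always assumed admissible: $\partial x\ne0$ for $x\in X_k$, $k\ge1$, and $\epsilon(x)\neq0$ for $x\in X_0$. $\mathbf F^{(n)}$ is the $n$-skeleton ($F_k$ replaced by $0$ for $k>n$). $A$ has type $FP_n$ if such a resolution exists with $\mathbf F^{(n)}$ finitely generated. For $c\in\mathbf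 F$, $\mathrm{supp}(c)\subseteq Y$ is the set of $y$ occurring in the expansion of $c$. A control map is a $G$-map $h:\mathbf F\to fM$ with $h(c)=\bigcup_{y\in\mathrm{supp}(c)}h(y)$ (so $h(0)=\emptyset$) and $h(x)\neq\emptyset$ for $x\in X$. Put $v_\gamma(c)=\min\beta_\gamma(h(c))$ for $c\ne0$, $v_\gamma(0)=\infty$, and $v_\gamma(a)=\infty$ for $a\in A$. Finitary maps and pushes. An additive homomorphism $\varphi:B\to C$ of $G$-modules is $G$-finitary if there is a $G$-map $\Phi:B\to fC$ with $\varphi(b)\in\Phi(b)$ for all $b\in B$. For $\varphi:\mathbf F^{(n)}\to\mathbf F^{(n)}$ additive and $\gamma(\infty)=e$, $\mathrm{gsh}_e(\varphi)=\inf\{v_\gamma(\varphi(c))-v_\gamma(c)\mid 0\ne c\in \mathbf F^{(n)}\}$ (independent of the ray $\gamma$ with endpoint $e$); $\varphi$ pushes $\mathbf F^{(n)}$ towards $e$ if $\mathrm{gsh}_e(\varphi)>0$. A chain map $\varphi$ induces $\mathrm{id}_A$ if $\epsilon\varphi=\epsilon$ on $F_0$. Invariants. Choose $\mathbf F\twoheadrightarrow A$ with $\mathbf F^{(n)}$ finitely generated and a control map $h$ (the invariants do not depend on these choices). ${}^{\circ}\Sigma^n(M;A)$ is the set of $e\in\partial M$ for which there is a $G$-finitary chain map $\mathbf F^{(n)}\to\mathbf F^{(n)}$ inducing $\mathrm{id}_A$ and pushing $\mathbf F^{(n)}$ towards $e$. $\mathbf F\twoheadrightarrow A$ is $CA^{m-1}$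 over $e=\gamma(\infty)$ if for every real $s$ there is $\lambda(s)\ge0$, with $s-\lambda(s)\to+\infty$ as $s\to+\infty$, such that for $-1\le i\le m-1$ every $i$-cycle $z$ of the augmented complex $\mathbf F\to A$ with $v_\gamma(z)\ge s$ is the boundary of an $(i+1)$-chain $c$ with $v_\gamma(c)\ge s-\lambda(s)$ (degree $-1$ being $A$, with boundary $\epsilon:F_0\to A$). $\Sigma^n(M;A)$ is the set of $e\in\partial M$ such that $\mathbf F\twoheadrightarrow A$ is $CA^{k}$ over $e$ for all $k$ with $-1\le k<n$. *)

theory Defs
  imports
    "HOL-Analysis.Analysis"
    "HOL-Algebra.Group_Action"
    "HOL-Library.Poly_Mapping"
begin

section \<open>CAT(0) spaces and their boundary\<close>

definition geodesic_path :: "(real \<Rightarrow> 'm::metric_space) \<Rightarrow> 'm \<Rightarrow> 'm \<Rightarrow> bool" where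
  "geodesic_path c x y \<longleftrightarrow> c 0 = x \<and> c (dist x y) = y \<and>
     (\<forall>s\<in>{0..dist x y}. \<forall>t\<in>{0..dist x y}. dist (c s) (c t) = \<bar>s - t\<bar>)"

text \<open>
  A geodesic triangle with vertices \<open>p\<close>, \<open>q\<close>, \<open>r\<close> has a comparison triangle \<open>p'\<close>, \<open>q'\<close>, \<open>r'\<close>
  in the Euclidean plane. Two different sides share a vertex, which we call \<open>p\<close>, and both are
  parametrised by the distance from \<open>p\<close>. A point \<open>x'\<close> of the side from \<open>p'\<close> to \<open>q'\<close> is then
  the comparison point of \<open>c1 (dist p' x')\<close>. For two points on the same side
  the comparison inequality is an equality. The third side plays no role in the inequality.
\<close>

definition CAT0 :: "'m::metric_space itself \<Rightarrow> bool" where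
  "CAT0 _ \<longleftrightarrow>
     (\<forall>x y :: 'm. \<exists>c. geodesic_path c x y) \<and>
     (\<forall>(p :: 'm) q r c1 c2 (p' :: real^2) q' r'.
        geodesic_path c1 p q \<and> geodesic_path c2 p r \<and>
        dist p' q' = dist p q \<and> dist p' r' = dist p r \<and> dist q' r' = dist q r \<longrightarrow>
        (\<forall>x'\<in>closed_segment p' q'. \<forall>y'\<in>closed_segment p' r'.
           dist (c1 (dist p' x')) (c2 (dist p' y')) \<le> dist x' y'))"

definition proper_space :: "'m::metric_space itself \<Rightarrow> bool" where
  "proper_space _ \<longleftrightarrow> (\<forall>(x :: 'm) r. compact (cball x r))"

text \<open>Only the values on \<open>[0, \<infinity>)\<close> of a ray matter here and below.\<close>

definition geodesic_ray :: "(real \<Rightarrow> 'm::metric_space) \<Rightarrow> bool" where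
  "geodesic_ray c \<longleftrightarrow> (\<forall>s\<ge>0. \<forall>t\<ge>0. dist (c s) (c t) = \<bar>s - t\<bar>)"

definition asymptotic :: "((real \<Rightarrow> 'm::metric_space) \<times> (real \<Rightarrow> 'm)) set" where
  "asymptotic = {(c, c'). geodesic_ray c \<and> geodesic_ray c' \<and>
     (\<exists>K. \<forall>t\<ge>0. dist (c t) (c' t) \<le> K)}"

text \<open>A boundary point \<open>e\<close> is the set of all rays with endpoint \<open>e\<close>.\<close>

definition visual_boundary :: "(real \<Rightarrow> 'm::metric_space) set set" where
  "visual_boundary = Collect geodesic_ray // asymptotic"

text \<open>
  In a complete CAT(0) space every boundary point is represented by exactly one ray
  from the base point \<open>x0\<close>, and the topology does not depend on \<open>x0\<close>.
\<close>

definition cone_nbhd :: "'m::metric_space \<Rightarrow> (real \<Rightarrow> 'm) \<Rightarrow> real \<Rightarrow> real \<Rightarrow> (real \<Rightarrow> 'm) set set" where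
  "cone_nbhd x0 c r \<delta> =
     {e \<in> visual_boundary. \<exists>c'\<in>e. c' 0 = x0 \<and> dist (c' r) (c r) < \<delta>}"

definition cone_topology :: "'m::metric_space \<Rightarrow> (real \<Rightarrow> 'm) set topology" where
  "cone_topology x0 = topology_generated_by
     {cone_nbhd x0 c r \<delta> | c r \<delta>. geodesic_ray c \<and> c 0 = x0 \<and> r > 0 \<and> \<delta> > 0}"

definition busemann :: "(real \<Rightarrow> 'm::metric_space) \<Rightarrow> 'm \<Rightarrow> real" where
  "busemann \<gamma> x = Lim at_top (\<lambda>t. t - dist x (\<gamma> t))"

definition isometric_action :: "('g, 'b) monoid_scheme \<Rightarrow> ('g \<Rightarrow> 'm::metric_space \<Rightarrow> 'm) \<Rightarrow> bool" where
  "isometric_action G \<rho> \<longleftrightarrow> group_action G UNIV \<rho> \<and>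
     (\<forall>g\<in>carrier G. \<forall>x y. dist (\<rho> g x) (\<rho> g y) = dist x y)"

definition boundary_action ::
    "('g \<Rightarrow> 'm \<Rightarrow> 'm) \<Rightarrow> 'g \<Rightarrow> (real \<Rightarrow> 'm) set \<Rightarrow> (real \<Rightarrow> 'm) set" where
  "boundary_action \<rho> g e = (\<lambda>c. \<rho> g \<circ> c) ` e"


section \<open>Modules over the integral group ring\<close>

text \<open>
  A (left) module over the integral group ring of \<open>G\<close> is an abelian group
  on which \<open>G\<close> acts by automorphisms. Elements of the group ring are finitely
  supported functions \<open>G \<rightarrow> \<int>\<close>, and \<open>zg_smult\<close> is their action.
\<close>

definition G_module :: "('g, 'b) monoid_scheme \<Rightarrow> ('g \<Rightarrow> 'a::ab_group_add \<Rightarrow> 'a) \<Rightarrow> bool" where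
  "G_module G act \<longleftrightarrow> group_action G UNIV act \<and>
     (\<forall>g\<in>carrier G. \<forall>a b. act g (a + b) = act g a + act g b)"

definition int_scale :: "int \<Rightarrow> 'a::ab_group_add \<Rightarrow> 'a" where
  "int_scale k a = (if k \<ge> 0 then (\<Sum>i<nat k. a) else - (\<Sum>i<nat (- k). a))"

definition zg_smult :: "('g \<Rightarrow> 'a::ab_group_add \<Rightarrow> 'a) \<Rightarrow> ('g \<Rightarrow>\<^sub>0 int) \<Rightarrow> 'a \<Rightarrow> 'a" where
  "zg_smult act r a = (\<Sum>g\<in>Poly_Mapping.keys r. int_scale (Poly_Mapping.lookup r g) (act g a))"

definition zg_coeffs :: "('g, 'b) monoid_scheme \<Rightarrow> 'a set \<Rightarrow> ('a \<Rightarrow>\<^sub>0 ('g \<Rightarrow>\<^sub>0 int)) set" where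
  "zg_coeffs G S = {r. Poly_Mapping.keys r \<subseteq> S \<and>
     (\<forall>x. Poly_Mapping.keys (Poly_Mapping.lookup r x) \<subseteq> carrier G)}"

definition zg_comb :: "('g \<Rightarrow> 'a::ab_group_add \<Rightarrow> 'a) \<Rightarrow> ('a \<Rightarrow>\<^sub>0 ('g \<Rightarrow>\<^sub>0 int)) \<Rightarrow> 'a" where
  "zg_comb act r = (\<Sum>x\<in>Poly_Mapping.keys r. zg_smult act (Poly_Mapping.lookup r x) x)"

definition zg_span :: "('g, 'b) monoid_scheme \<Rightarrow> ('g \<Rightarrow> 'a::ab_group_add \<Rightarrow> 'a) \<Rightarrow> 'a set \<Rightarrow> 'a set" where
  "zg_span G act S = zg_comb act ` zg_coeffs G S"

definition zg_basis ::
    "('g, 'b) monoid_scheme \<Rightarrow> ('g \<Rightarrow> 'a::ab_group_add \<Rightarrow> 'a) \<Rightarrow> 'a set \<Rightarrow> 'a set \<Rightarrow> bool" where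
  "zg_basis G act S B \<longleftrightarrow> bij_betw (zg_comb act) (zg_coeffs G S) B"

definition zg_fin_gen ::
    "('g, 'b) monoid_scheme \<Rightarrow> ('g \<Rightarrow> 'a::ab_group_add \<Rightarrow> 'a) \<Rightarrow> 'a set \<Rightarrow> bool" where
  "zg_fin_gen G act B \<longleftrightarrow> (\<exists>S. finite S \<and> zg_span G act S = B)"

definition additive_on :: "'a::ab_group_add set \<Rightarrow> ('a \<Rightarrow> 'c::ab_group_add) \<Rightarrow> bool" where
  "additive_on B f \<longleftrightarrow> (\<forall>b\<in>B. \<forall>b'\<in>B. f (b + b') = f b + f b')"

definition G_map_on ::
    "('g, 'b) monoid_scheme \<Rightarrow> ('g \<Rightarrow> 'c \<Rightarrow> 'c) \<Rightarrow> ('g \<Rightarrow> 'd \<Rightarrow> 'd) \<Rightarrow> 'c set \<Rightarrow> ('c \<Rightarrow> 'd) \<Rightarrow> bool" where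
  "G_map_on G act act' B f \<longleftrightarrow> (\<forall>g\<in>carrier G. \<forall>b\<in>B. f (act g b) = act' g (f b))"

text \<open>\<open>G\<close> acts on finite sets by taking images.\<close>

definition G_finitary ::
    "('g, 'b) monoid_scheme \<Rightarrow> ('g \<Rightarrow> 'c::ab_group_add \<Rightarrow> 'c) \<Rightarrow> ('g \<Rightarrow> 'd::ab_group_add \<Rightarrow> 'd) \<Rightarrow>
     'c set \<Rightarrow> 'd set \<Rightarrow> ('c \<Rightarrow> 'd) \<Rightarrow> bool" where
  "G_finitary G act act' B C \<phi> \<longleftrightarrow> additive_on B \<phi> \<and> \<phi> \<in> B \<rightarrow> C \<and>
     (\<exists>\<Phi>. (\<forall>b\<in>B. finite (\<Phi> b) \<and> \<Phi> b \<subseteq> C \<and> \<phi> b \<in> \<Phi> b) \<and>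
          G_map_on G act (\<lambda>g. image (act' g)) B \<Phi>)"


section \<open>Based free resolutions and control maps\<close>

text \<open>
  The type \<open>'f\<close> is the total module, the direct sum of the chain modules.
  It carries the \<open>G\<close>-action \<open>res_act\<close>, and \<open>res_basis k\<close> is the chosen basis in degree \<open>k\<close>.
  The augmentation is only relevant on the chains of degree 0.
\<close>

record ('g, 'f, 'a) based_complex =
  res_act :: "'g \<Rightarrow> 'f \<Rightarrow> 'f"
  res_basis :: "nat \<Rightarrow> 'f set"
  res_bd :: "'f \<Rightarrow> 'f"
  res_aug :: "'f \<Rightarrow> 'a"

definition chains ::
    "('g, 'b) monoid_scheme \<Rightarrow> ('g, 'f::ab_group_add, 'a) based_complex \<Rightarrow> nat \<Rightarrow> 'f set" where
  "chains G R k = zg_span G (res_act R) (res_basis R k)"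

definition skeleton ::
    "('g, 'b) monoid_scheme \<Rightarrow> ('g, 'f::ab_group_add, 'a) based_complex \<Rightarrow> nat \<Rightarrow> 'f set" where
  "skeleton G R n = zg_span G (res_act R) (\<Union>k\<le>n. res_basis R k)"

definition cycles ::
    "('g, 'b) monoid_scheme \<Rightarrow> ('g, 'f::ab_group_add, 'a::ab_group_add) based_complex \<Rightarrow> nat \<Rightarrow> 'f set" where
  "cycles G R i = {z \<in> chains G R i. if i = 0 then res_aug R z = 0 else res_bd R z = 0}"

text \<open>
  The second and third conjuncts say that the total module is the direct sum of
  the chain modules and that these are free on the chosen bases.
  The last two conjuncts are admissibility.
\<close>

definition based_free_resolution ::
    "('g, 'b) monoid_scheme \<Rightarrow> ('g \<Rightarrow> 'a::ab_group_add \<Rightarrow> 'a) \<Rightarrow>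
     ('g, 'f::ab_group_add, 'a) based_complex \<Rightarrow> bool" where
  "based_free_resolution G act R \<longleftrightarrow>
     G_module G (res_act R) \<and>
     disjoint_family (res_basis R) \<and>
     zg_basis G (res_act R) (\<Union>k. res_basis R k) UNIV \<and>
     additive_on UNIV (res_bd R) \<and>
     G_map_on G (res_act R) (res_act R) UNIV (res_bd R) \<and>
     (\<forall>c\<in>chains G R 0. res_bd R c = 0) \<and>
     (\<forall>k. res_bd R ` chains G R (Suc k) = cycles G R k) \<and>
     additive_on (chains G R 0) (res_aug R) \<and>
     G_map_on G (res_act R) act (chains G R 0) (res_aug R) \<and>
     res_aug R ` chains G R 0 = UNIV \<and>
     (\<forall>k\<ge>1. \<forall>x\<in>res_basis R k. res_bd R x \<noteq> 0) \<and>
     (\<forall>x\<in>res_basis R 0. res_aug R x \<noteq> 0)"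

text \<open>
  A module has type \<open>FP\<^sub>n\<close> iff it has such a resolution (in some type \<open>'f\<close>).
\<close>

definition FP_resolution ::
    "nat \<Rightarrow> ('g, 'b) monoid_scheme \<Rightarrow> ('g \<Rightarrow> 'a::ab_group_add \<Rightarrow> 'a) \<Rightarrow>
     ('g, 'f::ab_group_add, 'a) based_complex \<Rightarrow> bool" where
  "FP_resolution n G act R \<longleftrightarrow>
     based_free_resolution G act R \<and> zg_fin_gen G (res_act R) (skeleton G R n)"

text \<open>
  Expanding \<open>c\<close> as a combination of basis elements \<open>x\<close> with coefficients \<open>r x\<close> in the group ring
  and then each \<open>r x\<close> as a combination of group elements gives the expansion of \<open>c\<close>
  in the induced \<open>\<int>\<close>-basis of all translates \<open>g x\<close>.
\<close>

definition basis_expansion ::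
    "('g, 'b) monoid_scheme \<Rightarrow> ('g, 'f::ab_group_add, 'a) based_complex \<Rightarrow> 'f \<Rightarrow> ('f \<Rightarrow>\<^sub>0 ('g \<Rightarrow>\<^sub>0 int))" where
  "basis_expansion G R =
     the_inv_into (zg_coeffs G (\<Union>k. res_basis R k)) (zg_comb (res_act R))"

definition supp ::
    "('g, 'b) monoid_scheme \<Rightarrow> ('g, 'f::ab_group_add, 'a) based_complex \<Rightarrow> 'f \<Rightarrow> 'f set" where
  "supp G R c = {res_act R g x | g x.
     Poly_Mapping.lookup (Poly_Mapping.lookup (basis_expansion G R c) x) g \<noteq> 0}"

definition control_map ::
    "('g, 'b) monoid_scheme \<Rightarrow> ('g \<Rightarrow> 'm \<Rightarrow> 'm) \<Rightarrow> ('g, 'f::ab_group_add, 'a) based_complex \<Rightarrow>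
     ('f \<Rightarrow> 'm set) \<Rightarrow> bool" where
  "control_map G \<rho> R h \<longleftrightarrow>
     (\<forall>c. finite (h c)) \<and>
     G_map_on G (res_act R) (\<lambda>g. image (\<rho> g)) UNIV h \<and>
     (\<forall>c. h c = (\<Union>y\<in>supp G R c. h y)) \<and>
     (\<forall>k. \<forall>x\<in>res_basis R k. h x \<noteq> {})"


section \<open>The invariants\<close>

definition valuation ::
    "('f::ab_group_add \<Rightarrow> 'm::metric_space set) \<Rightarrow> (real \<Rightarrow> 'm) \<Rightarrow> 'f \<Rightarrow> ereal" where
  "valuation h \<gamma> c = (if c = 0 then \<infinity> else ereal (Min (busemann \<gamma> ` h c)))"

definition gsh ::
    "('g, 'b) monoid_scheme \<Rightarrow> ('g, 'f::ab_group_add, 'a) based_complex \<Rightarrow>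
     ('f \<Rightarrow> 'm::metric_space set) \<Rightarrow> nat \<Rightarrow> (real \<Rightarrow> 'm) \<Rightarrow> ('f \<Rightarrow> 'f) \<Rightarrow> ereal" where
  "gsh G R h n \<gamma> \<phi> =
     (INF c\<in>skeleton G R n - {0}. valuation h \<gamma> (\<phi> c) - valuation h \<gamma> c)"

definition skeleton_chain_map ::
    "('g, 'b) monoid_scheme \<Rightarrow> ('g, 'f::ab_group_add, 'a) based_complex \<Rightarrow> nat \<Rightarrow> ('f \<Rightarrow> 'f) \<Rightarrow> bool" where
  "skeleton_chain_map G R n \<phi> \<longleftrightarrow>
     additive_on (skeleton G R n) \<phi> \<and>
     (\<forall>k\<le>n. \<phi> \<in> chains G R k \<rightarrow> chains G R k) \<and>
     (\<forall>c\<in>skeleton G R n. res_bd R (\<phi> c) = \<phi> (res_bd R c))"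

text \<open>
  Rays with the same endpoint have Busemann functions that differ by a constant, so the
  conditions on \<open>\<gamma>\<close> below do not depend on the choice of the ray \<open>\<gamma>\<close> in the (nonempty) class \<open>e\<close>.
\<close>

definition Sigma_circ ::
    "nat \<Rightarrow> ('g, 'b) monoid_scheme \<Rightarrow> ('g, 'f::ab_group_add, 'a) based_complex \<Rightarrow>
     ('f \<Rightarrow> 'm::metric_space set) \<Rightarrow> (real \<Rightarrow> 'm) set set" where
  "Sigma_circ n G R h = {e \<in> visual_boundary. \<exists>\<phi>.
     G_finitary G (res_act R) (res_act R) (skeleton G R n) (skeleton G R n) \<phi> \<and>
     skeleton_chain_map G R n \<phi> \<and>
     (\<forall>c\<in>chains G R 0. res_aug R (\<phi> c) = res_aug R c) \<and>
     (\<forall>\<gamma>\<in>e. gsh G R h n \<gamma> \<phi> > 0)}"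

text \<open>
  Controlled acyclicity in degrees \<open>-1, \<dots>, k\<close>, for \<open>k \<ge> -1\<close>. Degree \<open>-1\<close> is the first
  clause after \<open>\<forall>s\<close>: every element of the module is a cycle, of valuation \<open>\<infinity>\<close>.
\<close>

definition controlled_acyclic ::
    "int \<Rightarrow> ('g, 'b) monoid_scheme \<Rightarrow> ('g, 'f::ab_group_add, 'a::ab_group_add) based_complex \<Rightarrow>
     ('f \<Rightarrow> 'm::metric_space set) \<Rightarrow> (real \<Rightarrow> 'm) \<Rightarrow> bool" where
  "controlled_acyclic k G R h \<gamma> \<longleftrightarrow>
     (\<exists>l :: real \<Rightarrow> real. (\<forall>s. l s \<ge> 0) \<and> filterlim (\<lambda>s. s - l s) at_top at_top \<and>
       (\<forall>s. (\<forall>a. \<exists>c\<in>chains G R 0. res_aug R c = a \<and> valuation h \<gamma> c \<ge> ereal (s - l s)) \<and>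
            (\<forall>i. int i \<le> k \<longrightarrow> (\<forall>z\<in>cycles G R i. valuation h \<gamma> z \<ge> ereal s \<longrightarrow>
               (\<exists>c\<in>chains G R (Suc i). res_bd R c = z \<and> valuation h \<gamma> c \<ge> ereal (s - l s))))))"

definition Sigma_inv ::
    "nat \<Rightarrow> ('g, 'b) monoid_scheme \<Rightarrow> ('g, 'f::ab_group_add, 'a::ab_group_add) based_complex \<Rightarrow>
     ('f \<Rightarrow> 'm::metric_space set) \<Rightarrow> (real \<Rightarrow> 'm) set set" where
  "Sigma_inv n G R h = {e \<in> visual_boundary.
     \<forall>k. -1 \<le> k \<and> k < int n \<longrightarrow> (\<forall>\<gamma>\<in>e. controlled_acyclic k G R h \<gamma>)}"

end

theory Submission
  imports Defs
begin

text \<open>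
  Both sides are governed by the set of Busemann functions of the rays with endpoint in the closure of
  the orbit \<open>Ge\<close>. In a proper CAT(0) space the cone topology is the topology of pointwise convergence
  of Busemann functions up to constants, and the set is compact in the sense of a finite subcover.

  If \<open>\<phi>\<close> pushes towards \<open>e\<close>, then its conjugates push towards the points of \<open>Ge\<close> and take their values in
  the same finite sets. A chain homotopy \<open>\<sigma>\<close> from \<open>\<phi>\<close> to the identity shows that a cycle \<open>z\<close> differs from
  \<open>\<phi>\<^sup>N z\<close> by the boundary of \<open>\<Sum>j<N. \<sigma> (\<phi>\<^sup>j z)\<close>, whose lag is bounded independently of \<open>N\<close>; and \<open>\<phi>\<^sup>N z\<close> is the
  boundary of \<open>\<phi>\<^sup>N c\<close>, which is high for large \<open>N\<close>, for any \<open>c\<close> with boundary \<open>z\<close>. Only finitely many chains can occur,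
  so the conclusion passes to limits of points of \<open>Ge\<close>.

  Conversely a pushing map is built degree by degree, simultaneously for all points of the closure.
  A map pushing in degrees up to \<open>k\<close> makes the lag of fillings of \<open>k\<close>-cycles uniform, by the same homotopy
  argument. After replacing the map by a power, its values on the boundaries of the basis elements of degree
  \<open>k + 1\<close> have high fillings, and by compactness finitely many of them suffice.
\<close>

section \<open>Busemann functions in CAT(0) spaces\<close>

text \<open>The values of a finitary map on the translates \<open>g x\<close> of a basis element
  \<open>x\<close> may be chosen independently, as long as each lies in the
  \<open>g\<close>-translate of one finite set attached to \<open>x\<close>. Being pushed at
  \<open>g x\<close> over \<open>\<beta>\<close> is the same as being pushed at \<open>x\<close>
  over \<open>\<beta> \<circ> \<rho> g\<close>. A map that pushes towards \<open>e\<close> therefore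
  needs finitely many candidates at \<open>x\<close> that serve all functions of the orbit, and
  compactness, which provides finitely many, is available for the closure of the orbit; this is how
  the closure enters. The obstacle is uniformity: controlled acyclicity gives every Busemann
  function its own lag function and says nothing about neighbouring functions. Compactness can be
  applied to fillings only when one lag serves all functions. For this reason the finite sets
  \<open>\<Phi>\<close> are kept apart from the maps that select from them: one
  \<open>\<Phi>\<close>, and with it one bound for the homotopies, serves the maps belonging to all
  points of the closure.\<close>

lemma norm_real2: "norm (v :: real^2) = sqrt ((v$1)\<^sup>2 + (v$2)\<^sup>2)"
  by (simp add: norm_vec_def L2_set_def UNIV_2)

text \<open>Put \<open>p\<close> at the origin and \<open>q\<close> at \<open>(a, 0)\<close>. The
  law of cosines forces the first coordinate \<open>u\<close> of \<open>r\<close>, and the triangle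
  inequalities give \<open>\<bar>u\<bar> \<le> b\<close>, so that a second coordinate
  exists.\<close>

lemma comparison_triangle:
  fixes a b c :: real
  assumes "0 \<le> a" "0 \<le> b" "0 \<le> c" "c \<le> a + b" "a \<le> b + c" "b \<le> a + c"
  obtains p q r :: "real^2" where "dist p q = a" "dist p r = b" "dist q r = c"
proof (cases "a = 0")
  case True
  then have "b = c" using assms by simp
  have "dist (0::real^2) (vector [b, 0]) = b"
    using assms by (simp add: dist_norm norm_real2)
  then show ?thesis using that[of 0 0 "vector [b,0]"] True \<open>b = c\<close> by simp
next
  case False
  then have a: "a > 0" using assms by simp
  define u where "u = (a\<^sup>2 + b\<^sup>2 - c\<^sup>2) / (2 * a)"
  have ua: "2 * a * u = a\<^sup>2 + b\<^sup>2 - c\<^sup>2" using a by (simp add: u_def)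
  have "(a - b)\<^sup>2 \<le> c\<^sup>2" using assms by (intro abs_le_square_iff[THEN iffD1]) auto
  then have "2 * a * u \<le> 2 * a * b" using ua by (simp add: power2_diff)
  then have u1: "u \<le> b" using a by simp
  have "c\<^sup>2 \<le> (a + b)\<^sup>2" using assms by (intro power_mono) auto
  then have "2 * a * (- b) \<le> 2 * a * u" using ua by (simp add: power2_sum)
  then have u2: "- b \<le> u" using a by (subst (asm) mult_le_cancel_left_pos) auto
  have ub: "u\<^sup>2 \<le> b\<^sup>2" using u1 u2 by (intro abs_le_square_iff[THEN iffD1]) auto
  define r :: "real^2" where "r = vector [u, sqrt (b\<^sup>2 - u\<^sup>2)]"
  have "dist 0 r = b" using ub assms by (simp add: dist_norm norm_real2 r_def)
  moreover have "dist (vector [a, 0]) r = c"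
  proof -
    have "(a - u)\<^sup>2 + (b\<^sup>2 - u\<^sup>2) = c\<^sup>2"
      using ua by (simp add: power2_diff)
    then show ?thesis using ub assms by (simp add: dist_norm norm_real2 r_def)
  qed
  moreover have "dist 0 (vector [a, 0] :: real^2) = a"
    using assms by (simp add: dist_norm norm_real2)
  ultimately show ?thesis using that by blast
qed

lemma geodesic_ray_dist: "geodesic_ray c \<Longrightarrow> 0 \<le> s \<Longrightarrow> 0 \<le> t \<Longrightarrow> dist (c s) (c t) = \<bar>s - t\<bar>"
  by (simp add: geodesic_ray_def)

lemma geodesic_path_reverse:
  assumes "geodesic_path c x y"
  shows "geodesic_path (\<lambda>u. c (dist x y - u)) y x"
  using assms unfolding geodesic_path_def by (auto simp: dist_commute)

lemma geodesic_ray_segment: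
  assumes "geodesic_ray c" "T \<ge> 0"
  shows "geodesic_path c (c 0) (c T)"
  using assms unfolding geodesic_path_def geodesic_ray_def by auto

locale proper_CAT0 =
  fixes ty :: "'m::metric_space itself"
  assumes CAT0: "CAT0 TYPE('m)" and proper: "proper_space TYPE('m)"
begin

lemma ex_geodesic: "\<exists>c. geodesic_path c (x::'m) y"
  using CAT0 unfolding CAT0_def by blast

text \<open>The squared distance of the comparison points, expanded by the law of cosines. After
  this the arguments need only side lengths and no points of the plane.\<close>

lemma CAT0_inequality:
  fixes p q r :: 'm
  assumes "geodesic_path c1 p q" "geodesic_path c2 p r" "0 \<le> s" "s \<le> 1" "0 \<le> t" "t \<le> 1"
  shows "(dist (c1 (s * dist p q)) (c2 (t * dist p r)))\<^sup>2 \<le>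
    s\<^sup>2 * (dist p q)\<^sup>2 + t\<^sup>2 * (dist p r)\<^sup>2 - s * t * ((dist p q)\<^sup>2 + (dist p r)\<^sup>2 - (dist q r)\<^sup>2)"
proof -
  obtain p' q' r' :: "real^2"
    where d: "dist p' q' = dist p q" "dist p' r' = dist p r" "dist q' r' = dist q r"
    by (rule comparison_triangle[of "dist p q" "dist p r" "dist q r"])
       (use dist_triangle[of q r p] dist_triangle[of p q r] dist_triangle[of p r q] in
         \<open>simp_all add: dist_commute add.commute\<close>)
  define u v where "u = q' - p'" and "v = r' - p'"
  define x' y' where "x' = p' + s *\<^sub>R u" and "y' = p' + t *\<^sub>R v"
  have nu: "norm u = dist p q" "norm v = dist p r" "norm (u - v) = dist q r"
    using d by (simp_all add: u_def v_def dist_norm norm_minus_commute)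
  have x: "x' \<in> closed_segment p' q'" "dist p' x' = s * dist p q"
  proof -
    have "x' = (1 - s) *\<^sub>R p' + s *\<^sub>R q'" by (simp add: x'_def u_def algebra_simps)
    then show "x' \<in> closed_segment p' q'" using assms by (auto simp: closed_segment_def)
    have "dist p' x' = norm (s *\<^sub>R u)" by (simp add: x'_def dist_norm)
    then show "dist p' x' = s * dist p q" using nu assms by simp
  qed
  have y: "y' \<in> closed_segment p' r'" "dist p' y' = t * dist p r"
  proof -
    have "y' = (1 - t) *\<^sub>R p' + t *\<^sub>R r'" by (simp add: y'_def v_def algebra_simps)
    then show "y' \<in> closed_segment p' r'" using assms by (auto simp: closed_segment_def)
    have "dist p' y' = norm (t *\<^sub>R v)" by (simp add: y'_def dist_norm)
    then show "dist p' y' = t * dist p r" using nu assms by simp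
  qed
  have "dist (c1 (dist p' x')) (c2 (dist p' y')) \<le> dist x' y'"
    using CAT0 assms(1,2) d x(1) y(1) unfolding CAT0_def by blast
  then have "(dist (c1 (s * dist p q)) (c2 (t * dist p r)))\<^sup>2 \<le> (dist x' y')\<^sup>2"
    unfolding x(2) y(2) by (intro power_mono) auto
  also have "\<dots> = (norm (s *\<^sub>R u - t *\<^sub>R v))\<^sup>2"
    by (simp add: x'_def y'_def dist_norm)
  also have "\<dots> = s\<^sup>2 * (norm u)\<^sup>2 + t\<^sup>2 * (norm v)\<^sup>2 - s * t * (2 * (u \<bullet> v))"
    unfolding power2_norm_eq_inner
    by (simp add: inner_diff_left inner_diff_right inner_commute power2_eq_square algebra_simps)
  also have "2 * (u \<bullet> v) = (norm u)\<^sup>2 + (norm v)\<^sup>2 - (norm (u - v))\<^sup>2"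
    unfolding power2_norm_eq_inner
    by (simp add: inner_diff_left inner_diff_right inner_commute)
  finally show ?thesis by (simp add: nu)
qed

text \<open>For equal proportions the sides at \<open>p\<close> cancel and the square of
  \<open>s * dist q r\<close> is left.\<close>

lemma geodesic_scaling:
  fixes p q r :: 'm
  assumes "geodesic_path c1 p q" "geodesic_path c2 p r" "0 \<le> s" "s \<le> 1"
  shows "dist (c1 (s * dist p q)) (c2 (s * dist p r)) \<le> s * dist q r"
proof -
  have "(dist (c1 (s * dist p q)) (c2 (s * dist p r)))\<^sup>2 \<le> (s * dist q r)\<^sup>2"
    using CAT0_inequality[OF assms assms(3,4)] by (simp add: power2_eq_square algebra_simps)
  then show ?thesis by (rule power2_le_imp_le) (use assms(3) in simp)
qed

lemma midpoint_inequality: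
  fixes p q r :: 'm
  assumes "geodesic_path c q r"
  shows "(dist p (c (dist q r / 2)))\<^sup>2 \<le> (dist p q)\<^sup>2 / 2 + (dist p r)\<^sup>2 / 2 - (dist q r)\<^sup>2 / 4"
proof -
  obtain c2 where c2: "geodesic_path c2 q p" using ex_geodesic by blast
  then have "c2 (dist q p) = p" by (simp add: geodesic_path_def)
  \<comment> \<open>The vertex of the triangle is \<open>q\<close>: the midpoint has proportion 1/2
    on one side, and \<open>p\<close> is the far end of the other.\<close>
  then show ?thesis using CAT0_inequality[OF assms c2, of "1/2" 1]
    by (simp add: dist_commute power2_eq_square algebra_simps)
qed

text \<open>\<open>dist z q - dist x q\<close> approximates a Busemann function normalised at
  \<open>z\<close>. The single point \<open>c r\<close> determines it up to an error that does not
  depend on how far away \<open>q\<close> is.\<close>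

lemma geodesic_busemann_estimate:
  fixes x z q :: 'm
  assumes c: "geodesic_path c z q" and r: "dist x z < r" "r \<le> dist z q"
  shows "r - dist x (c r) \<le> dist z q - dist x q"
    and "dist z q - dist x q \<le> r - dist x (c r) + (dist x z)\<^sup>2 / (r - dist x z)"
proof -
  define L D a f where "L = dist z q" and "D = dist x q" and "a = dist x z" and "f = dist x (c r)"
  have a: "0 \<le> a" "a < r" "r \<le> L" "L > 0" using r zero_le_dist[of x z]
    unfolding a_def L_def by linarith+
  have "dist (c r) q = L - r"
    using c a unfolding geodesic_path_def L_def[symmetric]
    by (smt (verit) atLeastAtMost_iff)
  then show "r - dist x (c r) \<le> dist z q - dist x q"
    using dist_triangle[of x q "c r"] by (simp add: L_def)
  obtain c2 where c2: "geodesic_path c2 z x" using ex_geodesic by blast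
  then have e: "c2 (dist z x) = x" by (simp add: geodesic_path_def)
  have "f\<^sup>2 \<le> (r/L)\<^sup>2 * L\<^sup>2 + a\<^sup>2 - (r/L) * (L\<^sup>2 + a\<^sup>2 - D\<^sup>2)"
  proof -
    have *: "r / L * dist z q = r" using a by (simp add: L_def)
    have "(dist (c (r / L * dist z q)) (c2 (1 * dist z x)))\<^sup>2 \<le>
        (r/L)\<^sup>2 * (dist z q)\<^sup>2 + 1\<^sup>2 * (dist z x)\<^sup>2 -
        (r/L) * 1 * ((dist z q)\<^sup>2 + (dist z x)\<^sup>2 - (dist q x)\<^sup>2)"
      using a by (intro CAT0_inequality c c2) simp_all
    then show ?thesis
      unfolding * mult_1 mult_1_right one_power2 e
      unfolding f_def L_def a_def D_def dist_commute[of x] .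
  qed
  then have "L * f\<^sup>2 \<le> L * ((r/L)\<^sup>2 * L\<^sup>2 + a\<^sup>2 - (r/L) * (L\<^sup>2 + a\<^sup>2 - D\<^sup>2))"
    using a by (intro mult_left_mono) auto
  also have "\<dots> = L * r\<^sup>2 + L * a\<^sup>2 - r * (L\<^sup>2 + a\<^sup>2 - D\<^sup>2)"
    using a by (simp add: field_simps power2_eq_square)
  finally have 1: "L * f\<^sup>2 \<le> L * r\<^sup>2 + L * a\<^sup>2 - r * (L\<^sup>2 + a\<^sup>2 - D\<^sup>2)" .
  \<comment> \<open>In terms of \<open>m\<close> the comparison inequality becomes
    \<open>f\<^sup>2 \<le> (D - m)\<^sup>2 + a\<^sup>2\<close>. Since
    \<open>D - m \<ge> r - a\<close>, the root exceeds \<open>D - m\<close> by at most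
    \<open>a\<^sup>2 / (r - a)\<close>.\<close>
  define m where "m = L - r"
  have rm: "r = L - m" by (simp add: m_def)
  have "L * (f\<^sup>2 - (D - m)\<^sup>2) \<le> m * a\<^sup>2 - m * (L - D)\<^sup>2"
    using 1 unfolding rm by (simp add: power2_eq_square algebra_simps)
  also have "\<dots> \<le> L * a\<^sup>2"
  proof -
    have "m * a\<^sup>2 \<le> L * a\<^sup>2" using a by (intro mult_right_mono) (auto simp: m_def)
    moreover have "0 \<le> m * (L - D)\<^sup>2" using a by (simp add: m_def)
    ultimately show ?thesis by simp
  qed
  finally have f2: "f\<^sup>2 \<le> (D - m)\<^sup>2 + a\<^sup>2"
    using a by (subst (asm) mult_le_cancel_left_pos) auto
  have "L \<le> a + D" using dist_triangle[of z q x] by (simp add: L_def a_def D_def dist_commute)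
  then have w: "D - m \<ge> r - a" by (simp add: m_def)
  define e where "e = a\<^sup>2 / (r - a)"
  have e0: "e \<ge> 0" and er: "(r - a) * e = a\<^sup>2" using a by (auto simp: e_def)
  have "a\<^sup>2 \<le> (D - m) * e" using mult_right_mono[OF w e0] er by simp
  moreover have "(D - m + e)\<^sup>2 = (D - m)\<^sup>2 + 2 * ((D - m) * e) + e\<^sup>2"
    by (simp add: power2_eq_square algebra_simps)
  ultimately have "f\<^sup>2 \<le> (D - m + e)\<^sup>2" using f2 zero_le_power2[of a] zero_le_power2[of e] by linarith
  moreover have "0 \<le> D - m + e" using w a e0 by linarith
  ultimately have "f \<le> D - m + e" by (rule power2_le_imp_le)
  then show "dist z q - dist x q \<le> r - dist x (c r) + (dist x z)\<^sup>2 / (r - dist x z)"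
    by (simp add: e_def m_def f_def L_def D_def a_def)
qed

end

section \<open>Convergence of Busemann functions, and their values near a ray\<close>

lemma geodesic_ray_mono:
  assumes "geodesic_ray \<gamma>" "0 \<le> s" "s \<le> t"
  shows "s - dist x (\<gamma> s) \<le> t - dist x (\<gamma> t)"
  using geodesic_ray_dist[OF assms(1), of s t] dist_triangle[of x "\<gamma> t" "\<gamma> s"] assms by simp

text \<open>The expression is nondecreasing in \<open>t\<close> and bounded by
  \<open>dist x (\<gamma> 0)\<close>, so it converges to its supremum. As \<open>busemann\<close> is
  defined by \<open>Lim\<close>, convergence must be known before values can be estimated.\<close>

lemma busemann_tendsto:
  assumes "geodesic_ray \<gamma>"
  shows "((\<lambda>t. t - dist x (\<gamma> t)) \<longlongrightarrow> busemann \<gamma> x) at_top"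
proof -
  define f where "f t = t - dist x (\<gamma> t)" for t
  have b: "f t \<le> dist x (\<gamma> 0)" if "t \<ge> 0" for t
    using geodesic_ray_dist[OF assms, of 0 t] dist_triangle[of "\<gamma> 0" "\<gamma> t" x] that
    by (simp add: f_def dist_commute)
  have bdd: "bdd_above (f ` {0..})" using b by (intro bdd_aboveI2) auto
  have "(f \<longlongrightarrow> (SUP t\<in>{0..}. f t)) at_top"
  proof (rule increasing_tendsto)
    show "\<forall>\<^sub>F t in at_top. f t \<le> (SUP t\<in>{0..}. f t)"
      using eventually_ge_at_top[of 0] by eventually_elim (auto intro!: cSUP_upper bdd)
  next
    fix y assume "y < (SUP t\<in>{0..}. f t)"
    then obtain s where s: "s \<ge> 0" "y < f s" using less_cSUP_iff[OF _ bdd] by auto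
    show "\<forall>\<^sub>F t in at_top. y < f t"
      using eventually_ge_at_top[of s]
    proof eventually_elim
      case (elim t)
      then show ?case using s geodesic_ray_mono[OF assms, of s t x] by (simp add: f_def)
    qed
  qed
  then show ?thesis unfolding busemann_def f_def[symmetric]
    by (metis tendsto_Lim trivial_limit_at_top_linorder)
qed

lemma busemann_ge:
  assumes "geodesic_ray \<gamma>" "t \<ge> 0"
  shows "t - dist x (\<gamma> t) \<le> busemann \<gamma> x"
proof (rule tendsto_lowerbound[OF busemann_tendsto[OF assms(1)]])
  show "\<forall>\<^sub>F s in at_top. t - dist x (\<gamma> t) \<le> s - dist x (\<gamma> s)"
    using eventually_ge_at_top[of t] by eventually_elim (rule geodesic_ray_mono[OF assms])
qed simp

lemma busemann_lipschitz:
  assumes "geodesic_ray \<gamma>"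
  shows "busemann \<gamma> x \<le> busemann \<gamma> y + dist x y"
proof -
  have "((\<lambda>t. (t - dist y (\<gamma> t)) + dist x y) \<longlongrightarrow> busemann \<gamma> y + dist x y) at_top"
    by (intro tendsto_intros busemann_tendsto assms)
  moreover have "t - dist x (\<gamma> t) \<le> (t - dist y (\<gamma> t)) + dist x y" for t
    using dist_triangle[of y "\<gamma> t" x] by (simp add: dist_commute)
  ultimately show ?thesis
    by (intro tendsto_le[OF _ _ busemann_tendsto[OF assms, of x]]) 
       (auto intro!: always_eventually)
qed

lemma busemann_on_ray:
  assumes "geodesic_ray \<gamma>" "t \<ge> 0"
  shows "busemann \<gamma> (\<gamma> t) = t"
proof -
  have "((\<lambda>s. s - dist (\<gamma> t) (\<gamma> s)) \<longlongrightarrow> t) at_top"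
  proof (rule tendsto_eventually)
    show "\<forall>\<^sub>F s in at_top. s - dist (\<gamma> t) (\<gamma> s) = t"
      using eventually_ge_at_top[of t]
      by eventually_elim (use assms in \<open>simp add: geodesic_ray_dist\<close>)
  qed
  then show ?thesis using busemann_tendsto[OF assms(1)] 
    by (metis tendsto_unique trivial_limit_at_top_linorder)
qed

context proper_CAT0 begin

text \<open>With \<open>busemann_ge\<close> this pins the value at \<open>x\<close> to the single
  point \<open>\<gamma> t\<close>, with an error of order \<open>1 / t\<close>. The estimate for
  segments is uniform in the far end, so it survives the limit.\<close>

lemma busemann_estimate:
  fixes x :: 'm
  assumes "geodesic_ray \<gamma>" "dist x (\<gamma> 0) < t"
  shows "busemann \<gamma> x \<le> t - dist x (\<gamma> t) + (dist x (\<gamma> 0))\<^sup>2 / (t - dist x (\<gamma> 0))"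
proof -
  have t: "t \<ge> 0" using assms(2) zero_le_dist[of x "\<gamma> 0"] by linarith
  show ?thesis
  proof (rule tendsto_upperbound[OF busemann_tendsto[OF assms(1)]])
    show "\<forall>\<^sub>F s in at_top. s - dist x (\<gamma> s) \<le> t - dist x (\<gamma> t) + (dist x (\<gamma> 0))\<^sup>2 / (t - dist x (\<gamma> 0))"
      using eventually_ge_at_top[of t]
    proof eventually_elim
      case (elim s)
      have "dist (\<gamma> 0) (\<gamma> s) = s" using geodesic_ray_dist[OF assms(1), of 0 s] elim t by simp
      then show ?case
        using geodesic_busemann_estimate(2)[OF geodesic_ray_segment[OF assms(1), of s] assms(2)] elim t
        by simp
    qed
  qed simp
qed

end

section \<open>Compactness in the topology of pointwise convergence\<close>

lemma compact_Pi_UNIV: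
  fixes S :: "real \<Rightarrow> 'm::metric_space set"
  assumes "\<And>u. compact (S u)"
  shows "compact (Pi UNIV S)"
proof -
  have "compactin (product_topology (\<lambda>_. euclidean) (UNIV :: real set)) (Pi\<^sub>E UNIV S)"
    using assms by (simp add: compactin_PiE)
  then show ?thesis by (simp add: euclidean_product_topology PiE_UNIV_domain)
qed

text \<open>By Tychonoff the filter of \<open>F\<close> has a cluster point in the product of the
  sets \<open>S u\<close>. A cluster point does the work of a limit here, because equations and weak
  inequalities between coordinates define closed sets.\<close>

lemma pointwise_cluster_point:
  fixes F :: "real \<Rightarrow> real \<Rightarrow> 'm::metric_space"
  assumes "\<And>u. compact (S u)" "\<And>t u. F t u \<in> S u"
  obtains c where "\<And>Z. closed Z \<Longrightarrow> \<forall>\<^sub>F t in at_top. F t \<in> Z \<Longrightarrow> c \<in> Z"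
proof -
  have "filtermap F at_top \<noteq> bot" by (simp add: filtermap_bot_iff)
  moreover have "eventually (\<lambda>c. c \<in> Pi UNIV S) (filtermap F at_top)"
    using assms(2) by (auto simp: eventually_filtermap)
  ultimately obtain c where c: "inf (nhds c) (filtermap F at_top) \<noteq> bot"
    using compact_Pi_UNIV[of S] assms(1) unfolding compact_filter by blast
  have "c \<in> Z" if "closed Z" "\<forall>\<^sub>F t in at_top. F t \<in> Z" for Z
  proof (rule ccontr)
    assume "c \<notin> Z"
    then have "eventually (\<lambda>x. x \<in> - Z) (nhds c)"
      using that(1) by (intro eventually_nhds_in_open) auto
    moreover have "eventually (\<lambda>x. x \<in> Z) (filtermap F at_top)"
      using that(2) by (simp add: eventually_filtermap)
    ultimately have "eventually (\<lambda>x. False) (inf (nhds c) (filtermap F at_top))"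
      unfolding eventually_inf by blast
    then show False using c by (simp add: eventually_False)
  qed
  then show ?thesis using that by blast
qed

lemma closed_pointwise_dist_eq: "closed {c :: real \<Rightarrow> 'm::metric_space. dist (c s) (c t) = r}"
  by (intro closed_Collect_eq continuous_intros continuous_on_product_coordinates)

lemma closed_pointwise_eq: "closed {c :: real \<Rightarrow> 'm::metric_space. c t = y}"
  by (intro closed_Collect_eq continuous_intros continuous_on_product_coordinates)

lemma closed_pointwise_dist_le: "closed {c :: real \<Rightarrow> 'm::metric_space. dist (c t) y \<le> r}"
  by (intro closed_Collect_le continuous_intros continuous_on_product_coordinates)

context proper_CAT0 begin

text \<open>The geodesics from \<open>x0\<close> to \<open>\<gamma> t\<close> have their coordinates
  in compact balls and cluster at a ray. A ray is arbitrary at negative times; fixing it there will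
  make the set of rays from \<open>x0\<close> compact.\<close>

lemma ex_asymptotic_ray:
  fixes x0 :: 'm
  assumes \<gamma>: "geodesic_ray \<gamma>"
  shows "\<exists>c. geodesic_ray c \<and> c 0 = x0 \<and> (\<forall>t<0. c t = x0) \<and>
    (\<forall>t\<ge>0. dist (c t) (\<gamma> t) \<le> 2 * dist x0 (\<gamma> 0))"
proof -
  define a where "a = dist x0 (\<gamma> 0)"
  define L where "L t = dist x0 (\<gamma> t)" for t
  define g where "g t = (SOME c. geodesic_path c x0 (\<gamma> t))" for t
  have g: "geodesic_path (g t) x0 (\<gamma> t)" for t unfolding g_def by (rule someI_ex[OF ex_geodesic])
  define F where "F t u = (if 0 \<le> u \<and> u \<le> L t then g t u else x0)" for t u
  have Lt: "\<bar>L t - t\<bar> \<le> a" if "t \<ge> 0" for t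
    using geodesic_ray_dist[OF \<gamma>, of 0 t] that dist_triangle[of x0 "\<gamma> t" "\<gamma> 0"]
      dist_triangle[of "\<gamma> 0" "\<gamma> t" x0] by (simp add: L_def a_def dist_commute)
  have gd: "dist (g t u) (g t v) = \<bar>u - v\<bar>" if "0 \<le> u" "u \<le> L t" "0 \<le> v" "v \<le> L t" for t u v
    using g[of t] that unfolding geodesic_path_def L_def by auto
  have g0: "g t 0 = x0" for t using g[of t] by (simp add: geodesic_path_def)
  have F1: "compact (cball x0 \<bar>u\<bar>)" for u using proper by (simp add: proper_space_def)
  have F2: "F t u \<in> cball x0 \<bar>u\<bar>" for t u
    using gd[of 0 t u] g0[of t] by (auto simp: F_def)
  obtain c where c: "\<And>Z. closed Z \<Longrightarrow> \<forall>\<^sub>F t in at_top. F t \<in> Z \<Longrightarrow> c \<in> Z"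
    by (rule pointwise_cluster_point[where F = F and S = "\<lambda>u. cball x0 \<bar>u\<bar>"]) (use F1 F2 in auto)
  have ev: "\<forall>\<^sub>F t in at_top. u \<le> L t \<and> u \<le> t \<and> t > 0" for u
    using eventually_ge_at_top[of "u + a"] eventually_ge_at_top[of u] eventually_gt_at_top[of 0]
  proof eventually_elim
    case (elim t) then show ?case using Lt[of t] by linarith
  qed
  have "geodesic_ray c"
    unfolding geodesic_ray_def
  proof (intro allI impI)
    fix s t :: real assume st: "0 \<le> s" "0 \<le> t"
    have "c \<in> {c. dist (c s) (c t) = \<bar>s - t\<bar>}"
    proof (rule c[OF closed_pointwise_dist_eq])
      show "\<forall>\<^sub>F u in at_top. F u \<in> {c. dist (c s) (c t) = \<bar>s - t\<bar>}"
        using ev[of s] ev[of t] by eventually_elim (simp add: F_def st gd)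
    qed
    then show "dist (c s) (c t) = \<bar>s - t\<bar>" by simp
  qed
  moreover have F0: "c t = x0" if "t \<le> 0" for t
  proof -
    have "c \<in> {c. c t = x0}"
    proof (rule c[OF closed_pointwise_eq])
      have "F u \<in> {c. c t = x0}" for u using that g0[of u] by (cases "t = 0") (simp_all add: F_def)
      then show "\<forall>\<^sub>F u in at_top. F u \<in> {c. c t = x0}" by (intro always_eventually) blast
    qed
    then show ?thesis by simp
  qed
  moreover have "dist (c r) (\<gamma> r) \<le> 2 * a" if r: "r \<ge> 0" for r
  proof -
    have "c \<in> {c. dist (c r) (\<gamma> r) \<le> 2 * a}"
    proof (rule c[OF closed_pointwise_dist_le])
      show "\<forall>\<^sub>F t in at_top. F t \<in> {c. dist (c r) (\<gamma> r) \<le> 2 * a}"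
        using ev[of r]
      proof eventually_elim
        case (elim t)
        have dt: "dist (\<gamma> t) (\<gamma> 0) = t" using geodesic_ray_dist[OF \<gamma>, of t 0] elim by simp
        have dL: "dist (\<gamma> t) x0 = L t" by (simp add: L_def dist_commute)
        \<comment> \<open>Seen from \<open>\<gamma> t\<close>, this is the proportion at which the
          ray is at \<open>\<gamma> r\<close>. The geodesic \<open>g t\<close> is then at parameter
          \<open>L t * (r / t)\<close>, which differs from \<open>r\<close> by at most
          \<open>a\<close>; this accounts for the second \<open>a\<close> in the bound.\<close>
        define s where "s = 1 - r / t"
        have s: "0 \<le> s" "s \<le> 1" using elim r by (auto simp: s_def)
        have st: "t - s * t = r" using elim by (simp add: s_def left_diff_distrib)
        have sL: "L t - s * L t = L t * (r / t)" by (simp add: s_def left_diff_distrib)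
        have "dist (\<gamma> (t - s * t)) (g t (L t - s * L t)) \<le> s * dist (\<gamma> 0) x0"
        proof -
          have "geodesic_path (\<lambda>u. \<gamma> (dist (\<gamma> 0) (\<gamma> t) - u)) (\<gamma> t) (\<gamma> 0)"
            using elim by (intro geodesic_path_reverse geodesic_ray_segment \<gamma>) simp
          from geodesic_scaling[OF this geodesic_path_reverse[OF g[of t]] s]
          show ?thesis unfolding dist_commute[of "\<gamma> 0" "\<gamma> t"] dist_commute[of x0 "\<gamma> t"] dt dL .
        qed
        also have "\<dots> \<le> a" using s by (simp add: a_def dist_commute mult_left_le_one_le)
        finally have 1: "dist (\<gamma> r) (g t (L t * (r / t))) \<le> a" unfolding st sL .
        have rt: "0 \<le> r / t" "r / t \<le> 1" using elim r by auto
        have L0: "L t \<ge> 0" by (simp add: L_def)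
        have "dist (g t (L t * (r / t))) (g t r) = \<bar>L t * (r / t) - r\<bar>"
          by (rule gd[OF mult_nonneg_nonneg[OF L0 rt(1)] mult_left_le[OF rt(2) L0] r]) (use elim in simp)
        also have "L t * (r / t) - r = (r / t) * (L t - t)" using elim by (simp add: right_diff_distrib)
        also have "\<bar>(r / t) * (L t - t)\<bar> = (r / t) * \<bar>L t - t\<bar>" by (simp only: abs_mult abs_of_nonneg[OF rt(1)])
        also have "\<dots> \<le> 1 * a" using rt Lt[of t] elim by (intro mult_mono) auto
        finally have "dist (g t r) (\<gamma> r) \<le> 2 * a"
          using 1 dist_triangle[of "g t r" "\<gamma> r" "g t (L t * (r / t))"] by (simp add: dist_commute)
        then show ?case using elim r by (simp add: F_def)
      qed
    qed
    then show ?thesis by simp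
  qed
  ultimately show ?thesis by (intro exI[of _ c]) (simp add: a_def)
qed

text \<open>Both sides are compared with \<open>q\<close>, the value read off from
  \<open>\<gamma>' r\<close>. The geodesics from \<open>\<gamma>' 0\<close> to
  \<open>\<gamma> t\<close> pass \<open>\<gamma>' r\<close> at a distance that vanishes as
  \<open>t\<close> grows. The remaining error \<open>2 * (a\<^sup>2 / (r - a))\<close> vanishes as
  \<open>r\<close> grows.\<close>

lemma busemann_asymptotic:
  fixes x :: 'm
  assumes \<gamma>: "geodesic_ray \<gamma>" and \<gamma>': "geodesic_ray \<gamma>'"
    and K: "\<And>t. t \<ge> 0 \<Longrightarrow> dist (\<gamma> t) (\<gamma>' t) \<le> K"
  shows "busemann \<gamma> x = busemann \<gamma>' x + busemann \<gamma> (\<gamma>' 0)"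
proof -
  define z where "z = \<gamma>' 0"
  define a where "a = dist x z"
  define L where "L t = dist z (\<gamma> t)" for t
  define g where "g t = (SOME c. geodesic_path c z (\<gamma> t))" for t
  have g: "geodesic_path (g t) z (\<gamma> t)" for t unfolding g_def by (rule someI_ex[OF ex_geodesic])
  have a0: "a \<ge> 0" by (simp add: a_def)
  have Lt: "\<bar>t - L t\<bar> \<le> K" if "t \<ge> 0" for t
    using geodesic_ray_dist[OF \<gamma>', of 0 t] that K[OF that] dist_triangle[of z "\<gamma> t" "\<gamma>' t"]
      dist_triangle[of z "\<gamma>' t" "\<gamma> t"] by (simp add: L_def z_def dist_commute)
  have *: "\<bar>(busemann \<gamma> x - busemann \<gamma> z) - busemann \<gamma>' x\<bar> \<le> 2 * (a\<^sup>2 / (r - a))" if r: "r > a" for r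
  proof -
    define q where "q = r - dist x (\<gamma>' r)"
    define E where "E = a\<^sup>2 / (r - a)"
    have E0: "E \<ge> 0" using r by (simp add: E_def)
    have q: "q \<le> busemann \<gamma>' x" "busemann \<gamma>' x \<le> q + E"
      using busemann_ge[OF \<gamma>', of r x] busemann_estimate[OF \<gamma>', of x r] r a0
      by (auto simp: q_def E_def a_def z_def)
    have lim: "((\<lambda>t. (L t - dist x (\<gamma> t)) - q) \<longlongrightarrow> (busemann \<gamma> x - busemann \<gamma> z) - q) at_top"
    proof -
      have "((\<lambda>t. ((t - dist x (\<gamma> t)) - (t - dist z (\<gamma> t))) - q) \<longlongrightarrow> (busemann \<gamma> x - busemann \<gamma> z) - q) at_top"
        by (intro tendsto_intros busemann_tendsto \<gamma>)
      then show ?thesis by (simp add: L_def)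
    qed
    have bnd: "\<bar>(L t - dist x (\<gamma> t)) - q\<bar> \<le> E + 2 * K * r / L t"
      if t: "t \<ge> 0" "t \<ge> r + K" for t
    proof -
      have Lr: "L t \<ge> r" using Lt[OF t(1)] t by linarith
      have L0: "L t > 0" using Lr r a0 by linarith
      have e: "r - dist x (g t r) \<le> L t - dist x (\<gamma> t)" "L t - dist x (\<gamma> t) \<le> r - dist x (g t r) + E"
        using geodesic_busemann_estimate[OF g[of t], of x r] r Lr by (auto simp: L_def a_def E_def)
      have dL: "dist z (\<gamma>' (L t)) = L t"
        using geodesic_ray_dist[OF \<gamma>', of 0 "L t"] L0 by (simp add: z_def)
      \<comment> \<open>Two geodesics of length \<open>L t\<close> from \<open>z\<close> are
        compared. Their far ends are at distance at most \<open>2 * K\<close>: one \<open>K\<close>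
        bounds the distance of the rays at time \<open>t\<close>, the other bounds
        \<open>\<bar>t - L t\<bar>\<close>.\<close>
      have "dist (g t ((r / L t) * dist z (\<gamma> t))) (\<gamma>' ((r / L t) * dist z (\<gamma>' (L t))))
          \<le> (r / L t) * dist (\<gamma> t) (\<gamma>' (L t))"
        using r a0 Lr L0 \<gamma>' unfolding z_def
        by (intro geodesic_scaling g[of t, unfolded z_def] geodesic_ray_segment) auto
      then have "dist (g t r) (\<gamma>' r) \<le> (r / L t) * dist (\<gamma> t) (\<gamma>' (L t))"
        using dL L0 by (simp add: L_def[symmetric])
      also have "\<dots> \<le> (r / L t) * (2 * K)"
      proof (rule mult_left_mono)
        have "dist (\<gamma>' t) (\<gamma>' (L t)) \<le> K" 
          using geodesic_ray_dist[OF \<gamma>', of t "L t"] t L0 Lt[OF t(1)] by simp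
        then show "dist (\<gamma> t) (\<gamma>' (L t)) \<le> 2 * K" 
          using K[OF t(1)] dist_triangle[of "\<gamma> t" "\<gamma>' (L t)" "\<gamma>' t"] by simp
      qed (use r a0 L0 in auto)
      finally have "dist (g t r) (\<gamma>' r) \<le> 2 * K * r / L t" by (simp add: mult.commute)
      then show ?thesis using e dist_triangle[of x "\<gamma>' r" "g t r"] dist_triangle[of x "g t r" "\<gamma>' r"] E0
        by (simp add: q_def dist_commute)
    qed
    have Ltop: "filterlim L at_top at_top"
    proof (rule filterlim_at_top_mono)
      show "filterlim (\<lambda>t. - K + t) at_top at_top" 
        by (rule filterlim_tendsto_add_at_top[OF tendsto_const filterlim_ident])
      show "\<forall>\<^sub>F t in at_top. - K + t \<le> L t"
        using eventually_ge_at_top[of 0]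
      proof eventually_elim
        case (elim t) then show ?case using Lt[of t] by linarith
      qed
    qed
    have "((\<lambda>t. E + 2 * K * r / L t) \<longlongrightarrow> E + 0) at_top"
      by (rule tendsto_add[OF tendsto_const
            tendsto_divide_0[OF tendsto_const filterlim_at_top_imp_at_infinity[OF Ltop]]])
    moreover have "\<forall>\<^sub>F t in at_top. \<bar>(L t - dist x (\<gamma> t)) - q\<bar> \<le> E + 2 * K * r / L t"
      using eventually_ge_at_top[of 0] eventually_ge_at_top[of "r + K"] by eventually_elim (rule bnd)
    ultimately have "\<bar>(busemann \<gamma> x - busemann \<gamma> z) - q\<bar> \<le> E + 0"
      by (rule tendsto_le[OF trivial_limit_at_top_linorder _ tendsto_rabs[OF lim]])
    then show ?thesis using q by (simp add: E_def[symmetric])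
  qed
  have lim0: "((\<lambda>r. 2 * (a\<^sup>2 / (- a + r))) \<longlongrightarrow> 2 * 0) at_top"
    by (rule tendsto_mult[OF tendsto_const tendsto_divide_0[OF tendsto_const
          filterlim_at_top_imp_at_infinity[OF filterlim_tendsto_add_at_top[OF tendsto_const filterlim_ident]]]])
  have "\<bar>(busemann \<gamma> x - busemann \<gamma> z) - busemann \<gamma>' x\<bar> \<le> 2 * 0"
  proof (rule tendsto_lowerbound[OF lim0])
    show "\<forall>\<^sub>F r in at_top. \<bar>(busemann \<gamma> x - busemann \<gamma> z) - busemann \<gamma>' x\<bar> \<le> 2 * (a\<^sup>2 / (- a + r))"
      using eventually_gt_at_top[of a] by eventually_elim (use * in simp)
  qed simp
  then show ?thesis by (simp add: z_def)
qed

end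

section \<open>Boundary points as classes of rays, and nearness of Busemann functions\<close>

lemma asymptotic_iff:
  "(c, c') \<in> asymptotic \<longleftrightarrow> geodesic_ray c \<and> geodesic_ray c' \<and> (\<exists>K. \<forall>t\<ge>0. dist (c t) (c' t) \<le> K)"
  by (simp add: asymptotic_def)

lemma asymptotic_sym: "(c, c') \<in> asymptotic \<Longrightarrow> (c', c) \<in> asymptotic"
  by (auto simp: asymptotic_iff dist_commute)

lemma asymptotic_trans: "(c, c') \<in> asymptotic \<Longrightarrow> (c', c'') \<in> asymptotic \<Longrightarrow> (c, c'') \<in> asymptotic"
proof -
  assume a: "(c, c') \<in> asymptotic" "(c', c'') \<in> asymptotic"
  then obtain K K' where K: "\<forall>t\<ge>0. dist (c t) (c' t) \<le> K" "\<forall>t\<ge>0. dist (c' t) (c'' t) \<le> K'"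
    by (auto simp: asymptotic_iff)
  have "dist (c t) (c'' t) \<le> K + K'" if "t \<ge> 0" for t
    using K[rule_format, OF that] dist_triangle[of "c t" "c'' t" "c' t"] by linarith
  then show "(c, c'') \<in> asymptotic" using a by (auto simp: asymptotic_iff)
qed

lemma asymptotic_refl: "geodesic_ray c \<Longrightarrow> (c, c) \<in> asymptotic"
  by (auto simp: asymptotic_iff)

lemma visual_boundary_nonempty: "e \<in> visual_boundary \<Longrightarrow> \<exists>\<gamma>. \<gamma> \<in> e"
  unfolding visual_boundary_def by (elim quotientE) (auto intro: asymptotic_refl)

lemma visual_boundary_ray: "e \<in> visual_boundary \<Longrightarrow> \<gamma> \<in> e \<Longrightarrow> geodesic_ray \<gamma>"
  by (auto simp: visual_boundary_def asymptotic_iff elim!: quotientE)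

lemma visual_boundary_mem_iff:
  assumes "e \<in> visual_boundary" "\<gamma> \<in> e"
  shows "\<gamma>' \<in> e \<longleftrightarrow> (\<gamma>, \<gamma>') \<in> asymptotic"
  using assms
  by (auto simp: visual_boundary_def elim!: quotientE intro: asymptotic_trans asymptotic_sym)

lemma visual_boundary_class: "geodesic_ray \<gamma> \<Longrightarrow> asymptotic `` {\<gamma>} \<in> visual_boundary"
  by (auto simp: visual_boundary_def intro: quotientI)

text \<open>The constant \<open>a\<close> is there because the endpoint of a ray determines its Busemann function
  only up to a constant.\<close>

definition near :: "real \<Rightarrow> 'm set \<Rightarrow> ('m \<Rightarrow> real) \<Rightarrow> ('m \<Rightarrow> real) \<Rightarrow> bool" where
  "near \<epsilon> K f f' \<longleftrightarrow> (\<exists>a. \<forall>x\<in>K. \<bar>f x - f' x - a\<bar> < \<epsilon>)"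

lemma near_shift:
  assumes "near \<epsilon> K f f'" "\<And>x. g x = f x + a" "\<And>x. g' x = f' x + b"
  shows "near \<epsilon> K g g'"
proof -
  obtain r where "\<forall>x\<in>K. \<bar>f x - f' x - r\<bar> < \<epsilon>" using assms(1) by (auto simp: near_def)
  then have "\<forall>x\<in>K. \<bar>g x - g' x - (r + a - b)\<bar> < \<epsilon>" by (simp add: assms algebra_simps)
  then show ?thesis unfolding near_def by blast
qed

lemma near_trans:
  assumes "near \<epsilon> K f f'" "near \<epsilon>' K f' f''"
  shows "near (\<epsilon> + \<epsilon>') K f f''"
proof -
  obtain r r' where r: "\<forall>x\<in>K. \<bar>f x - f' x - r\<bar> < \<epsilon>" "\<forall>x\<in>K. \<bar>f' x - f'' x - r'\<bar> < \<epsilon>'"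
    using assms by (auto simp: near_def)
  have "\<bar>f x - f'' x - (r + r')\<bar> < \<epsilon> + \<epsilon>'" if "x \<in> K" for x
    using r(1)[rule_format, OF that] r(2)[rule_format, OF that] by linarith
  then show ?thesis unfolding near_def by blast
qed

lemma near_mono: "near \<epsilon> K f f' \<Longrightarrow> \<epsilon> \<le> \<epsilon>' \<Longrightarrow> K' \<subseteq> K \<Longrightarrow> near \<epsilon>' K' f f'"
  unfolding near_def by (meson order_less_le_trans subsetD)

lemma near_commute:
  assumes "near \<epsilon> K f f'"
  shows "near \<epsilon> K f' f"
proof -
  obtain r where r: "\<forall>x\<in>K. \<bar>f x - f' x - r\<bar> < \<epsilon>" using assms by (auto simp: near_def)
  have "\<bar>f' x - f x - (- r)\<bar> < \<epsilon>" if "x \<in> K" for x using r[rule_format, OF that] by linarith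
  then show ?thesis unfolding near_def by blast
qed

text \<open>The rays whose endpoint is in the cone closure of the endpoints of \<open>Q\<close>,
  expressed through Busemann functions; \<open>closure_eq_limit_rays\<close> proves this when
  \<open>Q\<close> is a union of boundary points.\<close>

definition limit_rays :: "(real \<Rightarrow> 'm::metric_space) set \<Rightarrow> (real \<Rightarrow> 'm) set" where
  "limit_rays Q = {\<gamma>. geodesic_ray \<gamma> \<and>
     (\<forall>K \<epsilon>. finite K \<longrightarrow> \<epsilon> > 0 \<longrightarrow> (\<exists>\<gamma>'\<in>Q. near \<epsilon> K (busemann \<gamma>) (busemann \<gamma>')))}"

section \<open>The cone topology in terms of Busemann functions\<close>

context proper_CAT0 begin

lemma busemann_boundary_const:
  assumes "e \<in> visual_boundary" "\<gamma> \<in> e" "\<gamma>' \<in> e"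
  shows "\<exists>a. \<forall>x :: 'm. busemann \<gamma> x = busemann \<gamma>' x + a"
proof -
  obtain K where "geodesic_ray \<gamma>" "geodesic_ray \<gamma>'" "\<And>t. t \<ge> 0 \<Longrightarrow> dist (\<gamma> t) (\<gamma>' t) \<le> K"
    using assms visual_boundary_mem_iff[of e \<gamma> \<gamma>'] by (auto simp: asymptotic_iff)
  from busemann_asymptotic[OF this] show ?thesis by blast
qed

lemma boundary_ray_from:
  fixes x0 :: 'm
  assumes "e \<in> visual_boundary"
  shows "\<exists>c\<in>e. geodesic_ray c \<and> c 0 = x0 \<and> (\<forall>t<0. c t = x0)"
proof -
  obtain \<gamma> where \<gamma>: "\<gamma> \<in> e" using visual_boundary_nonempty[OF assms] by blast
  obtain c where c: "geodesic_ray c" "c 0 = x0" "\<forall>t<0. c t = x0"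
    "\<forall>t\<ge>0. dist (c t) (\<gamma> t) \<le> 2 * dist x0 (\<gamma> 0)"
    using ex_asymptotic_ray[OF visual_boundary_ray[OF assms \<gamma>], of x0] by blast
  have "c \<in> e" using visual_boundary_mem_iff[OF assms \<gamma>] c visual_boundary_ray[OF assms \<gamma>]
    by (auto simp: asymptotic_iff dist_commute)
  then show ?thesis using c by blast
qed

text \<open>The point at time \<open>t\<close> determines each of the two Busemann functions on
  \<open>K\<close> up to \<open>\<epsilon> / 2\<close>, and moving that point by less than
  \<open>\<delta>\<close> changes the estimate by less than \<open>\<delta>\<close>.\<close>

lemma busemann_close:
  fixes x0 :: 'm
  assumes "finite K" "\<epsilon> > 0"
  shows "\<exists>t>0. \<exists>\<delta>>0. \<forall>c c'. geodesic_ray c \<longrightarrow> geodesic_ray c' \<longrightarrow> c 0 = x0 \<longrightarrow> c' 0 = x0 \<longrightarrow>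
    dist (c t) (c' t) < \<delta> \<longrightarrow> (\<forall>x\<in>K. \<bar>busemann c x - busemann c' x\<bar> < \<epsilon>)"
proof -
  define A where "A = (\<Sum>x\<in>K. dist x x0)"
  have A: "dist x x0 \<le> A" if "x \<in> K" for x
    unfolding A_def using that assms(1) by (intro member_le_sum) auto
  have A0: "A \<ge> 0" by (simp add: A_def sum_nonneg)
  \<comment> \<open>Chosen so that \<open>A\<^sup>2 / (t - A)\<close> is below
    \<open>\<epsilon> / 2\<close>; the summand 1 keeps the denominator positive and the inequality
    strict.\<close>
  define t where "t = A + 1 + 2 * A\<^sup>2 / \<epsilon>"
  have q0: "2 * A\<^sup>2 / \<epsilon> \<ge> 0" using assms by simp
  have est: "(dist x x0)\<^sup>2 / (t - dist x x0) < \<epsilon> / 2" if "x \<in> K" for x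
  proof -
    have "(dist x x0)\<^sup>2 \<le> A\<^sup>2" using A[OF that] by (intro power_mono) auto
    also have "A\<^sup>2 = \<epsilon> / 2 * (2 * A\<^sup>2 / \<epsilon>)" using assms(2) by simp
    also have "\<dots> < \<epsilon> / 2 * (t - dist x x0)"
      using A[OF that] assms(2) by (intro mult_strict_left_mono) (auto simp: t_def)
    finally show ?thesis using A[OF that] q0 by (simp add: pos_divide_less_eq t_def)
  qed
  have "t > 0" using A0 q0 by (simp add: t_def)
  have "\<forall>c c'. geodesic_ray c \<longrightarrow> geodesic_ray c' \<longrightarrow> c 0 = x0 \<longrightarrow> c' 0 = x0 \<longrightarrow>
    dist (c t) (c' t) < \<epsilon> / 2 \<longrightarrow> (\<forall>x\<in>K. \<bar>busemann c x - busemann c' x\<bar> < \<epsilon>)"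
  proof (intro allI impI ballI)
    fix c c' x assume c: "geodesic_ray c" "geodesic_ray c'" "c 0 = x0" "c' 0 = x0"
      and d: "dist (c t) (c' t) < \<epsilon> / 2" and x: "x \<in> K"
    have tx: "dist x x0 < t" using A[OF x] q0 by (simp add: t_def)
    have "t - dist x (c t) \<le> busemann c x" "t - dist x (c' t) \<le> busemann c' x"
      using \<open>t > 0\<close> c by (auto intro!: busemann_ge)
    moreover have "busemann c x \<le> t - dist x (c t) + (dist x x0)\<^sup>2 / (t - dist x x0)"
      "busemann c' x \<le> t - dist x (c' t) + (dist x x0)\<^sup>2 / (t - dist x x0)"
      using busemann_estimate[OF c(1), of x t] busemann_estimate[OF c(2), of x t] tx c by auto
    moreover have "\<bar>dist x (c t) - dist x (c' t)\<bar> < \<epsilon> / 2"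
      using d dist_triangle[of x "c t" "c' t"] dist_triangle[of x "c' t" "c t"]
      unfolding dist_commute[of "c' t" "c t"] by linarith
    ultimately show "\<bar>busemann c x - busemann c' x\<bar> < \<epsilon>" using est[OF x] by linarith
  qed
  then show ?thesis using \<open>t > 0\<close> half_gt_zero[OF assms(2)] by blast
qed

text \<open>The hypothesis puts \<open>c' r\<close> almost into the horoball of \<open>c\<close>
  through \<open>c r\<close>. Horoballs are convex, so the midpoint \<open>m\<close> of
  \<open>c r\<close> and \<open>c' r\<close> also has distance at least about \<open>r\<close> from
  \<open>c 0\<close>. Both ends have distance exactly \<open>r\<close>, and the midpoint inequality
  then bounds their distance from each other.\<close>

lemma rays_close:
  fixes c c' :: "real \<Rightarrow> 'm"
  assumes c: "geodesic_ray c" and c': "geodesic_ray c'" and "c 0 = c' 0" "0 \<le> r"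
    and b: "busemann c (c' r) \<ge> r - \<epsilon>"
  shows "(dist (c r) (c' r))\<^sup>2 \<le> 8 * r * \<epsilon>"
proof -
  define q q' where "q = c r" and "q' = c' r"
  obtain g where g: "geodesic_path g q q'" using ex_geodesic by blast
  define m where "m = g (dist q q' / 2)"
  have mid: "(dist p m)\<^sup>2 \<le> (dist p q)\<^sup>2 / 2 + (dist p q')\<^sup>2 / 2 - (dist q q')\<^sup>2 / 4" for p
    unfolding m_def by (rule midpoint_inequality[OF g])
  have max: "dist p m \<le> max (dist p q) (dist p q')" for p
  proof (rule power2_le_imp_le)
    have "(dist p q)\<^sup>2 \<le> (max (dist p q) (dist p q'))\<^sup>2" "(dist p q')\<^sup>2 \<le> (max (dist p q) (dist p q'))\<^sup>2"
      by (auto intro!: power_mono)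
    then show "(dist p m)\<^sup>2 \<le> (max (dist p q) (dist p q'))\<^sup>2"
      using mid[of p] zero_le_power2[of "dist q q'"] by linarith
  qed (simp add: max_def)
  \<comment> \<open>Convexity of horoballs, as a limit of the convexity of balls around
    \<open>c t\<close>.\<close>
  have "min (busemann c q) (busemann c q') \<le> busemann c m"
  proof (rule tendsto_le[OF trivial_limit_at_top_linorder busemann_tendsto[OF c]
        tendsto_min[OF busemann_tendsto[OF c] busemann_tendsto[OF c]]])
    have "min (t - dist q (c t)) (t - dist q' (c t)) \<le> t - dist m (c t)" for t
      using max[of "c t"] by (auto simp: dist_commute min_def max_def split: if_splits)
    then show "\<forall>\<^sub>F t in at_top. min (t - dist q (c t)) (t - dist q' (c t)) \<le> t - dist m (c t)"
      by (intro always_eventually) blast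
  qed
  moreover have "busemann c m \<le> dist (c 0) m"
    using busemann_lipschitz[OF c, of m "c 0"] busemann_on_ray[OF c, of 0] by (simp add: dist_commute)
  moreover have "busemann c q = r" unfolding q_def by (rule busemann_on_ray[OF c assms(4)])
  ultimately have m: "min r (r - \<epsilon>) \<le> dist (c 0) m" using b by (auto simp: q'_def)
  have "dist (c 0) q = r" "dist (c 0) q' = r"
    using geodesic_ray_dist[OF c, of 0 r] geodesic_ray_dist[OF c', of 0 r] assms(3,4)
    by (auto simp: q_def q'_def)
  then have d: "(dist q q')\<^sup>2 \<le> 4 * (r\<^sup>2 - (dist (c 0) m)\<^sup>2)" and mr: "dist (c 0) m \<le> r"
    using mid[of "c 0"] max[of "c 0"] by auto
  have "\<epsilon> \<ge> 0"
    using b busemann_lipschitz[OF c, of "c' r" "c 0"] busemann_on_ray[OF c, of 0] assms(3,4)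
      geodesic_ray_dist[OF c', of r 0] by simp
  have "r\<^sup>2 - (dist (c 0) m)\<^sup>2 = (r + dist (c 0) m) * (r - dist (c 0) m)"
    by (simp add: power2_eq_square algebra_simps)
  also have "\<dots> \<le> (2 * r) * \<epsilon>"
    using m mr \<open>\<epsilon> \<ge> 0\<close> assms(4) by (intro mult_mono) auto
  finally show ?thesis using d by (simp add: q_def q'_def)
qed

lemma limit_rays_asymptotic:
  fixes \<gamma> :: "real \<Rightarrow> 'm"
  assumes "e \<in> visual_boundary" "\<gamma> \<in> e" "\<gamma>' \<in> e" "\<gamma> \<in> limit_rays Q"
  shows "\<gamma>' \<in> limit_rays Q"
proof -
  obtain a where a: "\<forall>x :: 'm. busemann \<gamma>' x = busemann \<gamma> x + a"
    using busemann_boundary_const[OF assms(1,3,2)] by blast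
  have "\<exists>\<gamma>''\<in>Q. near \<epsilon> K (busemann \<gamma>') (busemann \<gamma>'')" if "finite K" "\<epsilon> > 0" for K \<epsilon>
  proof -
    obtain \<gamma>'' where "\<gamma>'' \<in> Q" "near \<epsilon> K (busemann \<gamma>) (busemann \<gamma>'')"
      using assms(4) \<open>finite K\<close> \<open>\<epsilon> > 0\<close> unfolding limit_rays_def by blast
    then show ?thesis using near_shift[of \<epsilon> K "busemann \<gamma>" "busemann \<gamma>''" "busemann \<gamma>'" a "busemann \<gamma>''" 0] a
      by auto
  qed
  then show ?thesis using visual_boundary_ray[OF assms(1,3)] unfolding limit_rays_def by blast
qed

text \<open>Two test points suffice. Busemann functions of rays from \<open>x0\<close> vanish at
  \<open>x0\<close>, which controls the additive constant; the value at \<open>c r\<close> is what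
  \<open>rays_close\<close> asks for.\<close>

lemma cone_nbhd_near:
  fixes x0 :: 'm
  assumes e: "e \<in> visual_boundary" "\<gamma> \<in> e" and n: "e \<in> cone_nbhd x0 d r \<delta>" and r: "r > 0"
  shows "\<exists>K \<epsilon>. finite K \<and> \<epsilon> > 0 \<and>
    (\<forall>e' \<gamma>'. e' \<in> visual_boundary \<longrightarrow> \<gamma>' \<in> e' \<longrightarrow> near \<epsilon> K (busemann \<gamma>) (busemann \<gamma>') \<longrightarrow>
      e' \<in> cone_nbhd x0 d r \<delta>)"
proof -
  obtain c where c: "c \<in> e" "c 0 = x0" "dist (c r) (d r) < \<delta>" using n by (auto simp: cone_nbhd_def)
  have cr: "geodesic_ray c" using visual_boundary_ray e c by blast
  define \<eta> where "\<eta> = \<delta> - dist (c r) (d r)"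
  \<comment> \<open>\<open>rays_close\<close> is applied with \<open>2 * \<epsilon>\<close> and
    bounds the squared distance by \<open>16 * r * \<epsilon>\<close>; the summand 1 makes this
    smaller than \<open>\<eta>\<^sup>2\<close>.\<close>
  define \<epsilon> where "\<epsilon> = \<eta>\<^sup>2 / (16 * r + 1)"
  have \<eta>: "\<eta> > 0" using c by (simp add: \<eta>_def)
  then have \<epsilon>: "\<epsilon> > 0" using r by (simp add: \<epsilon>_def)
  have *: "8 * r * (2 * \<epsilon>) < \<eta>\<^sup>2"
  proof -
    have "(16 * r + 1) * \<epsilon> = \<eta>\<^sup>2" using r by (simp add: \<epsilon>_def)
    then show ?thesis using \<epsilon> by (simp add: algebra_simps)
  qed
  show ?thesis
  proof (intro exI[of _ "{x0, c r}"] exI[of _ \<epsilon>] conjI allI impI)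
    fix e' \<gamma>' assume e': "e' \<in> visual_boundary" "\<gamma>' \<in> e'" "near \<epsilon> {x0, c r} (busemann \<gamma>) (busemann \<gamma>')"
    obtain c' where c': "c' \<in> e'" "geodesic_ray c'" "c' 0 = x0" using boundary_ray_from[OF e'(1), of x0] by blast
    obtain a where a: "\<And>x :: 'm. busemann c x = busemann \<gamma> x + a"
      using busemann_boundary_const[OF e(1) c(1) e(2)] by blast
    obtain b where b: "\<And>x :: 'm. busemann c' x = busemann \<gamma>' x + b"
      using busemann_boundary_const[OF e'(1) c'(1) e'(2)] by blast
    obtain u where u: "\<forall>x\<in>{x0, c r}. \<bar>busemann c x - busemann c' x - u\<bar> < \<epsilon>"
      using near_shift[OF e'(3) a b] unfolding near_def by blast
    have "busemann c x0 = 0" "busemann c' x0 = 0" "busemann c (c r) = r"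
      using busemann_on_ray[OF cr, of 0] busemann_on_ray[OF c'(2), of 0] busemann_on_ray[OF cr, of r] r c c'
      by auto
    then have "busemann c' (c r) \<ge> r - 2 * \<epsilon>" using u by auto
    then have "(dist (c' r) (c r))\<^sup>2 \<le> 8 * r * (2 * \<epsilon>)"
      using rays_close[OF c'(2) cr, of r "2 * \<epsilon>"] c c' r by auto
    then have "(dist (c' r) (c r))\<^sup>2 < \<eta>\<^sup>2" using * by linarith
    then have "dist (c' r) (c r) < \<eta>" using \<eta> by (meson less_imp_le power2_less_imp_less)
    then have "dist (c' r) (d r) < \<delta>" using dist_triangle[of "c' r" "d r" "c r"] by (simp add: \<eta>_def)
    then show "e' \<in> cone_nbhd x0 d r \<delta>" using e' c' by (auto simp: cone_nbhd_def)
  qed (use \<epsilon> in auto)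
qed

theorem closure_eq_limit_rays:
  fixes x0 :: 'm
  assumes S: "S \<subseteq> visual_boundary"
  shows "cone_topology x0 closure_of S = {e \<in> visual_boundary. e \<subseteq> limit_rays (\<Union>S)}"
proof (intro equalityI subsetI)
  fix e assume e: "e \<in> cone_topology x0 closure_of S"
  have eb: "e \<in> visual_boundary"
    using e by (auto simp: in_closure_of cone_topology_def topology_generated_by_topspace cone_nbhd_def)
  obtain c where c: "c \<in> e" "geodesic_ray c" "c 0 = x0" using boundary_ray_from[OF eb, of x0] by blast
  have "c \<in> limit_rays (\<Union>S)"
    unfolding limit_rays_def
  proof (intro CollectI conjI c allI impI)
    fix K :: "'m set" and \<epsilon> :: real assume "finite K" "\<epsilon> > 0"
    then obtain t \<delta> where t: "t > 0" "\<delta> > 0" and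
      cl: "\<forall>c c'. geodesic_ray c \<longrightarrow> geodesic_ray c' \<longrightarrow> c 0 = x0 \<longrightarrow> c' 0 = x0 \<longrightarrow>
           dist (c t) (c' t) < \<delta> \<longrightarrow> (\<forall>x\<in>K. \<bar>busemann c x - busemann c' x\<bar> < \<epsilon>)"
      using busemann_close[of K \<epsilon> x0] by blast
    have "openin (cone_topology x0) (cone_nbhd x0 c t \<delta>)"
      unfolding cone_topology_def using c t by (intro topology_generated_by_Basis) blast
    moreover have "e \<in> cone_nbhd x0 c t \<delta>"
      using eb c t by (auto simp: cone_nbhd_def)
    ultimately obtain e' where e': "e' \<in> S" "e' \<in> cone_nbhd x0 c t \<delta>"
      using e unfolding in_closure_of by blast
    then obtain c' where c': "c' \<in> e'" "c' 0 = x0" "dist (c' t) (c t) < \<delta>" by (auto simp: cone_nbhd_def)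
    have "geodesic_ray c'" using visual_boundary_ray e' c' S by blast
    then have "near \<epsilon> K (busemann c) (busemann c')"
      unfolding near_def using cl[rule_format, of c c'] c c' by (intro exI[of _ 0]) (auto simp: dist_commute)
    then show "\<exists>\<gamma>'\<in>\<Union> S. near \<epsilon> K (busemann c) (busemann \<gamma>')" using e' c' by blast
  qed
  then show "e \<in> {e \<in> visual_boundary. e \<subseteq> limit_rays (\<Union>S)}"
    using eb c limit_rays_asymptotic by blast
next
  fix e assume "e \<in> {e \<in> visual_boundary. e \<subseteq> limit_rays (\<Union>S)}"
  then have e: "e \<in> visual_boundary" "e \<subseteq> limit_rays (\<Union>S)" by auto
  obtain c where c: "c \<in> e" "geodesic_ray c" "c 0 = x0" using boundary_ray_from[OF e(1), of x0] by blast
  let ?B = "{cone_nbhd x0 c r \<delta> | c r \<delta>. geodesic_ray c \<and> c 0 = x0 \<and> r > 0 \<and> \<delta> > 0}"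
  have "e \<in> cone_nbhd x0 c 1 1" using e c by (auto simp: cone_nbhd_def)
  moreover have "cone_nbhd x0 c 1 1 \<in> ?B" using c zero_less_one by blast
  ultimately have top: "e \<in> topspace (cone_topology x0)"
    unfolding cone_topology_def topology_generated_by_topspace by blast
  \<comment> \<open>Cone neighbourhoods are given as a subbasis only, so the property has to be
    carried through finite intersections and arbitrary unions.\<close>
  have nb: "e \<in> T \<Longrightarrow> \<exists>K \<epsilon>. finite K \<and> \<epsilon> > 0 \<and>
      (\<forall>e' \<gamma>'. e' \<in> visual_boundary \<longrightarrow> \<gamma>' \<in> e' \<longrightarrow> near \<epsilon> K (busemann c) (busemann \<gamma>') \<longrightarrow> e' \<in> T)"
    if "generate_topology_on ?B T" for T
    using that
  proof (induction T rule: generate_topology_on.induct)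
    case (Int A B)
    then obtain K1 \<epsilon>1 K2 \<epsilon>2 where k: "finite K1" "\<epsilon>1 > 0" "finite K2" "\<epsilon>2 > 0"
      and 1: "\<forall>e' \<gamma>'. e' \<in> visual_boundary \<longrightarrow> \<gamma>' \<in> e' \<longrightarrow> near \<epsilon>1 K1 (busemann c) (busemann \<gamma>') \<longrightarrow> e' \<in> A"
      and 2: "\<forall>e' \<gamma>'. e' \<in> visual_boundary \<longrightarrow> \<gamma>' \<in> e' \<longrightarrow> near \<epsilon>2 K2 (busemann c) (busemann \<gamma>') \<longrightarrow> e' \<in> B"
      by auto
    show ?case
    proof (intro exI[of _ "K1 \<union> K2"] exI[of _ "min \<epsilon>1 \<epsilon>2"] conjI allI impI)
      fix e' \<gamma>' assume a: "e' \<in> visual_boundary" "\<gamma>' \<in> e'"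
        "near (min \<epsilon>1 \<epsilon>2) (K1 \<union> K2) (busemann c) (busemann \<gamma>')"
      have "near \<epsilon>1 K1 (busemann c) (busemann \<gamma>')" "near \<epsilon>2 K2 (busemann c) (busemann \<gamma>')"
        using a(3) by (auto elim!: near_mono)
      then show "e' \<in> A \<inter> B" using 1 2 a by blast
    qed (use k in auto)
  next
    case (UN F)
    then obtain T where T: "T \<in> F" "e \<in> T" by blast
    from UN.IH[OF T] obtain K \<epsilon> where "finite K" "\<epsilon> > 0"
      "\<forall>e' \<gamma>'. e' \<in> visual_boundary \<longrightarrow> \<gamma>' \<in> e' \<longrightarrow> near \<epsilon> K (busemann c) (busemann \<gamma>') \<longrightarrow> e' \<in> T" by blast
    then show ?case using T(1) by (intro exI[of _ K] exI[of _ \<epsilon>]) blast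
  next
    case (Basis T)
    from Basis.hyps obtain d r \<delta> where T: "T = cone_nbhd x0 d r \<delta>" "r > 0" by blast
    show ?case
      using cone_nbhd_near[OF e(1) c(1) Basis.prems[unfolded T(1)] T(2)] unfolding T(1) .
  qed simp
  show "e \<in> cone_topology x0 closure_of S"
    unfolding in_closure_of
  proof (intro conjI top allI impI)
    fix T assume T: "e \<in> T \<and> openin (cone_topology x0) T"
    then have "generate_topology_on ?B T"
      unfolding cone_topology_def by (simp add: openin_topology_generated_by_iff)
    from nb[OF this] T obtain K \<epsilon> where K: "finite K" "\<epsilon> > 0"
      "\<forall>e' \<gamma>'. e' \<in> visual_boundary \<longrightarrow> \<gamma>' \<in> e' \<longrightarrow> near \<epsilon> K (busemann c) (busemann \<gamma>') \<longrightarrow> e' \<in> T" by blast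
    have "c \<in> limit_rays (\<Union>S)" using e c by blast
    then obtain \<gamma>' where "\<gamma>' \<in> \<Union>S" "near \<epsilon> K (busemann c) (busemann \<gamma>')"
      using K unfolding limit_rays_def by blast
    then show "\<exists>y. y \<in> S \<and> y \<in> T" using K S by blast
  qed
qed

text \<open>The test set may depend on the centre \<open>f\<close>, because in the application it
  contains the control points of a chain chosen for \<open>f\<close>. The rays from one
  \<open>x0\<close> represent all endpoints and form a compact set \<open>C\<close>; the open set
  around a centre constrains a single coordinate, the one at the time given by
  \<open>busemann_close\<close>.\<close>

theorem limit_rays_finite_subcover:
  fixes K :: "('m \<Rightarrow> real) \<Rightarrow> 'm set"
  assumes K: "\<And>f. finite (K f)" and \<epsilon>: "\<epsilon> > 0"
  obtains F where "finite F" "F \<subseteq> busemann ` limit_rays Q"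
    "\<And>\<gamma>. \<gamma> \<in> limit_rays Q \<Longrightarrow> \<exists>f\<in>F. near \<epsilon> (K f) f (busemann \<gamma>)"
proof -
  obtain x0 :: 'm where True by blast
  define C where "C = {c. geodesic_ray c \<and> c 0 = x0 \<and> (\<forall>t<0. c t = x0) \<and> c \<in> limit_rays Q}"
  have "compact C"
  proof -
    have "C \<subseteq> Pi UNIV (\<lambda>u. cball x0 \<bar>u\<bar>)"
    proof (intro subsetI Pi_I)
      fix c u assume c: "c \<in> C"
      show "c u \<in> cball x0 \<bar>u\<bar>"
      proof (cases "u < 0")
        case False
        then have "dist (c 0) (c u) = \<bar>0 - u\<bar>" using c by (intro geodesic_ray_dist) (auto simp: C_def)
        then show ?thesis using c by (simp add: C_def)
      qed (use c in \<open>simp add: C_def\<close>)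
    qed
    moreover have "compact (Pi UNIV (\<lambda>u. cball x0 \<bar>u\<bar>))"
      using proper by (intro compact_Pi_UNIV) (simp add: proper_space_def)
    moreover have "closed C"
    proof -
      have sub: "closure C \<subseteq> Z" if "closed Z" "C \<subseteq> Z" for Z
        using that by (simp add: closure_minimal)
      have "closure C \<subseteq> C"
      proof
        fix c assume c: "c \<in> closure C"
        have c0: "c t = x0" if "t \<le> 0" for t
        proof -
          have "closure C \<subseteq> {c. c t = x0}" 
            using that by (intro sub closed_pointwise_eq) (auto simp: C_def order_le_less)
          then show ?thesis using c by blast
        qed
        have ray: "geodesic_ray c"
          unfolding geodesic_ray_def
        proof (intro allI impI)
          fix s t :: real assume st: "0 \<le> s" "0 \<le> t"
          have "closure C \<subseteq> {c. dist (c s) (c t) = \<bar>s - t\<bar>}"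
            using st by (intro sub closed_pointwise_dist_eq) (auto simp: C_def geodesic_ray_dist)
          then show "dist (c s) (c t) = \<bar>s - t\<bar>" using c by blast
        qed
        have "c \<in> limit_rays Q"
          unfolding limit_rays_def
        proof (intro CollectI conjI ray allI impI)
          fix K :: "'m set" and \<epsilon> :: real assume K: "finite K" "\<epsilon> > 0"
          obtain t \<delta> where t: "t > 0" "\<delta> > 0" and
            cl: "\<forall>c c'. geodesic_ray c \<longrightarrow> geodesic_ray c' \<longrightarrow> c 0 = x0 \<longrightarrow> c' 0 = x0 \<longrightarrow>
              dist (c t) (c' t) < \<delta> \<longrightarrow> (\<forall>x\<in>K. \<bar>busemann c x - busemann c' x\<bar> < \<epsilon> / 2)"
            using busemann_close[OF K(1) half_gt_zero[OF K(2)], of x0] by blast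
          have "open {c'. dist (c' t) (c t) < \<delta>}"
            by (intro open_Collect_less continuous_intros continuous_on_product_coordinates)
          moreover have "c \<in> {c'. dist (c' t) (c t) < \<delta>} \<inter> closure C" using c t by simp
          ultimately have "{c'. dist (c' t) (c t) < \<delta>} \<inter> C \<noteq> {}"
            using open_Int_closure_eq_empty by blast
          then obtain c' where c': "c' \<in> C" "dist (c' t) (c t) < \<delta>" by blast
          \<comment> \<open>Half of \<open>\<epsilon>\<close> is spent on replacing \<open>c\<close>
            by \<open>c'\<close>, the other half on approximating \<open>c'\<close> by a ray in
            \<open>Q\<close>.\<close>
          have "near (\<epsilon>/2) K (busemann c) (busemann c')"
            unfolding near_def using cl[rule_format, of c c'] c' ray c0[of 0]
            by (intro exI[of _ 0]) (auto simp: dist_commute C_def)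
          moreover obtain \<gamma> where "\<gamma> \<in> Q" "near (\<epsilon>/2) K (busemann c') (busemann \<gamma>)"
            using c'(1) K half_gt_zero[OF K(2)] unfolding C_def limit_rays_def by blast
          ultimately show "\<exists>\<gamma>'\<in>Q. near \<epsilon> K (busemann c) (busemann \<gamma>')"
            using near_trans by fastforce
        qed
        then show "c \<in> C" using ray c0 by (simp add: C_def)
      qed
      then show ?thesis by (metis closed_closure closure_subset subset_antisym)
    qed
    ultimately show ?thesis by (metis compact_Int_closed inf.absorb_iff2)
  qed
  have "\<exists>t \<delta>. t > 0 \<and> \<delta> > 0 \<and> (\<forall>c c'. geodesic_ray c \<longrightarrow> geodesic_ray c' \<longrightarrow> c 0 = x0 \<longrightarrow> c' 0 = x0 \<longrightarrow>
      dist (c t) (c' t) < \<delta> \<longrightarrow> (\<forall>x\<in>K f. \<bar>busemann c x - busemann c' x\<bar> < \<epsilon>))" for f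
    using busemann_close[OF K[of f] \<epsilon>, of x0] by blast
  then obtain t \<delta> where t: "\<And>f. t f > 0 \<and> \<delta> f > 0 \<and>
      (\<forall>c c'. geodesic_ray c \<longrightarrow> geodesic_ray c' \<longrightarrow> c 0 = x0 \<longrightarrow> c' 0 = x0 \<longrightarrow>
      dist (c (t f)) (c' (t f)) < \<delta> f \<longrightarrow> (\<forall>x\<in>K f. \<bar>busemann c x - busemann c' x\<bar> < \<epsilon>))"
    by metis
  define U where "U c = {c'. dist (c' (t (busemann c))) (c (t (busemann c))) < \<delta> (busemann c)}" for c
  have "open (U c)" for c
    unfolding U_def by (intro open_Collect_less continuous_intros continuous_on_product_coordinates)
  moreover have "C \<subseteq> \<Union>(U ` C)" using t by (auto simp: U_def)
  ultimately obtain C' where C': "C' \<subseteq> C" "finite C'" "C \<subseteq> \<Union>(U ` C')"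
    by (rule compactE_image[OF \<open>compact C\<close>])
  show ?thesis
  proof (rule that[of "busemann ` C'"])
    show "busemann ` C' \<subseteq> busemann ` limit_rays Q" using C' by (auto simp: C_def)
    fix \<gamma> assume \<gamma>: "\<gamma> \<in> limit_rays Q"
    define e where "e = asymptotic `` {\<gamma>}"
    have r: "geodesic_ray \<gamma>" using \<gamma> by (simp add: limit_rays_def)
    then have e: "e \<in> visual_boundary" "\<gamma> \<in> e"
      by (auto simp: e_def visual_boundary_class asymptotic_refl)
    obtain c where c: "c \<in> e" "geodesic_ray c" "c 0 = x0" "\<forall>t<0. c t = x0"
      using boundary_ray_from[OF e(1), of x0] by blast
    then have "c \<in> C" using limit_rays_asymptotic[OF e(1,2) c(1) \<gamma>] by (auto simp: C_def)
    then obtain c' where c': "c' \<in> C'" "c \<in> U c'" using C' by blast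
    have "\<forall>x\<in>K (busemann c'). \<bar>busemann c' x - busemann c x\<bar> < \<epsilon>"
      using t[of "busemann c'"] c' C' c by (auto simp: U_def C_def dist_commute)
    then have "near \<epsilon> (K (busemann c')) (busemann c') (busemann c)"
      unfolding near_def by (intro exI[of _ 0]) auto
    moreover obtain a where "\<And>x :: 'm. busemann \<gamma> x = busemann c x + a"
      using busemann_boundary_const[OF e(1) e(2) c(1)] by blast
    ultimately have "near \<epsilon> (K (busemann c')) (busemann c') (busemann \<gamma>)"
      using near_shift[of _ _ _ _ "busemann c'" 0] by fastforce
    then show "\<exists>f\<in>busemann ` C'. near \<epsilon> (K f) f (busemann \<gamma>)" using c' by blast
  qed (use C' in simp)
qed

end

section \<open>Based free resolutions\<close>

lemma int_scale_0 [simp]: "int_scale 0 a = 0"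
  by (simp add: int_scale_def)

lemma int_scale_1 [simp]: "int_scale 1 a = a"
  by (simp add: int_scale_def)

lemma int_scale_Suc: "int_scale (k + 1) a = int_scale k a + a"
proof (cases "k \<ge> 0")
  case True
  then have "nat (k + 1) = Suc (nat k)" by simp
  then show ?thesis using True by (simp add: int_scale_def)
next
  case False
  then have "int_scale (k + 1) a = - (\<Sum>i<nat (- (k + 1)). a)" by (auto simp: int_scale_def)
  moreover have "nat (- k) = Suc (nat (- (k + 1)))" using False by simp
  ultimately show ?thesis using False by (simp add: int_scale_def)
qed

lemma int_scale_add: "int_scale (k + l) a = int_scale k a + int_scale l a"
proof (induction l rule: int_induct[where k = 0])
  case (step1 i)
  then show ?case using int_scale_Suc[of "k + i" a] int_scale_Suc[of i a] by (simp add: add.assoc)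
next
  case (step2 i)
  then show ?case using int_scale_Suc[of "k + (i - 1)" a] int_scale_Suc[of "i - 1" a]
    by (simp add: algebra_simps)
qed simp

lemma zg_smult_0 [simp]: "zg_smult t 0 a = 0"
  by (simp add: zg_smult_def)

lemma zg_smult_superset:
  assumes "finite A" "Poly_Mapping.keys r \<subseteq> A"
  shows "zg_smult t r a = (\<Sum>g\<in>A. int_scale (Poly_Mapping.lookup r g) (t g a))"
  unfolding zg_smult_def by (rule sum.mono_neutral_left) (use assms in \<open>auto simp: in_keys_iff\<close>)

lemma zg_smult_add: "zg_smult t (r + s) a = zg_smult t r a + zg_smult t s a"
proof -
  let ?A = "Poly_Mapping.keys r \<union> Poly_Mapping.keys s"
  have "zg_smult t u a = (\<Sum>g\<in>?A. int_scale (Poly_Mapping.lookup u g) (t g a))"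
    if "u \<in> {r, s, r + s}" for u
    using that Poly_Mapping.keys_add[of r s] by (intro zg_smult_superset) auto
  then show ?thesis by (simp add: lookup_add int_scale_add sum.distrib)
qed

lemma zg_comb_superset:
  fixes r :: "'c::ab_group_add \<Rightarrow>\<^sub>0 ('g \<Rightarrow>\<^sub>0 int)"
  assumes "finite A" "Poly_Mapping.keys r \<subseteq> A"
  shows "zg_comb t r = (\<Sum>x\<in>A. zg_smult t (Poly_Mapping.lookup r x) x)"
  unfolding zg_comb_def by (rule sum.mono_neutral_left) (use assms in \<open>auto simp: in_keys_iff\<close>)

lemma additive_zg_comb:
  fixes t :: "'g \<Rightarrow> 'c::ab_group_add \<Rightarrow> 'c"
  shows "Modules.additive (zg_comb t)"
proof
  fix r s :: "'c \<Rightarrow>\<^sub>0 ('g \<Rightarrow>\<^sub>0 int)"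
  let ?A = "Poly_Mapping.keys r \<union> Poly_Mapping.keys s"
  have "zg_comb t u = (\<Sum>x\<in>?A. zg_smult t (Poly_Mapping.lookup u x) x)"
    if "u \<in> {r, s, r + s}" for u
    using that Poly_Mapping.keys_add[of r s] by (intro zg_comb_superset) auto
  then show "zg_comb t (r + s) = zg_comb t r + zg_comb t s"
    by (simp add: lookup_add zg_smult_add sum.distrib)
qed

lemma zg_comb_single: "zg_comb t (Poly_Mapping.single x (Poly_Mapping.single g 1)) = t g x"
  by (simp add: zg_comb_def zg_smult_def)

lemma sum_closed_induct:
  fixes P :: "'c::ab_group_add \<Rightarrow> bool"
  assumes "P 0" "\<And>u v. P u \<Longrightarrow> P v \<Longrightarrow> P (u + v)" "\<And>i. i \<in> I \<Longrightarrow> P (f i)"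
  shows "P (sum f I)"
  using assms(3) by (induction I rule: infinite_finite_induct) (auto intro: assms(1,2))

lemma int_scale_closed:
  assumes "P 0" "\<And>u v. P u \<Longrightarrow> P v \<Longrightarrow> P (u + v)" "\<And>u. P u \<Longrightarrow> P (- u)" "P (y :: 'c::ab_group_add)"
  shows "P (int_scale k y)"
  unfolding int_scale_def by (auto intro!: assms(3) sum_closed_induct[of P] assms(1,2,4))

text \<open>The possible values at \<open>c\<close> of the \<open>N\<close>-th power of a map that
  selects from \<open>\<Phi>\<close>. Through it, powers of finitary maps stay finitary with a bound
  that depends on \<open>\<Phi>\<close> and \<open>N\<close> alone.\<close>

primrec iter_sel :: "('f \<Rightarrow> 'f set) \<Rightarrow> nat \<Rightarrow> 'f \<Rightarrow> 'f set" where
  "iter_sel \<Phi> 0 c = {c}"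
| "iter_sel \<Phi> (Suc N) c = \<Union>(\<Phi> ` iter_sel \<Phi> N c)"

text \<open>What bounds on lags use of a Busemann function; with it the algebra can be done for
  arbitrary real functions on the space.\<close>

definition lipschitz1 :: "('m::metric_space \<Rightarrow> real) \<Rightarrow> bool" where
  "lipschitz1 \<beta> \<longleftrightarrow> (\<forall>x y. \<beta> x \<le> \<beta> y + dist x y)"

locale controlled_resolution =
  fixes G :: "('g, 'b) monoid_scheme"
    and \<rho> :: "'g \<Rightarrow> 'm::metric_space \<Rightarrow> 'm"
    and act :: "'g \<Rightarrow> 'a::ab_group_add \<Rightarrow> 'a"
    and R :: "('g, 'f::ab_group_add, 'a) based_complex"
    and h :: "'f \<Rightarrow> 'm set"
  assumes group: "group G"
    and isometric: "isometric_action G \<rho>"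
    and module: "G_module G act"
    and resolution: "based_free_resolution G act R"
    and control: "control_map G \<rho> R h"
begin

abbreviation "tr \<equiv> res_act R"
abbreviation "bd \<equiv> res_bd R"
abbreviation "aug \<equiv> res_aug R"
abbreviation "X \<equiv> res_basis R"
abbreviation "XX \<equiv> (\<Union>k. res_basis R k)"
abbreviation "expand \<equiv> basis_expansion G R"

sublocale group G by (rule group)

sublocale M: group_action G UNIV \<rho> using isometric by (simp add: isometric_action_def)

sublocale A: group_action G UNIV act using module by (simp add: G_module_def)

lemma res_module: "G_module G tr"
  using resolution by (simp add: based_free_resolution_def)

sublocale F: group_action G UNIV tr using res_module by (simp add: G_module_def)

lemma rho_mult: "g \<in> carrier G \<Longrightarrow> k \<in> carrier G \<Longrightarrow> \<rho> (g \<otimes>\<^bsub>G\<^esub> k) x = \<rho> g (\<rho> k x)"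
  using M.composition_rule by auto

lemma rho_one [simp]: "\<rho> \<one>\<^bsub>G\<^esub> x = x"
  using M.id_eq_one by (metis UNIV_I restrict_apply)

lemma rho_inv [simp]: "g \<in> carrier G \<Longrightarrow> \<rho> (inv\<^bsub>G\<^esub> g) (\<rho> g x) = x" 
  "g \<in> carrier G \<Longrightarrow> \<rho> g (\<rho> (inv\<^bsub>G\<^esub> g) x) = x"
  by (simp_all flip: rho_mult)

lemma rho_isometry: "g \<in> carrier G \<Longrightarrow> dist (\<rho> g x) (\<rho> g y) = dist x y"
  using isometric by (simp add: isometric_action_def)

lemma tr_mult: "g \<in> carrier G \<Longrightarrow> k \<in> carrier G \<Longrightarrow> tr (g \<otimes>\<^bsub>G\<^esub> k) c = tr g (tr k c)"
  using F.composition_rule by auto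

lemma tr_one [simp]: "tr \<one>\<^bsub>G\<^esub> c = c"
  using F.id_eq_one by (metis UNIV_I restrict_apply)

lemma tr_inv [simp]: "g \<in> carrier G \<Longrightarrow> tr (inv\<^bsub>G\<^esub> g) (tr g c) = c"
  "g \<in> carrier G \<Longrightarrow> tr g (tr (inv\<^bsub>G\<^esub> g) c) = c"
  by (simp_all flip: tr_mult)

lemma act_inv: "g \<in> carrier G \<Longrightarrow> act (inv\<^bsub>G\<^esub> g) (act g c) = c"
  using A.orbit_sym_aux by auto

lemma additive_tr: "g \<in> carrier G \<Longrightarrow> Modules.additive (tr g)"
  using res_module by (simp add: G_module_def Modules.additive_def)

lemma additive_bd: "Modules.additive bd"
  using resolution by (simp add: based_free_resolution_def additive_on_def Modules.additive_def)

lemma bd_tr: "g \<in> carrier G \<Longrightarrow> bd (tr g c) = tr g (bd c)"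
  using resolution by (simp add: based_free_resolution_def G_map_on_def)

lemma bd_chains_0: "c \<in> chains G R 0 \<Longrightarrow> bd c = 0"
  using resolution by (simp add: based_free_resolution_def)

lemma bd_image: "bd ` chains G R (Suc k) = cycles G R k"
  using resolution unfolding based_free_resolution_def by blast

lemma aug_tr: "g \<in> carrier G \<Longrightarrow> c \<in> chains G R 0 \<Longrightarrow> aug (tr g c) = act g (aug c)"
  using resolution by (simp add: based_free_resolution_def G_map_on_def)

lemma aug_surj: "\<exists>c\<in>chains G R 0. aug c = a"
proof -
  have "aug ` chains G R 0 = UNIV" using resolution unfolding based_free_resolution_def by blast
  then show ?thesis by (metis UNIV_I imageE)
qed

lemma aug_add: "c \<in> chains G R 0 \<Longrightarrow> d \<in> chains G R 0 \<Longrightarrow> aug (c + d) = aug c + aug d"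
  using resolution by (simp add: based_free_resolution_def additive_on_def)

lemma basis_disjoint: "x \<in> X i \<Longrightarrow> x \<in> X j \<Longrightarrow> i = j"
proof -
  have "disjoint_family X" using resolution by (simp add: based_free_resolution_def)
  then show "x \<in> X i \<Longrightarrow> x \<in> X j \<Longrightarrow> i = j" unfolding disjoint_family_on_def by blast
qed

lemma comb_bij: "bij_betw (zg_comb tr) (zg_coeffs G XX) UNIV"
  using resolution by (simp add: based_free_resolution_def zg_basis_def)

lemma expand_coeffs: "expand c \<in> zg_coeffs G XX"
  unfolding basis_expansion_def
  using bij_betw_imp_surj_on[OF bij_betw_the_inv_into[OF comb_bij]] by blast

lemma comb_expand [simp]: "zg_comb tr (expand c) = c"
  unfolding basis_expansion_def using comb_bij by (simp add: f_the_inv_into_f_bij_betw)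

lemma expand_comb: "r \<in> zg_coeffs G XX \<Longrightarrow> expand (zg_comb tr r) = r"
  unfolding basis_expansion_def using comb_bij by (intro the_inv_into_f_f) (auto simp: bij_betw_def)

lemma coeffs_add:
  assumes "r \<in> zg_coeffs G S" "s \<in> zg_coeffs G S" shows "r + s \<in> zg_coeffs G S"
proof -
  have "Poly_Mapping.keys (Poly_Mapping.lookup (r + s) x) \<subseteq> carrier G" for x
    using assms Poly_Mapping.keys_add[of "Poly_Mapping.lookup r x" "Poly_Mapping.lookup s x"]
    unfolding zg_coeffs_def lookup_add by blast
  then show ?thesis
    using assms Poly_Mapping.keys_add[of r s] by (auto simp: zg_coeffs_def)
qed

lemma additive_expand: "Modules.additive expand"
proof
  fix c d
  have "zg_comb tr (expand c + expand d) = c + d"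
    by (simp add: additive.add[OF additive_zg_comb])
  then show "expand (c + d) = expand c + expand d"
    using expand_comb[OF coeffs_add[OF expand_coeffs expand_coeffs], of c d] by simp
qed

lemma coeffs_single: "g \<in> carrier G \<Longrightarrow> x \<in> S \<Longrightarrow>
  Poly_Mapping.single x (Poly_Mapping.single g (1::int)) \<in> zg_coeffs G S"
  by (auto simp: zg_coeffs_def lookup_single when_def split: if_splits)

lemma expand_basis:
  "g \<in> carrier G \<Longrightarrow> x \<in> XX \<Longrightarrow> expand (tr g x) = Poly_Mapping.single x (Poly_Mapping.single g 1)"
  using expand_comb[OF coeffs_single] by (simp only: zg_comb_single)

text \<open>Since \<open>XX\<close> is a basis, membership in a span is visible in the unique
  expansion, so closure properties of spans reduce to those of sets of keys.\<close>

lemma span_iff: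
  assumes "S \<subseteq> XX"
  shows "c \<in> zg_span G tr S \<longleftrightarrow> Poly_Mapping.keys (expand c) \<subseteq> S"
proof
  assume "c \<in> zg_span G tr S"
  then obtain r where r: "r \<in> zg_coeffs G S" "c = zg_comb tr r" by (auto simp: zg_span_def)
  moreover have "zg_coeffs G S \<subseteq> zg_coeffs G XX" using assms by (auto simp: zg_coeffs_def)
  ultimately have "expand c = r" using expand_comb by blast
  then show "Poly_Mapping.keys (expand c) \<subseteq> S" using r by (simp add: zg_coeffs_def)
next
  assume "Poly_Mapping.keys (expand c) \<subseteq> S"
  then have "expand c \<in> zg_coeffs G S" using expand_coeffs[of c] by (simp add: zg_coeffs_def)
  then show "c \<in> zg_span G tr S" unfolding zg_span_def by (metis comb_expand imageI)
qed

text \<open>An element is an integral combination of the elements of its own support. Staying inside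
  the support matters for valuations: a lower bound for \<open>c\<close> is inherited by the
  elements of its support.\<close>

lemma supp_induct [consumes 0, case_names zero supp add minus]:
  assumes "P 0" "\<And>y. y \<in> supp G R c \<Longrightarrow> P y" "\<And>u v. P u \<Longrightarrow> P v \<Longrightarrow> P (u + v)" "\<And>u. P u \<Longrightarrow> P (- u)"
  shows "P c"
proof -
  have sc: "P (int_scale k y)" if "P y" for k y
    by (rule int_scale_closed[of P]) (use assms that in auto)
  have "P (zg_comb tr (expand c))"
    unfolding zg_comb_def zg_smult_def
  proof (rule sum_closed_induct[of P, OF assms(1,3)], assumption+, rule sum_closed_induct[of P, OF assms(1,3)], assumption+)
    fix x g assume "g \<in> Poly_Mapping.keys (Poly_Mapping.lookup (expand c) x)"
    then show "P (int_scale (Poly_Mapping.lookup (Poly_Mapping.lookup (expand c) x) g) (tr g x))"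
      by (intro sc assms(2)) (auto simp: supp_def in_keys_iff)
  qed
  then show ?thesis by simp
qed

lemma supp_cases:
  assumes "y \<in> supp G R c"
  obtains g x where "g \<in> carrier G" "x \<in> XX" "x \<in> Poly_Mapping.keys (expand c)" "y = tr g x"
proof -
  obtain g x where y: "y = tr g x" "Poly_Mapping.lookup (Poly_Mapping.lookup (expand c) x) g \<noteq> 0"
    using assms by (auto simp: supp_def)
  then have x: "x \<in> Poly_Mapping.keys (expand c)" by (auto simp: in_keys_iff)
  then show ?thesis
    using that[of g x] y expand_coeffs[of c] by (auto simp: zg_coeffs_def in_keys_iff subset_iff)
qed

lemma span_induct [consumes 2, case_names zero basis add minus]:
  assumes "c \<in> zg_span G tr S" "S \<subseteq> XX"
    "P 0" "\<And>g x. g \<in> carrier G \<Longrightarrow> x \<in> S \<Longrightarrow> P (tr g x)"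
    "\<And>u v. P u \<Longrightarrow> P v \<Longrightarrow> P (u + v)" "\<And>u. P u \<Longrightarrow> P (- u)"
  shows "P c"
proof (induction c rule: supp_induct)
  case (supp y)
  then show ?case using assms(1,4) unfolding span_iff[OF assms(2)] by (auto elim!: supp_cases)
qed (use assms in auto)

lemma span_0: "S \<subseteq> XX \<Longrightarrow> 0 \<in> zg_span G tr S"
  by (simp add: span_iff additive.zero[OF additive_expand])

lemma span_add: "S \<subseteq> XX \<Longrightarrow> c \<in> zg_span G tr S \<Longrightarrow> d \<in> zg_span G tr S \<Longrightarrow> c + d \<in> zg_span G tr S"
  using Poly_Mapping.keys_add[of "expand c" "expand d"]
  by (auto simp: span_iff additive.add[OF additive_expand])

lemma span_minus: "S \<subseteq> XX \<Longrightarrow> c \<in> zg_span G tr S \<Longrightarrow> - c \<in> zg_span G tr S"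
  by (simp add: span_iff additive.minus[OF additive_expand])

lemma span_basis: "S \<subseteq> XX \<Longrightarrow> g \<in> carrier G \<Longrightarrow> x \<in> S \<Longrightarrow> tr g x \<in> zg_span G tr S"
proof -
  assume S: "S \<subseteq> XX" "g \<in> carrier G" "x \<in> S"
  then have "expand (tr g x) = Poly_Mapping.single x (Poly_Mapping.single g 1)"
    by (intro expand_basis) auto
  then show "tr g x \<in> zg_span G tr S" using S by (simp add: span_iff)
qed

lemma span_tr:
  assumes "S \<subseteq> XX" "g \<in> carrier G" "c \<in> zg_span G tr S"
  shows "tr g c \<in> zg_span G tr S"
  using assms(3,1)
proof (induction c rule: span_induct)
  case (basis k x)
  then show ?case using assms by (simp add: span_basis flip: tr_mult)
qed (simp_all add: additive.zero[OF additive_tr[OF assms(2)]] additive.add[OF additive_tr[OF assms(2)]]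
      additive.minus[OF additive_tr[OF assms(2)]] span_0 span_add span_minus assms(1) del: Union_iff)

lemma X_subset: "X k \<subseteq> XX" "(\<Union>i\<le>k. X i) \<subseteq> XX"
  by auto

lemmas chains_induct [consumes 1, case_names zero basis add minus] =
  span_induct[OF _ X_subset(1), folded chains_def]
lemmas chains_0 [simp] = span_0[OF X_subset(1), folded chains_def]
lemmas chains_add = span_add[OF X_subset(1), folded chains_def]
lemmas chains_minus = span_minus[OF X_subset(1), folded chains_def]
lemmas chains_basis = span_basis[OF X_subset(1), folded chains_def]
lemmas chains_tr = span_tr[OF X_subset(1), folded chains_def]

lemma chains_diff: "c \<in> chains G R k \<Longrightarrow> d \<in> chains G R k \<Longrightarrow> c - d \<in> chains G R k"
  using chains_add[OF _ chains_minus, of c k d] by simp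

lemmas skeleton_0 [simp] = span_0[OF X_subset(2), folded skeleton_def]
lemmas skeleton_add = span_add[OF X_subset(2), folded skeleton_def]
lemmas skeleton_minus = span_minus[OF X_subset(2), folded skeleton_def]
lemmas skeleton_tr = span_tr[OF X_subset(2), folded skeleton_def]

lemma chains_skeleton: "i \<le> k \<Longrightarrow> c \<in> chains G R i \<Longrightarrow> c \<in> skeleton G R k"
  unfolding chains_def skeleton_def span_iff[OF X_subset(1)] span_iff[OF X_subset(2)] by auto

lemma skeleton_induct [consumes 1, case_names zero chain add minus]:
  assumes "c \<in> skeleton G R k" "P 0" "\<And>c i. i \<le> k \<Longrightarrow> c \<in> chains G R i \<Longrightarrow> P c"
    "\<And>u v. P u \<Longrightarrow> P v \<Longrightarrow> P (u + v)" "\<And>u. P u \<Longrightarrow> P (- u)"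
  shows "P c"
  using assms(1) X_subset(2) unfolding skeleton_def
proof (induction c rule: span_induct)
  case (basis g x)
  then show ?case using assms(3) chains_basis by blast
qed (use assms in auto)

lemma cycles_chains: "z \<in> cycles G R i \<Longrightarrow> z \<in> chains G R i"
  by (simp add: cycles_def)

lemma bd_cycle: "z \<in> cycles G R i \<Longrightarrow> bd z = 0"
  by (cases i) (auto simp: cycles_def bd_chains_0)

lemma bd_chains_Suc: "c \<in> chains G R (Suc k) \<Longrightarrow> bd c \<in> cycles G R k"
  using bd_image by blast

lemma bd_bd: "c \<in> chains G R k \<Longrightarrow> bd (bd c) = 0"
  using bd_cycle[OF bd_chains_Suc] by (cases k) (auto simp: bd_chains_0 additive.zero[OF additive_bd])

lemma cycle_is_boundary: "z \<in> cycles G R k \<Longrightarrow> \<exists>c\<in>chains G R (Suc k). bd c = z"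
  using bd_image[of k] by (metis imageE)

lemma cycles_tr: 
  assumes "g \<in> carrier G" "z \<in> cycles G R k" shows "tr g z \<in> cycles G R k"
proof -
  obtain c where "c \<in> chains G R (Suc k)" "bd c = z" using cycle_is_boundary assms by blast
  then show ?thesis using bd_chains_Suc[OF chains_tr[OF assms(1)], of c k] bd_tr[OF assms(1)] by simp
qed

text \<open>The expansions of a finite generating set involve a finite set \<open>K\<close> of basis
  elements, and these span the skeleton. A basis element of the skeleton has itself as its only key,
  so it belongs to \<open>K\<close>.\<close>

lemma basis_finite:
  assumes "zg_fin_gen G tr (skeleton G R n)"
  shows "finite (\<Union>k\<le>n. X k)"
proof -
  obtain S where S: "finite S" "zg_span G tr S = skeleton G R n" using assms by (auto simp: zg_fin_gen_def)
  define K where "K = (\<Union>s\<in>S. Poly_Mapping.keys (expand s))"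
  have "finite K" using S by (simp add: K_def)
  have K: "K \<subseteq> XX" using expand_coeffs by (auto simp: K_def zg_coeffs_def)
  have SK: "s \<in> zg_span G tr K" if "s \<in> S" for s
    using that unfolding span_iff[OF K] by (auto simp: K_def)
  have "zg_span G tr S \<subseteq> zg_span G tr K"
  proof
    fix c assume "c \<in> zg_span G tr S"
    then obtain r where r: "r \<in> zg_coeffs G S" "c = zg_comb tr r" by (auto simp: zg_span_def)
    let ?P = "\<lambda>c. c \<in> zg_span G tr K"
    have "?P (int_scale k (tr g s))" if "g \<in> carrier G" "s \<in> S" for k g s
      by (rule int_scale_closed[of ?P]) (use that K SK in \<open>auto intro: span_0 span_add span_minus span_tr\<close>)
    then show "?P c"
      unfolding r(2) zg_comb_def zg_smult_def using r(1)
      by (intro sum_closed_induct[of ?P] span_0[OF K] span_add[OF K]) (unfold zg_coeffs_def, blast+)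
  qed
  moreover have "x \<in> skeleton G R n" if "x \<in> X k" "k \<le> n" for x k
    using chains_skeleton[OF that(2) chains_basis[OF one_closed that(1)]] by simp
  ultimately have "x \<in> K" if "x \<in> X k" "k \<le> n" for x k
    using that S(2) span_iff[OF K, of x] expand_basis[OF one_closed, of x] by fastforce
  then have "(\<Union>k\<le>n. X k) \<subseteq> K" by blast
  then show ?thesis using \<open>finite K\<close> by (rule finite_subset)
qed


subsection \<open>Finitary maps\<close>

text \<open>The witness of finitarity without the map. It lives on the whole total module, so that
  powers and conjugates need no conditions on domains; maps given on a skeleton are extended in
  \<open>total_extension\<close>.\<close>

definition fin_eq :: "('f \<Rightarrow> 'f set) \<Rightarrow> bool" where
  "fin_eq \<Phi> \<longleftrightarrow> (\<forall>c. finite (\<Phi> c)) \<and> (\<forall>g\<in>carrier G. \<forall>c. \<Phi> (tr g c) = tr g ` \<Phi> c)"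

text \<open>Maps that share \<open>\<Phi>\<close> have a common bound on their lag.\<close>

definition sel :: "('f \<Rightarrow> 'f set) \<Rightarrow> ('f \<Rightarrow> 'f) \<Rightarrow> bool" where
  "sel \<Phi> \<phi> \<longleftrightarrow> Modules.additive \<phi> \<and> (\<forall>c. \<phi> c \<in> \<Phi> c)"

lemma fin_eq_finite: "fin_eq \<Phi> \<Longrightarrow> finite (\<Phi> c)"
  by (simp add: fin_eq_def)

lemma fin_eq_tr: "fin_eq \<Phi> \<Longrightarrow> g \<in> carrier G \<Longrightarrow> \<Phi> (tr g c) = tr g ` \<Phi> c"
  by (simp add: fin_eq_def)

lemma fin_eq_singleton:
  assumes "\<And>g c. g \<in> carrier G \<Longrightarrow> f (tr g c) = tr g (f c)"
  shows "fin_eq (\<lambda>c. {f c})"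
  using assms by (simp add: fin_eq_def)

lemma fin_eq_comp:
  assumes "fin_eq \<Phi>" "fin_eq \<Psi>" shows "fin_eq (\<lambda>c. \<Union>(\<Psi> ` \<Phi> c))"
  using assms by (auto simp: fin_eq_def)

lemma fin_eq_diff:
  assumes "fin_eq \<Phi>" "fin_eq \<Psi>" shows "fin_eq (\<lambda>c. (\<lambda>(p, q). p - q) ` (\<Phi> c \<times> \<Psi> c))"
  unfolding fin_eq_def
proof (intro conjI allI ballI)
  fix g c assume g: "g \<in> carrier G"
  have "(\<lambda>(p, q). p - q) ` (tr g ` \<Phi> c \<times> tr g ` \<Psi> c) = (\<lambda>(p, q). tr g p - tr g q) ` (\<Phi> c \<times> \<Psi> c)"
    by (force simp: image_iff)
  then show "(\<lambda>(p, q). p - q) ` (\<Phi> (tr g c) \<times> \<Psi> (tr g c)) = tr g ` (\<lambda>(p, q). p - q) ` (\<Phi> c \<times> \<Psi> c)"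
    using assms g by (simp add: fin_eq_tr image_image case_prod_beta additive.diff[OF additive_tr[OF g]])
qed (use assms in \<open>simp add: fin_eq_def\<close>)

lemma fin_eq_iter: "fin_eq \<Phi> \<Longrightarrow> fin_eq (iter_sel \<Phi> N)"
proof (induction N)
  case 0
  have "iter_sel \<Phi> 0 = (\<lambda>c. {c})" by (rule ext) simp
  then show ?case using fin_eq_singleton[of "\<lambda>c. c"] by simp
next
  case (Suc N)
  have "iter_sel \<Phi> (Suc N) = (\<lambda>c. \<Union>(\<Phi> ` iter_sel \<Phi> N c))" by (rule ext) simp
  then show ?case using fin_eq_comp[OF Suc.IH[OF Suc.prems] Suc.prems] by simp
qed

lemma funpow_additive: "Modules.additive \<phi> \<Longrightarrow> Modules.additive (\<phi> ^^ N)" for \<phi> :: "'f \<Rightarrow> 'f"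
  by (induction N) (simp_all add: Modules.additive_def)

lemma sel_funpow: "sel \<Phi> \<phi> \<Longrightarrow> sel (iter_sel \<Phi> N) (\<phi> ^^ N)"
  unfolding sel_def by (induction N) (auto simp: funpow_additive simp del: funpow.simps, auto)

text \<open>Equivariance of \<open>\<Phi>\<close> makes a conjugate select from the same finite
  sets. Bounds obtained from \<open>\<Phi>\<close> thus hold for all conjugates at once.\<close>

lemma sel_conj:
  assumes "fin_eq \<Phi>" "sel \<Phi> \<phi>" "g \<in> carrier G"
  shows "sel \<Phi> (\<lambda>c. tr (inv\<^bsub>G\<^esub> g) (\<phi> (tr g c)))"
proof -
  have "tr (inv\<^bsub>G\<^esub> g) (\<phi> (tr g c)) \<in> tr (inv\<^bsub>G\<^esub> g) ` tr g ` \<Phi> c" for c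
    using assms fin_eq_tr[OF assms(1,3)] unfolding sel_def by blast
  moreover have "tr (inv\<^bsub>G\<^esub> g) ` tr g ` \<Phi> c = \<Phi> c" for c using assms(3) by (simp add: image_image)
  moreover have "Modules.additive (\<lambda>c. tr (inv\<^bsub>G\<^esub> g) (\<phi> (tr g c)))"
    using assms additive_tr[of g] additive_tr[of "inv\<^bsub>G\<^esub> g"] by (simp add: sel_def Modules.additive_def)
  ultimately show ?thesis by (simp add: sel_def)
qed

text \<open>\<open>\<Psi> c\<close> collects the values at \<open>c\<close> of all candidate maps at once. It is equivariant because
  conjugation by \<open>G\<close> permutes the candidates.\<close>

lemma fin_eq_extension:
  assumes S: "\<And>x. x \<in> XX \<Longrightarrow> finite (S x)"
  shows "\<exists>\<Psi>. fin_eq \<Psi> \<and> (\<forall>t. (\<forall>g\<in>carrier G. \<forall>x\<in>XX. t g x \<in> tr g ` S x) \<longrightarrow>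
    (\<exists>\<phi>. sel \<Psi> \<phi> \<and> (\<forall>g\<in>carrier G. \<forall>x\<in>XX. \<phi> (tr g x) = t g x)))"
proof -
  define fam where "fam = {f. Modules.additive f \<and> (\<forall>g\<in>carrier G. \<forall>x\<in>XX. f (tr g x) \<in> tr g ` S x)}"
  define \<Psi> where "\<Psi> c = {f c | f. f \<in> fam}" for c
  have fam_conj: "(\<lambda>c. tr k (f (tr (inv\<^bsub>G\<^esub> k) c))) \<in> fam" if "f \<in> fam" "k \<in> carrier G" for f k
  proof -
    have "tr k (f (tr (inv\<^bsub>G\<^esub> k) (tr g x))) \<in> tr g ` S x" if g: "g \<in> carrier G" "x \<in> XX" for g x
    proof -
      have "f (tr (inv\<^bsub>G\<^esub> k \<otimes>\<^bsub>G\<^esub> g) x) \<in> tr (inv\<^bsub>G\<^esub> k \<otimes>\<^bsub>G\<^esub> g) ` S x"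
        using \<open>f \<in> fam\<close> g \<open>k \<in> carrier G\<close> unfolding fam_def by blast
      then obtain y where "y \<in> S x" "f (tr (inv\<^bsub>G\<^esub> k \<otimes>\<^bsub>G\<^esub> g) x) = tr (inv\<^bsub>G\<^esub> k \<otimes>\<^bsub>G\<^esub> g) y" by blast
      then show ?thesis using g \<open>k \<in> carrier G\<close> by (simp add: tr_mult)
    qed
    moreover have "Modules.additive (\<lambda>c. tr k (f (tr (inv\<^bsub>G\<^esub> k) c)))"
      using that additive_tr[of k] additive_tr[of "inv\<^bsub>G\<^esub> k"] by (simp add: fam_def Modules.additive_def)
    ultimately show ?thesis unfolding fam_def by blast
  qed
  have sub: "\<Psi> (tr k c) \<subseteq> tr k ` \<Psi> c" if "k \<in> carrier G" for k c
  proof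
    fix y assume "y \<in> \<Psi> (tr k c)"
    then obtain f where f: "f \<in> fam" "y = f (tr k c)" by (auto simp: \<Psi>_def)
    have "(\<lambda>c. tr (inv\<^bsub>G\<^esub> k) (f (tr (inv\<^bsub>G\<^esub> (inv\<^bsub>G\<^esub> k)) c))) \<in> fam"
      using fam_conj[OF f(1)] that by blast
    then have "tr (inv\<^bsub>G\<^esub> k) y \<in> \<Psi> c" using f(2) that by (auto simp: \<Psi>_def)
    then show "y \<in> tr k ` \<Psi> c" using that by (metis image_eqI tr_inv(2))
  qed
  have eq: "\<Psi> (tr k c) = tr k ` \<Psi> c" if k: "k \<in> carrier G" for k c
  proof
    have "\<Psi> c \<subseteq> tr (inv\<^bsub>G\<^esub> k) ` \<Psi> (tr k c)" using sub[of "inv\<^bsub>G\<^esub> k" "tr k c"] k by simp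
    then have "tr k ` \<Psi> c \<subseteq> tr k ` tr (inv\<^bsub>G\<^esub> k) ` \<Psi> (tr k c)" by (rule image_mono)
    then show "tr k ` \<Psi> c \<subseteq> \<Psi> (tr k c)" using k by (simp add: image_image)
  qed (rule sub[OF k])
  \<comment> \<open>An additive map is determined at \<open>c\<close> by its values on the support
    of \<open>c\<close>, and each element of the support admits finitely many values.\<close>
  have "finite (\<Psi> c)" for c
  proof (induction c rule: supp_induct)
    case zero
    have "\<Psi> 0 \<subseteq> {0}" by (auto simp: \<Psi>_def fam_def additive.zero)
    then show ?case by (rule finite_subset) simp
  next
    case (supp y)
    then obtain g x where y: "g \<in> carrier G" "x \<in> XX" "y = tr g x" by (rule supp_cases)
    then have "\<Psi> y \<subseteq> tr g ` S x" by (auto simp: \<Psi>_def fam_def)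
    then show ?case by (rule finite_subset) (use S y in auto)
  next
    case (add u v)
    have "\<Psi> (u + v) \<subseteq> (\<lambda>(p, q). p + q) ` (\<Psi> u \<times> \<Psi> v)"
      by (force simp: \<Psi>_def fam_def additive.add)
    then show ?case by (rule finite_subset) (use add in auto)
  next
    case (minus u)
    have "\<Psi> (- u) \<subseteq> uminus ` \<Psi> u" by (force simp: \<Psi>_def fam_def additive.minus)
    then show ?case by (rule finite_subset) (use minus in auto)
  qed
  then have "fin_eq \<Psi>" using eq by (simp add: fin_eq_def)
  moreover have "\<exists>\<phi>. sel \<Psi> \<phi> \<and> (\<forall>g\<in>carrier G. \<forall>x\<in>XX. \<phi> (tr g x) = t g x)"
    if t: "\<forall>g\<in>carrier G. \<forall>x\<in>XX. t g x \<in> tr g ` S x" for t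
  proof -
    \<comment> \<open>Here \<open>t\<close> takes the place of the action in \<open>zg_comb\<close>:
      the translates \<open>g x\<close> are treated as a basis over the integers and receive
      independent values.\<close>
    define \<phi> where "\<phi> c = zg_comb t (expand c)" for c
    have "Modules.additive \<phi>"
      by (simp add: Modules.additive_def \<phi>_def additive.add[OF additive_expand] additive.add[OF additive_zg_comb])
    moreover have \<phi>: "\<forall>g\<in>carrier G. \<forall>x\<in>XX. \<phi> (tr g x) = t g x"
      unfolding \<phi>_def by (intro ballI, subst expand_basis) (simp_all add: zg_comb_single)
    ultimately have "\<phi> \<in> fam" using t by (simp add: fam_def)
    then show ?thesis using \<phi> \<open>Modules.additive \<phi>\<close> by (auto simp: sel_def \<Psi>_def)
  qed
  ultimately show ?thesis by blast
qed

lemma additive_eq_on_chains: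
  assumes "c \<in> chains G R k" "Modules.additive f" "Modules.additive f'"
    "\<And>g x. g \<in> carrier G \<Longrightarrow> x \<in> X k \<Longrightarrow> f (tr g x) = f' (tr g x)"
  shows "f c = f' c"
  using assms(1) by (induction c rule: chains_induct)
    (auto simp: assms additive.zero[OF assms(2)] additive.zero[OF assms(3)] additive.add[OF assms(2)] 
      additive.add[OF assms(3)] additive.minus[OF assms(2)] additive.minus[OF assms(3)])

text \<open>The step in constructions by degree: a selection is kept outside degree \<open>k\<close>
  and redefined freely in degree \<open>k\<close>. The order of quantifiers matters, since
  \<open>\<Psi>\<close> is fixed before the old map and the new values are known.\<close>

lemma extend_degree:
  assumes \<Phi>: "fin_eq \<Phi>" and S: "\<And>x. x \<in> X k \<Longrightarrow> finite (S x)"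
  shows "\<exists>\<Psi>. fin_eq \<Psi> \<and> (\<forall>\<phi>0 t. sel \<Phi> \<phi>0 \<longrightarrow> (\<forall>g\<in>carrier G. \<forall>x\<in>X k. t g x \<in> tr g ` S x) \<longrightarrow>
    (\<exists>\<phi>. sel \<Psi> \<phi> \<and> (\<forall>i. i \<noteq> k \<longrightarrow> (\<forall>c\<in>chains G R i. \<phi> c = \<phi>0 c)) \<and>
      (\<forall>g\<in>carrier G. \<forall>x\<in>X k. \<phi> (tr g x) = t g x)))"
proof -
  define S' where "S' x = (if x \<in> X k then S x else \<Phi> x)" for x
  have "finite (S' x)" for x using S \<Phi> by (simp add: S'_def fin_eq_def)
  then obtain \<Psi> where \<Psi>: "fin_eq \<Psi>" and ex: "\<forall>t. (\<forall>g\<in>carrier G. \<forall>x\<in>XX. t g x \<in> tr g ` S' x) \<longrightarrow>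
    (\<exists>\<phi>. sel \<Psi> \<phi> \<and> (\<forall>g\<in>carrier G. \<forall>x\<in>XX. \<phi> (tr g x) = t g x))"
    using fin_eq_extension[of S'] by blast
  have "\<exists>\<phi>. sel \<Psi> \<phi> \<and> (\<forall>i. i \<noteq> k \<longrightarrow> (\<forall>c\<in>chains G R i. \<phi> c = \<phi>0 c)) \<and>
      (\<forall>g\<in>carrier G. \<forall>x\<in>X k. \<phi> (tr g x) = t g x)"
    if s: "sel \<Phi> \<phi>0" and t: "\<forall>g\<in>carrier G. \<forall>x\<in>X k. t g x \<in> tr g ` S x" for \<phi>0 t
  proof -
    define t' where "t' g x = (if x \<in> X k then t g x else \<phi>0 (tr g x))" for g x
    have "\<forall>g\<in>carrier G. \<forall>x\<in>XX. t' g x \<in> tr g ` S' x"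
    proof (intro ballI)
      fix g x assume g: "g \<in> carrier G"
      have "\<phi>0 (tr g x) \<in> tr g ` \<Phi> x" using s fin_eq_tr[OF \<Phi> g] by (metis sel_def)
      then show "t' g x \<in> tr g ` S' x" using t g by (simp add: t'_def S'_def)
    qed
    then have "\<exists>\<phi>. sel \<Psi> \<phi> \<and> (\<forall>g\<in>carrier G. \<forall>x\<in>XX. \<phi> (tr g x) = t' g x)"
      using ex by (elim allE[of _ t'] impE)
    then obtain \<phi> where \<phi>: "sel \<Psi> \<phi>" "\<forall>g\<in>carrier G. \<forall>x\<in>XX. \<phi> (tr g x) = t' g x" by blast
    have "\<phi> c = \<phi>0 c" if i: "i \<noteq> k" "c \<in> chains G R i" for i c
      using i(2)
    proof (rule additive_eq_on_chains)
      fix g x assume "g \<in> carrier G" "x \<in> X i"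
      then show "\<phi> (tr g x) = \<phi>0 (tr g x)" using \<phi>(2) i(1) basis_disjoint[of x i k] by (auto simp: t'_def)
    qed (use \<phi> s in \<open>auto simp: sel_def\<close>)
    moreover have "\<forall>g\<in>carrier G. \<forall>x\<in>X k. \<phi> (tr g x) = t g x" using \<phi>(2) by (auto simp: t'_def)
    ultimately show ?thesis using \<phi>(1) by blast
  qed
  then show ?thesis using \<Psi> by blast
qed

section \<open>Chain maps and chain homotopies\<close>

definition chain_map :: "nat \<Rightarrow> ('f \<Rightarrow> 'f) \<Rightarrow> bool" where
  "chain_map k \<phi> \<longleftrightarrow> Modules.additive \<phi> \<and> (\<forall>i\<le>k. \<forall>c\<in>chains G R i. \<phi> c \<in> chains G R i \<and> bd (\<phi> c) = \<phi> (bd c)) \<and>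
     (\<forall>c\<in>chains G R 0. aug (\<phi> c) = aug c)"

lemma chain_map_additive: "chain_map k \<phi> \<Longrightarrow> Modules.additive \<phi>"
  and chain_map_chains: "chain_map k \<phi> \<Longrightarrow> i \<le> k \<Longrightarrow> c \<in> chains G R i \<Longrightarrow> \<phi> c \<in> chains G R i"
  and chain_map_bd: "chain_map k \<phi> \<Longrightarrow> i \<le> k \<Longrightarrow> c \<in> chains G R i \<Longrightarrow> bd (\<phi> c) = \<phi> (bd c)"
  and chain_map_aug: "chain_map k \<phi> \<Longrightarrow> c \<in> chains G R 0 \<Longrightarrow> aug (\<phi> c) = aug c"
  by (auto simp: chain_map_def)

lemma chain_map_cycles:
  assumes "chain_map k \<phi>" "i \<le> k" "z \<in> cycles G R i" shows "\<phi> z \<in> cycles G R i"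
proof -
  have z: "z \<in> chains G R i" by (rule cycles_chains[OF assms(3)])
  have "\<phi> z \<in> chains G R i" using chain_map_chains[OF assms(1,2) z] .
  moreover have "bd (\<phi> z) = 0"
    using chain_map_bd[OF assms(1,2) z] bd_cycle[OF assms(3)] additive.zero[OF chain_map_additive[OF assms(1)]]
    by simp
  moreover have "aug (\<phi> z) = 0" if "i = 0"
    using chain_map_aug[OF assms(1), of z] z assms(3) that by (simp add: cycles_def)
  ultimately show ?thesis by (simp add: cycles_def)
qed

lemma chain_map_comp: "chain_map k \<phi> \<Longrightarrow> chain_map k \<psi> \<Longrightarrow> chain_map k (\<phi> \<circ> \<psi>)"
  by (auto simp: chain_map_def Modules.additive_def)

lemma chain_map_funpow: "chain_map k \<phi> \<Longrightarrow> chain_map k (\<phi> ^^ N)"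
proof (induction N)
  case 0
  then show ?case by (simp add: chain_map_def Modules.additive_def)
next
  case (Suc N)
  then show ?case using chain_map_comp[of k \<phi> "\<phi> ^^ N"] by (simp add: comp_def)
qed

lemma chain_map_conj:
  assumes "chain_map k \<phi>" "g \<in> carrier G"
  shows "chain_map k (\<lambda>c. tr (inv\<^bsub>G\<^esub> g) (\<phi> (tr g c)))"
proof -
  have g': "inv\<^bsub>G\<^esub> g \<in> carrier G" using assms by simp
  have "Modules.additive (\<lambda>c. tr (inv\<^bsub>G\<^esub> g) (\<phi> (tr g c)))"
    using additive_tr[OF assms(2)] additive_tr[OF g'] chain_map_additive[OF assms(1)]
    by (simp add: Modules.additive_def)
  moreover have "aug (tr (inv\<^bsub>G\<^esub> g) (\<phi> (tr g c))) = aug c" if "c \<in> chains G R 0" for c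
    using that assms g' chain_map_chains[OF assms(1), of 0] chain_map_aug[OF assms(1)]
    by (simp add: aug_tr chains_tr act_inv)
  moreover have "tr (inv\<^bsub>G\<^esub> g) (\<phi> (tr g c)) \<in> chains G R i \<and>
      bd (tr (inv\<^bsub>G\<^esub> g) (\<phi> (tr g c))) = tr (inv\<^bsub>G\<^esub> g) (\<phi> (tr g (bd c)))" 
    if "i \<le> k" "c \<in> chains G R i" for i c
    using that assms g' chain_map_chains[OF assms(1), of i] chain_map_bd[OF assms(1), of i]
    by (simp add: bd_tr chains_tr)
  ultimately show ?thesis by (simp add: chain_map_def)
qed

definition fill :: "nat \<Rightarrow> 'f \<Rightarrow> 'f" where
  "fill k z = (SOME c. c \<in> chains G R (Suc k) \<and> bd c = z)"

lemma fill: 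
  assumes "z \<in> cycles G R k"
  shows "fill k z \<in> chains G R (Suc k)" "bd (fill k z) = z"
  using someI_ex[of "\<lambda>c. c \<in> chains G R (Suc k) \<and> bd c = z"] cycle_is_boundary[OF assms]
  unfolding fill_def by blast+

text \<open>The usual filling of \<open>c - \<phi> c - \<sigma> (bd c)\<close>, degree by degree,
  but with a bound \<open>\<Psi>\<close> that is common to all chain maps selecting from
  \<open>\<Phi>\<close>. The number \<open>k\<close> counts the degrees already treated, so degree
  \<open>m\<close> is included when \<open>k = Suc m\<close>.\<close>

lemma homotopy:
  assumes \<Phi>: "fin_eq \<Phi>" and "k \<le> Suc m"
  shows "\<exists>\<Psi>. fin_eq \<Psi> \<and> (\<forall>\<phi>. sel \<Phi> \<phi> \<longrightarrow> chain_map m \<phi> \<longrightarrow> (\<exists>\<sigma>. sel \<Psi> \<sigma> \<and>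
    (\<forall>i<k. \<forall>c\<in>chains G R i. \<sigma> c \<in> chains G R (Suc i) \<and> bd (\<sigma> c) = c - \<phi> c - \<sigma> (bd c))))"
  using assms(2)
proof (induction k)
  case 0
  have "fin_eq (\<lambda>c. {0 :: 'f})"
    by (intro fin_eq_singleton) (simp add: additive.zero[OF additive_tr])
  moreover have "sel (\<lambda>c. {0}) (\<lambda>c. 0)" by (simp add: sel_def Modules.additive_def)
  ultimately show ?case by (intro exI[of _ "\<lambda>c. {0}"]) auto
next
  case (Suc k)
  then obtain \<Psi>0 where \<Psi>0: "fin_eq \<Psi>0" and ex0: "\<forall>\<phi>. sel \<Phi> \<phi> \<longrightarrow> chain_map m \<phi> \<longrightarrow> (\<exists>\<sigma>. sel \<Psi>0 \<sigma> \<and>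
    (\<forall>i<k. \<forall>c\<in>chains G R i. \<sigma> c \<in> chains G R (Suc i) \<and> bd (\<sigma> c) = c - \<phi> c - \<sigma> (bd c)))" by auto
  \<comment> \<open>Contains every value that the cycle to be filled can take as
    \<open>\<phi>\<close> and the partial homotopy range over selections from \<open>\<Phi>\<close>
    and \<open>\<Psi>0\<close>.\<close>
  define \<Theta> where "\<Theta> = (\<lambda>c. (\<lambda>(p, q). p - q) `
    (((\<lambda>(p, q). p - q) ` ({c} \<times> \<Phi> c)) \<times> \<Union>(\<Psi>0 ` {bd c})))"
  have \<Theta>: "fin_eq \<Theta>"
    unfolding \<Theta>_def by (intro fin_eq_diff fin_eq_comp fin_eq_singleton \<Psi>0 \<Phi>) (simp_all add: bd_tr)
  define S where "S x = fill k ` \<Theta> x" for x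
  have "finite (S x)" for x using \<Theta> by (simp add: S_def fin_eq_def)
  then obtain \<Psi> where \<Psi>: "fin_eq \<Psi>" and ex: "\<forall>\<phi>0 t. sel \<Psi>0 \<phi>0 \<longrightarrow>
      (\<forall>g\<in>carrier G. \<forall>x\<in>X k. t g x \<in> tr g ` S x) \<longrightarrow>
    (\<exists>\<phi>. sel \<Psi> \<phi> \<and> (\<forall>i. i \<noteq> k \<longrightarrow> (\<forall>c\<in>chains G R i. \<phi> c = \<phi>0 c)) \<and>
      (\<forall>g\<in>carrier G. \<forall>x\<in>X k. \<phi> (tr g x) = t g x))"
    using extend_degree[OF \<Psi>0, of k S] by blast
  have "\<exists>\<sigma>. sel \<Psi> \<sigma> \<and>
    (\<forall>i<Suc k. \<forall>c\<in>chains G R i. \<sigma> c \<in> chains G R (Suc i) \<and> bd (\<sigma> c) = c - \<phi> c - \<sigma> (bd c))"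
    if s: "sel \<Phi> \<phi>" and cm: "chain_map m \<phi>" for \<phi>
  proof -
    have k: "k \<le> m" using Suc.prems by simp
    obtain \<sigma>0 where s0: "sel \<Psi>0 \<sigma>0" and \<sigma>0: "\<And>i c. i < k \<Longrightarrow> c \<in> chains G R i \<Longrightarrow>
      \<sigma>0 c \<in> chains G R (Suc i) \<and> bd (\<sigma>0 c) = c - \<phi> c - \<sigma>0 (bd c)" using ex0 s cm by blast
    have ad0: "Modules.additive \<sigma>0" and ad: "Modules.additive \<phi>" using s s0 by (auto simp: sel_def)
    define z where "z y = y - \<phi> y - \<sigma>0 (bd y)" for y
    have az: "Modules.additive z"
      by (simp add: Modules.additive_def z_def additive.add[OF ad] additive.add[OF ad0]
          additive.add[OF additive_bd] algebra_simps)
    have z\<Theta>: "z y \<in> \<Theta> y" for y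
      using s s0 unfolding z_def \<Theta>_def sel_def by force
    \<comment> \<open>Degree 0 is separate because cycles are defined there by the augmentation,
      which agrees on \<open>y\<close> and \<open>\<phi> y\<close>.\<close>
    have zc: "z y \<in> cycles G R k" if y: "y \<in> chains G R k" for y
    proof (cases k)
      case 0
      then have "bd y = 0" using y bd_chains_0 by simp
      then have zy: "z y = y - \<phi> y" by (simp add: z_def additive.zero[OF ad0])
      have "\<phi> y \<in> chains G R 0" using chain_map_chains[OF cm k y] 0 by simp
      moreover have "aug ((y - \<phi> y) + \<phi> y) = aug (y - \<phi> y) + aug (\<phi> y)"
        using y 0 \<open>\<phi> y \<in> chains G R 0\<close> by (intro aug_add chains_diff) auto
      then have "aug (y - \<phi> y) = 0" using chain_map_aug[OF cm, of y] y 0 by simp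
      ultimately show ?thesis using y 0 by (simp add: zy cycles_def chains_diff)
    next
      case (Suc j)
      have b: "bd y \<in> chains G R j" using bd_chains_Suc[of y j] y Suc cycles_chains by blast
      have "bd (\<sigma>0 (bd y)) = bd y - \<phi> (bd y) - \<sigma>0 (bd (bd y))"
        using \<sigma>0[of j "bd y"] b Suc by simp
      then have "bd (\<sigma>0 (bd y)) = bd y - \<phi> (bd y)" by (simp add: bd_bd[OF y] additive.zero[OF ad0])
      then have "bd (z y) = 0"
        using chain_map_bd[OF cm k y] by (simp add: z_def additive.diff[OF additive_bd])
      moreover have "z y \<in> chains G R k"
        using \<sigma>0[of j "bd y"] b Suc y chain_map_chains[OF cm k y] by (auto simp: z_def intro!: chains_diff)
      ultimately show ?thesis using Suc by (simp add: cycles_def)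
    qed
    \<comment> \<open>\<open>fill\<close> need not be equivariant. The cycle at \<open>g x\<close>
      is therefore moved back to \<open>x\<close>, where it is one of finitely many, filled there,
      and the filling is moved forward again.\<close>
    define t where "t g x = tr g (fill k (tr (inv\<^bsub>G\<^esub> g) (z (tr g x))))" for g x
    have "\<forall>g\<in>carrier G. \<forall>x\<in>X k. t g x \<in> tr g ` S x"
    proof (intro ballI)
      fix g x assume g: "g \<in> carrier G"
      have "tr (inv\<^bsub>G\<^esub> g) (z (tr g x)) \<in> tr (inv\<^bsub>G\<^esub> g) ` tr g ` \<Theta> x"
        using z\<Theta>[of "tr g x"] fin_eq_tr[OF \<Theta> g] by blast
      then have "tr (inv\<^bsub>G\<^esub> g) (z (tr g x)) \<in> \<Theta> x" using g by (simp add: image_image)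
      then show "t g x \<in> tr g ` S x" by (simp add: t_def S_def)
    qed
    then have "\<exists>\<phi>. sel \<Psi> \<phi> \<and> (\<forall>i. i \<noteq> k \<longrightarrow> (\<forall>c\<in>chains G R i. \<phi> c = \<sigma>0 c)) \<and>
      (\<forall>g\<in>carrier G. \<forall>x\<in>X k. \<phi> (tr g x) = t g x)"
      using ex s0 by (elim allE[of _ \<sigma>0] impE allE[of _ t])
    then obtain \<sigma> where \<sigma>: "sel \<Psi> \<sigma>" "\<And>i c. i \<noteq> k \<Longrightarrow> c \<in> chains G R i \<Longrightarrow> \<sigma> c = \<sigma>0 c"
      "\<And>g x. g \<in> carrier G \<Longrightarrow> x \<in> X k \<Longrightarrow> \<sigma> (tr g x) = t g x"
      by blast
    have ads: "Modules.additive \<sigma>" using \<sigma>(1) by (simp add: sel_def)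
    have \<sigma>bd: "\<sigma> (bd c) = \<sigma>0 (bd c)" if "c \<in> chains G R i" "i \<le> k" for i c
    proof (cases i)
      case 0
      then show ?thesis using that by (simp add: bd_chains_0 additive.zero[OF ads] additive.zero[OF ad0])
    next
      case (Suc j)
      then show ?thesis using \<sigma>(2)[of j "bd c"] that bd_chains_Suc[of c j] cycles_chains by auto
    qed
    have "\<sigma> c \<in> chains G R (Suc i) \<and> bd (\<sigma> c) = c - \<phi> c - \<sigma> (bd c)" if "i < Suc k" "c \<in> chains G R i" for i c
    proof (cases "i = k")
      case False
      then show ?thesis using \<sigma>0[of i c] \<sigma>(2)[of i c] \<sigma>bd[of c i] that by simp
    next
      case True
      have "c \<in> chains G R k" using that True by simp
      then have "\<sigma> c \<in> chains G R (Suc k) \<and> bd (\<sigma> c) = z c"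
      proof (induction c rule: chains_induct)
        case zero
        then show ?case by (simp add: additive.zero[OF ads] additive.zero[OF additive_bd] additive.zero[OF az])
      next
        case (basis g x)
        have "tr (inv\<^bsub>G\<^esub> g) (z (tr g x)) \<in> cycles G R k"
          using basis by (intro cycles_tr zc chains_basis) auto
        from fill[OF this] show ?case
          using basis by (simp add: \<sigma>(3) t_def chains_tr bd_tr)
      next
        case (add u v)
        then show ?case
          by (simp add: additive.add[OF ads] additive.add[OF additive_bd] additive.add[OF az] chains_add)
      next
        case (minus u)
        then show ?case
          by (simp add: additive.minus[OF ads] additive.minus[OF additive_bd] additive.minus[OF az] chains_minus)
      qed
      then show ?thesis using True \<sigma>bd[OF that(2)] that(1) by (simp add: z_def)
    qed
    then show ?thesis using \<sigma>(1) by blast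
  qed
  then show ?case using \<Psi> by blast
qed


subsection \<open>Valuations and pushing\<close>

lemma h_finite: "finite (h c)"
  using control unfolding control_map_def by blast

lemma h_tr: "g \<in> carrier G \<Longrightarrow> h (tr g c) = \<rho> g ` h c"
  using control unfolding control_map_def G_map_on_def by blast

lemma h_supp: "h c = (\<Union>y\<in>supp G R c. h y)"
  using control unfolding control_map_def by blast

lemma h_basis: "x \<in> X k \<Longrightarrow> h x \<noteq> {}"
  using control unfolding control_map_def by blast

lemma h_0 [simp]: "h 0 = {}"
  by (subst h_supp) (simp add: supp_def additive.zero[OF additive_expand])

lemma h_add: "h (c + d) \<subseteq> h c \<union> h d"
proof -
  have "supp G R (c + d) \<subseteq> supp G R c \<union> supp G R d"
    by (fastforce simp: supp_def additive.add[OF additive_expand] lookup_add)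
  then show ?thesis unfolding h_supp[of "c + d"] h_supp[of c] h_supp[of d] by blast
qed

lemma h_minus: "h (- c) = h c"
proof -
  have "supp G R (- c) = supp G R c"
    by (simp add: supp_def additive.minus[OF additive_expand])
  then show ?thesis unfolding h_supp[of "- c"] h_supp[of c] by simp
qed

lemma h_nonempty: 
  assumes "c \<noteq> 0" shows "h c \<noteq> {}"
proof
  assume e: "h c = {}"
  have "c = 0"
  proof (induction c rule: supp_induct)
    case (supp y)
    then have "h y = {}" using e h_supp[of c] by blast
    moreover obtain g x where "g \<in> carrier G" "x \<in> XX" "y = tr g x" using supp by (rule supp_cases)
    ultimately show ?case using h_tr[of g x] h_basis by blast
  qed auto
  then show False using assms by simp
qed

text \<open>This is \<open>v\<^sub>\<gamma> c \<ge> s\<close> for the Busemann function \<open>\<beta>\<close> of \<open>\<gamma>\<close>; it holds at \<open>c = 0\<close>, where \<open>h c\<close> is empty.\<close>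

definition above :: "('m \<Rightarrow> real) \<Rightarrow> real \<Rightarrow> 'f \<Rightarrow> bool" where
  "above \<beta> s c \<longleftrightarrow> (\<forall>p\<in>h c. s \<le> \<beta> p)"

lemma above_0 [simp]: "above \<beta> s 0"
  by (simp add: above_def)

lemma above_add: "above \<beta> s c \<Longrightarrow> above \<beta> s d \<Longrightarrow> above \<beta> s (c + d)"
  using h_add[of c d] unfolding above_def by blast

lemma above_minus: "above \<beta> s (- c) \<longleftrightarrow> above \<beta> s c"
  by (simp add: above_def h_minus)

lemma above_mono: "above \<beta> s c \<Longrightarrow> s' \<le> s \<Longrightarrow> above \<beta> s' c"
  unfolding above_def by force

lemma above_supp: "above \<beta> s c \<Longrightarrow> y \<in> supp G R c \<Longrightarrow> above \<beta> s y"
  unfolding above_def h_supp[of c] by blast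

lemma above_tr: "g \<in> carrier G \<Longrightarrow> above \<beta> s (tr g c) \<longleftrightarrow> above (\<beta> \<circ> \<rho> g) s c"
  by (simp add: above_def h_tr)

lemma lipschitz1_comp: "lipschitz1 \<beta> \<Longrightarrow> g \<in> carrier G \<Longrightarrow> lipschitz1 (\<beta> \<circ> \<rho> g)"
  unfolding lipschitz1_def by (metis comp_apply rho_isometry)

lemma above_near:
  assumes "above \<beta> s c" "\<forall>p\<in>K. \<bar>\<beta> p - \<beta>' p - a\<bar> < \<epsilon>" "h c \<subseteq> K"
  shows "above \<beta>' (s - a - \<epsilon>) c"
  unfolding above_def
proof
  fix p assume p: "p \<in> h c"
  then have "s \<le> \<beta> p" "\<bar>\<beta> p - \<beta>' p - a\<bar> < \<epsilon>" using assms unfolding above_def by blast+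
  then show "s - a - \<epsilon> \<le> \<beta>' p" by linarith
qed

text \<open>This is \<open>v c \<ge> v x + d\<close>, without arithmetic on infinite valuations.\<close>

definition lift :: "('m \<Rightarrow> real) \<Rightarrow> real \<Rightarrow> 'f \<Rightarrow> 'f \<Rightarrow> bool" where
  "lift \<beta> d x c \<longleftrightarrow> (\<forall>s. above \<beta> s x \<longrightarrow> above \<beta> (s + d) c)"

lemma lift_trans: "lift \<beta> d x y \<Longrightarrow> lift \<beta> d' y z \<Longrightarrow> lift \<beta> (d + d') x z"
  unfolding lift_def by (metis add.assoc)

lemma lift_mono: "lift \<beta> d x y \<Longrightarrow> d' \<le> d \<Longrightarrow> lift \<beta> d' x y"
  unfolding lift_def using above_mono by (meson add_left_mono)

text \<open>This trades translates of a chain for translates of \<open>\<beta>\<close>, and is the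
  reason for working with families of functions closed under
  \<open>\<beta> \<mapsto> \<beta> \<circ> \<rho> g\<close>.\<close>

lemma lift_tr: "g \<in> carrier G \<Longrightarrow> lift \<beta> d (tr g x) (tr g c) \<longleftrightarrow> lift (\<beta> \<circ> \<rho> g) d x c"
  by (simp add: lift_def above_tr)

text \<open>A lower bound for \<open>c\<close> passes to its support, and lower bounds pass to sums;
  so translates of basis elements decide.\<close>

lemma lift_skeleton:
  assumes \<phi>: "Modules.additive \<phi>" and c: "c \<in> skeleton G R k"
    and b: "\<And>g i x. g \<in> carrier G \<Longrightarrow> i \<le> k \<Longrightarrow> x \<in> X i \<Longrightarrow> lift \<beta> d (tr g x) (\<phi> (tr g x))"
  shows "lift \<beta> d c (\<phi> c)"
  unfolding lift_def
proof (intro allI impI)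
  fix s assume s: "above \<beta> s c"
  have S: "(\<Union>i\<le>k. X i) \<subseteq> XX" by auto
  show "above \<beta> (s + d) (\<phi> c)"
  proof (induction c rule: supp_induct)
    case (supp y)
    obtain g x where y: "g \<in> carrier G" "x \<in> Poly_Mapping.keys (expand c)" "y = tr g x"
      using supp by (rule supp_cases)
    then obtain i where "i \<le> k" "x \<in> X i" using c unfolding skeleton_def span_iff[OF S] by blast
    then show ?case using b[of g i x] y above_supp[OF s supp] by (simp add: lift_def)
  qed (auto simp: additive.zero[OF \<phi>] additive.add[OF \<phi>] additive.minus[OF \<phi>] above_add above_minus)
qed

text \<open>A 1-Lipschitz function varies on a finite set by at most its diameter, for which
  \<open>D\<close> is a crude bound. Nonemptiness of \<open>h x\<close> supplies a point to compare
  with; otherwise the premise of \<open>lift\<close> would hold at every level.\<close>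

lemma lift_finite:
  assumes "finite K"
  shows "\<exists>D\<ge>0. \<forall>\<beta> x y. lipschitz1 \<beta> \<longrightarrow> x \<in> K \<longrightarrow> y \<in> K \<longrightarrow> h x \<noteq> {} \<longrightarrow> lift \<beta> (- D) x y"
proof -
  define H where "H = (\<Union>x\<in>K. h x)"
  have H: "finite H" using assms h_finite by (auto simp: H_def)
  define D where "D = (\<Sum>p\<in>H. \<Sum>q\<in>H. dist p q)"
  have D: "dist p q \<le> D" if "p \<in> H" "q \<in> H" for p q
  proof -
    have "dist p q \<le> (\<Sum>q\<in>H. dist p q)" using H that by (intro member_le_sum) auto
    also have "\<dots> \<le> D" unfolding D_def using H that by (intro member_le_sum) (auto intro: sum_nonneg)
    finally show ?thesis .
  qed
  have "D \<ge> 0" by (simp add: D_def sum_nonneg)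
  moreover have "lift \<beta> (- D) x y" if b: "lipschitz1 \<beta>" "x \<in> K" "y \<in> K" "h x \<noteq> {}" for \<beta> x y
    unfolding lift_def above_def
  proof (intro allI impI ballI)
    fix s q assume s: "\<forall>p\<in>h x. s \<le> \<beta> p" and q: "q \<in> h y"
    obtain p where p: "p \<in> h x" using b by blast
    have "\<beta> p \<le> \<beta> q + dist p q" using b by (simp add: lipschitz1_def)
    moreover have "dist p q \<le> D" using D p q b by (auto simp: H_def)
    ultimately show "s + - D \<le> \<beta> q" using s p by fastforce
  qed
  ultimately show ?thesis by blast
qed

text \<open>By \<open>lift_tr\<close> a comparison at \<open>g x\<close> becomes one at
  \<open>x\<close> over another 1-Lipschitz function. Finitely many basis elements with finitely
  many values remain, so the lag is uniform in the function and in the selection.\<close>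

lemma finitary_lag:
  assumes \<Phi>: "fin_eq \<Phi>" and fin: "finite (\<Union>i\<le>k. X i)"
  shows "\<exists>D\<ge>0. \<forall>\<beta> \<phi>. lipschitz1 \<beta> \<longrightarrow> sel \<Phi> \<phi> \<longrightarrow> (\<forall>c\<in>skeleton G R k. lift \<beta> (- D) c (\<phi> c))"
proof -
  define B where "B = (\<Union>i\<le>k. X i)"
  have "finite (B \<union> (\<Union>x\<in>B. \<Phi> x))" using fin \<Phi> by (simp add: B_def fin_eq_def)
  then obtain D where D: "D \<ge> 0" and L: "\<And>\<beta> x y. lipschitz1 \<beta> \<Longrightarrow> x \<in> B \<union> (\<Union>x\<in>B. \<Phi> x) \<Longrightarrow>
     y \<in> B \<union> (\<Union>x\<in>B. \<Phi> x) \<Longrightarrow> h x \<noteq> {} \<Longrightarrow> lift \<beta> (- D) x y"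
    using lift_finite by blast
  have "lift \<beta> (- D) c (\<phi> c)" if \<beta>: "lipschitz1 \<beta>" and s: "sel \<Phi> \<phi>" and c: "c \<in> skeleton G R k" for \<beta> \<phi> c
  proof (rule lift_skeleton[OF _ c])
    show "Modules.additive \<phi>" using s by (simp add: sel_def)
    fix g i x assume g: "g \<in> carrier G" and x: "i \<le> k" "x \<in> X i"
    have "\<phi> (tr g x) \<in> tr g ` \<Phi> x" using s fin_eq_tr[OF \<Phi> g, of x] by (auto simp: sel_def)
    then obtain y where y: "y \<in> \<Phi> x" "\<phi> (tr g x) = tr g y" by blast
    have "x \<in> B" using x by (auto simp: B_def)
    then have "lift (\<beta> \<circ> \<rho> g) (- D) x y"
      using y x h_basis by (intro L lipschitz1_comp \<beta> g) auto
    then show "lift \<beta> (- D) (tr g x) (\<phi> (tr g x))" using g by (simp add: y lift_tr)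
  qed
  then show ?thesis using D by blast
qed

definition pushes :: "nat \<Rightarrow> ('m \<Rightarrow> real) \<Rightarrow> real \<Rightarrow> ('f \<Rightarrow> 'f) \<Rightarrow> bool" where
  "pushes k \<beta> d \<phi> \<longleftrightarrow> (\<forall>c\<in>skeleton G R k. lift \<beta> d c (\<phi> c))"

lemma chain_map_skeleton:
  assumes "chain_map k \<phi>" "c \<in> skeleton G R k" shows "\<phi> c \<in> skeleton G R k"
  using assms(2)
proof (induction c rule: skeleton_induct)
  case (chain c i)
  then show ?case using chain_map_chains[OF assms(1)] chains_skeleton by blast
qed (simp_all add: additive.zero[OF chain_map_additive[OF assms(1)]] skeleton_add skeleton_minus
    additive.add[OF chain_map_additive[OF assms(1)]] additive.minus[OF chain_map_additive[OF assms(1)]])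

lemma pushes_funpow:
  assumes "chain_map k \<phi>" "pushes k \<beta> d \<phi>"
  shows "pushes k \<beta> (real N * d) (\<phi> ^^ N)"
proof (induction N)
  case 0
  then show ?case by (simp add: pushes_def lift_def)
next
  case (Suc N)
  have "lift \<beta> (real N * d + d) c (\<phi> ((\<phi> ^^ N) c))" if "c \<in> skeleton G R k" for c
    using Suc that assms(2) chain_map_skeleton[OF chain_map_funpow[OF assms(1)] that]
    by (intro lift_trans[of _ _ _ "(\<phi> ^^ N) c"]) (auto simp: pushes_def)
  then show ?case by (simp add: pushes_def algebra_simps)
qed

lemma pushes_conj:
  assumes "pushes k \<beta> d \<phi>" "g \<in> carrier G"
  shows "pushes k (\<beta> \<circ> \<rho> g) d (\<lambda>c. tr (inv\<^bsub>G\<^esub> g) (\<phi> (tr g c)))"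
proof -
  have "lift (\<beta> \<circ> \<rho> g) d c (tr (inv\<^bsub>G\<^esub> g) (\<phi> (tr g c)))" if "c \<in> skeleton G R k" for c
  proof -
    have "lift \<beta> d (tr g c) (tr g (tr (inv\<^bsub>G\<^esub> g) (\<phi> (tr g c))))"
      using assms skeleton_tr[OF assms(2) that] by (simp add: pushes_def)
    then show ?thesis using lift_tr[OF assms(2)] by blast
  qed
  then show ?thesis by (simp add: pushes_def)
qed

text \<open>The chain is \<open>\<Sum>j<N. \<sigma> (\<phi>\<^sup>j z)\<close>. Its lag \<open>D\<close> does not depend on \<open>N\<close>, because \<open>\<phi>\<close> does not lower cycles.\<close>

lemma uniform_lag:
  assumes \<Phi>: "fin_eq \<Phi>" and fin: "finite (\<Union>i\<le>k. X i)"
  shows "\<exists>D\<ge>0. \<exists>T. (\<forall>N z. finite (T N z)) \<and> (\<forall>\<beta> \<phi> i z N. lipschitz1 \<beta> \<longrightarrow> sel \<Phi> \<phi> \<longrightarrow> chain_map k \<phi> \<longrightarrow>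
    pushes k \<beta> 0 \<phi> \<longrightarrow> i \<le> k \<longrightarrow> z \<in> cycles G R i \<longrightarrow>
    (\<exists>c\<in>T N z. c \<in> chains G R (Suc i) \<and> bd c = z - (\<phi> ^^ N) z \<and> lift \<beta> (- D) z c))"
proof -
  obtain \<Psi> where \<Psi>: "fin_eq \<Psi>" and hom: "\<And>\<phi>. sel \<Phi> \<phi> \<Longrightarrow> chain_map k \<phi> \<Longrightarrow> \<exists>\<sigma>. sel \<Psi> \<sigma> \<and>
    (\<forall>i<Suc k. \<forall>c\<in>chains G R i. \<sigma> c \<in> chains G R (Suc i) \<and> bd (\<sigma> c) = c - \<phi> c - \<sigma> (bd c))"
    using homotopy[OF \<Phi>, of "Suc k" k] by auto
  obtain D where D: "D \<ge> 0" and lag: "\<And>\<beta> \<sigma> c. lipschitz1 \<beta> \<Longrightarrow> sel \<Psi> \<sigma> \<Longrightarrow> c \<in> skeleton G R k \<Longrightarrow> lift \<beta> (- D) c (\<sigma> c)"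
    using finitary_lag[OF \<Psi> fin] by blast
  \<comment> \<open>All possible partial sums, for all selections from \<open>\<Phi>\<close> and
    \<open>\<Psi>\<close> together. The finite set must not depend on \<open>\<phi>\<close>, because
    in \<open>acyclic_of_push\<close> the conjugate is chosen only after it.\<close>
  define T where "T = rec_nat (\<lambda>z. {0 :: 'f}) (\<lambda>N A z. (\<lambda>(p, q). p + q) ` (A z \<times> \<Union>(\<Psi> ` iter_sel \<Phi> N z)))"
  have T0: "T 0 z = {0}" for z by (simp add: T_def)
  have TSuc: "T (Suc N) z = (\<lambda>(p, q). p + q) ` (T N z \<times> \<Union>(\<Psi> ` iter_sel \<Phi> N z))" for N z by (simp add: T_def)
  have finT: "finite (T N z)" for N z
    using fin_eq_finite[OF \<Psi>] fin_eq_finite[OF fin_eq_iter[OF \<Phi>]] by (induction N) (simp_all add: T0 TSuc)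
  have "\<exists>c\<in>T N z. c \<in> chains G R (Suc i) \<and> bd c = z - (\<phi> ^^ N) z \<and> lift \<beta> (- D) z c"
    if \<beta>: "lipschitz1 \<beta>" and s: "sel \<Phi> \<phi>" and cm: "chain_map k \<phi>" and p: "pushes k \<beta> 0 \<phi>" and i: "i \<le> k"
      and z: "z \<in> cycles G R i" for \<beta> \<phi> i z N
  proof -
    obtain \<sigma> where ss: "sel \<Psi> \<sigma>" and \<sigma>: "\<And>i c. i < Suc k \<Longrightarrow> c \<in> chains G R i \<Longrightarrow>
        \<sigma> c \<in> chains G R (Suc i) \<and> bd (\<sigma> c) = c - \<phi> c - \<sigma> (bd c)"
      using hom[OF s cm] by blast
    have ads: "Modules.additive \<sigma>" using ss by (simp add: sel_def)
    show ?thesis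
    proof (induction N)
      case 0
      show ?case by (simp add: T0 additive.zero[OF additive_bd] lift_def)
    next
      case (Suc N)
      then obtain c where c: "c \<in> T N z" "c \<in> chains G R (Suc i)" "bd c = z - (\<phi> ^^ N) z" "lift \<beta> (- D) z c"
        by blast
      define y where "y = (\<phi> ^^ N) z"
      have y: "y \<in> cycles G R i" unfolding y_def by (rule chain_map_cycles[OF chain_map_funpow[OF cm] i z])
      then have yc: "y \<in> chains G R i" by (rule cycles_chains)
      have \<sigma>y: "\<sigma> y \<in> chains G R (Suc i)" "bd (\<sigma> y) = y - \<phi> y"
        using \<sigma>[of i y] i yc bd_cycle[OF y] by (auto simp: additive.zero[OF ads])
      have "lift \<beta> 0 z y"
        using pushes_funpow[OF cm p, of N] chains_skeleton[OF i cycles_chains[OF z]]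
        by (simp add: pushes_def y_def)
      then have "lift \<beta> (0 + - D) z (\<sigma> y)"
        by (rule lift_trans) (rule lag[OF \<beta> ss chains_skeleton[OF i yc]])
      \<comment> \<open>The lags of the summands do not add up: the valuation of a sum is at least
        the minimum of the valuations.\<close>
      then have "lift \<beta> (- D) z (c + \<sigma> y)" using c(4) above_add by (simp add: lift_def)
      moreover have "c + \<sigma> y \<in> T (Suc N) z"
        using c(1) ss sel_funpow[OF s, of N] by (force simp: TSuc sel_def y_def)
      moreover have "bd (c + \<sigma> y) = z - (\<phi> ^^ Suc N) z"
        using c(3) \<sigma>y(2) by (simp add: additive.add[OF additive_bd] y_def)
      ultimately show ?case using chains_add[OF c(2) \<sigma>y(1)] by blast
    qed
  qed
  then show ?thesis using D finT by (intro exI[of _ D] conjI exI[of _ T]) blast+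
qed

lemma pushes_mono: "pushes k \<beta> d \<phi> \<Longrightarrow> d' \<le> d \<Longrightarrow> pushes k \<beta> d' \<phi>"
  unfolding pushes_def using lift_mono by blast

text \<open>\<open>\<beta>\<close> is only a limit of the functions
  \<open>\<beta>0 \<circ> \<rho> g\<close>, towards which the conjugates push. All estimates are
  made for one such function close to \<open>\<beta>\<close> and carried back. The number
  \<open>N\<close> of pushes and the element \<open>g\<close> depend on the cycle, but the lag does
  not: it is the \<open>D\<close> of the homotopy and 1 for each of two passages between
  functions.\<close>

theorem acyclic_of_push:
  assumes fin: "finite (\<Union>i\<le>n. X i)" and lip: "lipschitz1 \<beta>0" "lipschitz1 \<beta>"
    and \<Phi>: "fin_eq \<Phi>" "sel \<Phi> \<phi>" and cm: "chain_map n \<phi>" and p: "pushes n \<beta>0 d \<phi>" "d > 0"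
    and near: "\<And>K \<epsilon>. finite K \<Longrightarrow> \<epsilon> > 0 \<Longrightarrow> \<exists>g\<in>carrier G. near \<epsilon> K \<beta> (\<beta>0 \<circ> \<rho> g)"
  shows "\<exists>D\<ge>0. \<forall>s. (\<forall>a. \<exists>c\<in>chains G R 0. aug c = a \<and> above \<beta> s c) \<and>
    (\<forall>i<n. \<forall>z\<in>cycles G R i. above \<beta> s z \<longrightarrow> (\<exists>c\<in>chains G R (Suc i). bd c = z \<and> above \<beta> (s - D) c))"
proof -
  define \<psi> where "\<psi> g c = tr (inv\<^bsub>G\<^esub> g) (\<phi> (tr g c))" for g c
  have \<psi>: "sel \<Phi> (\<psi> g)" "chain_map n (\<psi> g)" "pushes n (\<beta>0 \<circ> \<rho> g) d (\<psi> g)" "lipschitz1 (\<beta>0 \<circ> \<rho> g)"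
    if "g \<in> carrier G" for g
    unfolding \<psi>_def using that \<Phi> cm p lip
    by (auto intro: sel_conj chain_map_conj pushes_conj lipschitz1_comp)
  obtain D T where D: "D \<ge> 0" and T: "\<And>N z. finite (T N z)" and
    ul: "\<And>\<beta> \<phi> i z N. lipschitz1 \<beta> \<Longrightarrow> sel \<Phi> \<phi> \<Longrightarrow> chain_map n \<phi> \<Longrightarrow> pushes n \<beta> 0 \<phi> \<Longrightarrow> i \<le> n \<Longrightarrow>
      z \<in> cycles G R i \<Longrightarrow> \<exists>c\<in>T N z. c \<in> chains G R (Suc i) \<and> bd c = z - (\<phi> ^^ N) z \<and> lift \<beta> (- D) z c"
    using uniform_lag[OF \<Phi>(1) fin] by metis
  have deg0: "\<exists>c\<in>chains G R 0. aug c = a \<and> above \<beta> s c" for a s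
  proof -
    obtain c0 where c0: "c0 \<in> chains G R 0" "aug c0 = a" using aug_surj by blast
    define r where "r = Min (insert 0 (\<beta> ` h c0))"
    have r: "above \<beta> r c0" using h_finite[of c0] by (auto simp: above_def r_def)
    \<comment> \<open>The 2 pays for the passage from \<open>\<beta>\<close> to
      \<open>\<beta>0 \<circ> \<rho> g\<close> and back, each at precision 1.\<close>
    obtain N :: nat where N: "(s - r + 2) / d \<le> real N" using real_arch_simple by blast
    \<comment> \<open>Covers the values at \<open>c0\<close> of the \<open>N\<close>-th powers of
      all conjugates, so it can be fixed before \<open>g\<close> is chosen.\<close>
    define K where "K = h c0 \<union> (\<Union>c\<in>iter_sel \<Phi> N c0. h c)"
    have "finite K" using h_finite fin_eq_finite[OF fin_eq_iter[OF \<Phi>(1)]] by (auto simp: K_def)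
    then obtain g where g: "g \<in> carrier G" "near 1 K \<beta> (\<beta>0 \<circ> \<rho> g)" using near[of K 1] by auto
    then obtain a' where a': "\<forall>p\<in>K. \<bar>\<beta> p - (\<beta>0 \<circ> \<rho> g) p - a'\<bar> < 1" by (auto simp: near_def)
    have a'': "\<forall>p\<in>K. \<bar>(\<beta>0 \<circ> \<rho> g) p - \<beta> p - (- a')\<bar> < 1"
    proof
      fix p assume "p \<in> K"
      from a'[rule_format, OF this] show "\<bar>(\<beta>0 \<circ> \<rho> g) p - \<beta> p - (- a')\<bar> < 1" by linarith
    qed
    define c where "c = (\<psi> g ^^ N) c0"
    have "above (\<beta>0 \<circ> \<rho> g) (r - a' - 1) c0" by (rule above_near[OF r a']) (simp add: K_def)
    then have "above (\<beta>0 \<circ> \<rho> g) (r - a' - 1 + real N * d) c"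
      using pushes_funpow[OF \<psi>(2,3)[OF g(1)], of N] chains_skeleton[OF _ c0(1), of n]
      by (simp add: pushes_def lift_def c_def)
    moreover have "h c \<subseteq> K"
      using sel_funpow[OF \<psi>(1)[OF g(1)], of N] by (auto simp: K_def c_def sel_def)
    ultimately have "above \<beta> (r - a' - 1 + real N * d - (- a') - 1) c"
      using a'' by (intro above_near)
    moreover have "s \<le> r - a' - 1 + real N * d - (- a') - 1"
      using N p(2) by (simp add: pos_divide_le_eq)
    ultimately have "above \<beta> s c" by (rule above_mono)
    moreover have "c \<in> chains G R 0" "aug c = a"
      using chain_map_chains[OF chain_map_funpow[OF \<psi>(2)[OF g(1)]]] 
        chain_map_aug[OF chain_map_funpow[OF \<psi>(2)[OF g(1)]]] c0 by (auto simp: c_def)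
    ultimately show ?thesis by blast
  qed
  have "\<exists>c\<in>chains G R (Suc i). bd c = z \<and> above \<beta> (s - (D + 2)) c"
    if i: "i < n" and z: "z \<in> cycles G R i" and s: "above \<beta> s z" for i z s
  proof (cases "z = 0")
    case True
    then show ?thesis by (intro bexI[of _ 0]) (simp_all add: additive.zero[OF additive_bd])
  next
    case False
    obtain c0 where c0: "c0 \<in> chains G R (Suc i)" "bd c0 = z" using cycle_is_boundary[OF z] by blast
    obtain E where E: "E \<ge> 0" "\<And>\<beta>. lipschitz1 \<beta> \<Longrightarrow> lift \<beta> (- E) z c0"
      using lift_finite[of "{z, c0}"] h_nonempty[OF False] by auto
    \<comment> \<open>\<open>c0\<close> is an arbitrary filling and may be lower than
      \<open>z\<close> by \<open>E\<close>; \<open>N\<close> pushes make up for this loss.\<close>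
    obtain N :: nat where N: "E / d \<le> real N" using real_arch_simple by blast
    define K where "K = h z \<union> (\<Union>c\<in>T N z. h c) \<union> (\<Union>c\<in>iter_sel \<Phi> N c0. h c)"
    have "finite K" using h_finite T fin_eq_finite[OF fin_eq_iter[OF \<Phi>(1)]] by (auto simp: K_def)
    then obtain g where g: "g \<in> carrier G" "near 1 K \<beta> (\<beta>0 \<circ> \<rho> g)" using near[of K 1] by auto
    then obtain a' where a': "\<forall>p\<in>K. \<bar>\<beta> p - (\<beta>0 \<circ> \<rho> g) p - a'\<bar> < 1" by (auto simp: near_def)
    have a'': "\<forall>p\<in>K. \<bar>(\<beta>0 \<circ> \<rho> g) p - \<beta> p - (- a')\<bar> < 1"
    proof
      fix p assume "p \<in> K"
      from a'[rule_format, OF this] show "\<bar>(\<beta>0 \<circ> \<rho> g) p - \<beta> p - (- a')\<bar> < 1" by linarith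
    qed
    have lz: "above (\<beta>0 \<circ> \<rho> g) (s - a' - 1) z" by (rule above_near[OF s a']) (auto simp: K_def)
    have cmN: "chain_map n (\<psi> g ^^ N)" by (rule chain_map_funpow[OF \<psi>(2)[OF g(1)]])
    obtain c1 where c1: "c1 \<in> T N z" "c1 \<in> chains G R (Suc i)" "bd c1 = z - (\<psi> g ^^ N) z"
        "lift (\<beta>0 \<circ> \<rho> g) (- D) z c1"
      using ul[OF \<psi>(4,1,2)[OF g(1)] pushes_mono[OF \<psi>(3)[OF g(1)]], of i z N] i z p(2) by auto
    define c2 where "c2 = (\<psi> g ^^ N) c0"
    have c2: "c2 \<in> chains G R (Suc i)" "bd c2 = (\<psi> g ^^ N) z"
      using chain_map_chains[OF cmN _ c0(1)] chain_map_bd[OF cmN _ c0(1)] i c0(2) by (auto simp: c2_def)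
    have "lift (\<beta>0 \<circ> \<rho> g) (- E + real N * d) z c2"
      using pushes_funpow[OF \<psi>(2,3)[OF g(1)], of N] chains_skeleton[OF _ c0(1), of n] i E(2)[OF \<psi>(4)[OF g(1)]]
      by (intro lift_trans[of _ _ _ c0]) (auto simp: pushes_def c2_def)
    then have l2: "lift (\<beta>0 \<circ> \<rho> g) (- D) z c2"
      by (rule lift_mono) (use N p(2) D in \<open>simp add: pos_divide_le_eq\<close>)
    \<comment> \<open>The unknown constant \<open>a'\<close> enters the two passages with opposite
      signs and cancels.\<close>
    have up: "above \<beta> (s - (D + 2)) c" if "lift (\<beta>0 \<circ> \<rho> g) (- D) z c" "h c \<subseteq> K" for c
    proof -
      have "above (\<beta>0 \<circ> \<rho> g) (s - a' - 1 + - D) c" using that lz by (simp add: lift_def)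
      then have "above \<beta> (s - a' - 1 + - D - (- a') - 1) c" by (rule above_near[OF _ a'' that(2)])
      then show ?thesis by (rule above_mono) simp
    qed
    have "h c1 \<subseteq> K" using c1 by (auto simp: K_def)
    moreover have "h c2 \<subseteq> K" using sel_funpow[OF \<psi>(1)[OF g(1)], of N] by (auto simp: K_def c2_def sel_def)
    ultimately have "above \<beta> (s - (D + 2)) (c1 + c2)" using up c1 l2 by (intro above_add) auto
    then show ?thesis using c1 c2 by (intro bexI[of _ "c1 + c2"]) (auto simp: additive.add[OF additive_bd] chains_add)
  qed
  then show ?thesis using deg0 D by (intro exI[of _ "D + 2"]) auto
qed


subsection \<open>From controlled acyclicity to pushing maps\<close>

text \<open>\<open>lift\<close> compares two chains over the same function, so the additive constant
  in \<open>near\<close> cancels; each of the two passages costs \<open>\<epsilon>\<close>.\<close>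

lemma lift_near:
  assumes near: "near \<epsilon> K \<beta> \<beta>'" and l: "lift \<beta> d x c" and K: "h x \<subseteq> K" "h c \<subseteq> K"
  shows "lift \<beta>' (d - 2 * \<epsilon>) x c"
  unfolding lift_def
proof (intro allI impI)
  fix s assume s: "above \<beta>' s x"
  obtain a where a: "\<forall>p\<in>K. \<bar>\<beta> p - \<beta>' p - a\<bar> < \<epsilon>" using near by (auto simp: near_def)
  have a': "\<forall>p\<in>K. \<bar>\<beta>' p - \<beta> p - (- a)\<bar> < \<epsilon>"
  proof
    fix p assume "p \<in> K"
    from a[rule_format, OF this] show "\<bar>\<beta>' p - \<beta> p - (- a)\<bar> < \<epsilon>" by linarith
  qed
  have "above \<beta> (s - (- a) - \<epsilon>) x" by (rule above_near[OF s a' K(1)])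
  then have "above \<beta> (s - (- a) - \<epsilon> + d) c" using l by (simp add: lift_def)
  then have "above \<beta>' (s - (- a) - \<epsilon> + d - a - \<epsilon>) c" by (rule above_near[OF _ a K(2)])
  then show "above \<beta>' (s + (d - 2 * \<epsilon>)) c" by (rule above_mono) simp
qed

text \<open>The filling chosen for \<open>f\<close> remains good for functions near \<open>f\<close>
  on the finite set \<open>K f\<close>: by \<open>lift_near\<close> with precision 1/4 a comparison
  loses 1/2. This explains the margins between \<open>d\<close> and \<open>d + 1\<close> and between
  2 and 1. The constant \<open>d\<close> is common to all of \<open>B\<close>, which is where a
  uniform lag will be required.\<close>

lemma finitely_many_fillings:
  assumes cpt: "\<And>K \<epsilon>. (\<And>f. finite (K f)) \<Longrightarrow> \<epsilon> > 0 \<Longrightarrow> \<exists>F\<subseteq>B. finite F \<and> (\<forall>\<beta>\<in>B. \<exists>f\<in>F. near \<epsilon> (K f) f \<beta>)"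
    and ex: "\<And>\<beta>. \<beta> \<in> B \<Longrightarrow> lift \<beta> d x b \<Longrightarrow> \<exists>c. V c \<and> lift \<beta> 2 x c"
  shows "\<exists>S. finite S \<and> (\<forall>c\<in>S. V c) \<and> (\<forall>\<beta>\<in>B. lift \<beta> (d + 1) x b \<longrightarrow> (\<exists>c\<in>S. lift \<beta> 1 x c))"
proof -
  define cc where "cc f = (SOME c. V c \<and> lift f 2 x c)" for f
  define K where "K f = h x \<union> h b \<union> h (cc f)" for f
  have "finite (K f)" for f using h_finite by (simp add: K_def)
  then obtain F where F: "F \<subseteq> B" "finite F" "\<forall>\<beta>\<in>B. \<exists>f\<in>F. near (1/4) (K f) f \<beta>"
    using cpt[of K "1/4"] by auto
  \<comment> \<open>\<open>cc f\<close> is an arbitrary value when \<open>f\<close> has no suitable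
    filling, hence the filter by \<open>V\<close>.\<close>
  define S where "S = {c \<in> cc ` F. V c}"
  have "\<exists>c\<in>S. lift \<beta> 1 x c" if \<beta>: "\<beta> \<in> B" "lift \<beta> (d + 1) x b" for \<beta>
  proof -
    obtain f where f: "f \<in> F" "near (1/4) (K f) f \<beta>" using F \<beta> by blast
    have "lift f (d + 1 - 2 * (1/4)) x b"
      by (rule lift_near[OF near_commute[OF f(2)] \<beta>(2)]) (auto simp: K_def)
    then have "lift f d x b" by (rule lift_mono) simp
    then have cf: "V (cc f) \<and> lift f 2 x (cc f)"
      using ex[of f] f(1) F(1) someI_ex[of "\<lambda>c. V c \<and> lift f 2 x c"] unfolding cc_def by blast
    have "lift \<beta> (2 - 2 * (1/4)) x (cc f)"
      by (rule lift_near[OF f(2)]) (use cf in \<open>auto simp: K_def\<close>)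
    then have "lift \<beta> 1 x (cc f)" by (rule lift_mono) simp
    then show ?thesis using cf f by (auto simp: S_def)
  qed
  moreover have "finite S" "\<forall>c\<in>S. V c" using F(2) by (auto simp: S_def)
  ultimately show ?thesis by blast
qed

lemma aug_0 [simp]: "aug 0 = 0"
  using aug_add[of 0 0] by simp

lemma aug_minus: "c \<in> chains G R 0 \<Longrightarrow> aug (- c) = - aug c"
  using aug_add[of c "- c"] chains_minus[of c 0] by (simp add: eq_neg_iff_add_eq_0 add.commute)

lemma lift_of_above: 
  assumes "p \<in> h x" "above \<beta> (\<beta> p + d) c" shows "lift \<beta> d x c"
  unfolding lift_def
proof (intro allI impI)
  fix s assume "above \<beta> s x"
  then have "s \<le> \<beta> p" using assms(1) by (auto simp: above_def)
  then show "above \<beta> (s + d) c" by (intro above_mono[OF assms(2)]) simp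
qed

lemma ex_lowest:
  assumes "h x \<noteq> {}" obtains p where "p \<in> h x" "above \<beta> (\<beta> p) x"
proof -
  have "Min (\<beta> ` h x) \<in> \<beta> ` h x" using assms h_finite by (intro Min_in) auto
  then obtain p where p: "p \<in> h x" "\<beta> p = Min (\<beta> ` h x)" by auto
  have "above \<beta> (\<beta> p) x" unfolding p(2) above_def using h_finite by auto
  then show ?thesis using that p by blast
qed

text \<open>Controlled acyclicity in degrees -1 to \<open>n - 1\<close>, for an arbitrary function
  in place of the Busemann function of a ray.\<close>

definition acyclic_over :: "nat \<Rightarrow> ('m \<Rightarrow> real) \<Rightarrow> bool" where
  "acyclic_over n \<beta> \<longleftrightarrow> (\<exists>l :: real \<Rightarrow> real. filterlim (\<lambda>s. s - l s) at_top at_top \<and>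
    (\<forall>s. (\<forall>a. \<exists>c\<in>chains G R 0. aug c = a \<and> above \<beta> (s - l s) c) \<and>
      (\<forall>i<n. \<forall>z\<in>cycles G R i. above \<beta> s z \<longrightarrow>
        (\<exists>c\<in>chains G R (Suc i). bd c = z \<and> above \<beta> (s - l s) c))))"

text \<open>Elements of the module have infinite valuation, so the level in controlled acyclicity is
  free, and every function admits arbitrarily high chains over \<open>aug x\<close>. Compactness
  therefore applies at once.\<close>

lemma push_degree_0:
  assumes lip: "\<And>\<beta>. \<beta> \<in> B \<Longrightarrow> lipschitz1 \<beta>"
    and inv: "\<And>\<beta> g. \<beta> \<in> B \<Longrightarrow> g \<in> carrier G \<Longrightarrow> \<beta> \<circ> \<rho> g \<in> B"
    and cpt: "\<And>K \<epsilon>. (\<And>f. finite (K f)) \<Longrightarrow> \<epsilon> > 0 \<Longrightarrow> \<exists>F\<subseteq>B. finite F \<and> (\<forall>\<beta>\<in>B. \<exists>f\<in>F. near \<epsilon> (K f) f \<beta>)"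
    and ca: "\<And>\<beta>. \<beta> \<in> B \<Longrightarrow> acyclic_over n \<beta>"
  shows "\<exists>\<Phi>. fin_eq \<Phi> \<and> (\<forall>\<beta>\<in>B. \<exists>\<phi>. sel \<Phi> \<phi> \<and> chain_map 0 \<phi> \<and> pushes 0 \<beta> 1 \<phi>)"
proof -
  \<comment> \<open>Applied with \<open>b = 0\<close>, for which the premise on \<open>b\<close>
    holds because \<open>h 0\<close> is empty; the condition on a candidate is its
    augmentation.\<close>
  have "\<exists>S. finite S \<and> (\<forall>c\<in>S. c \<in> chains G R 0 \<and> aug c = aug x) \<and>
      (\<forall>\<beta>\<in>B. lift \<beta> (0 + 1) x 0 \<longrightarrow> (\<exists>c\<in>S. lift \<beta> 1 x c))" if x: "x \<in> X 0" for x
  proof (rule finitely_many_fillings[OF cpt])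
    fix \<beta> assume \<beta>: "\<beta> \<in> B"
    obtain l where l: "filterlim (\<lambda>s. s - l s) at_top at_top"
      "\<forall>s a. \<exists>c\<in>chains G R 0. aug c = a \<and> above \<beta> (s - l s) c"
      using ca[OF \<beta>] unfolding acyclic_over_def by blast
    obtain p where p: "p \<in> h x" using h_basis[OF x] by blast
    have "\<forall>\<^sub>F s in at_top. \<beta> p + 2 \<le> s - l s" using l(1) by (simp add: filterlim_at_top)
    then obtain s where s: "\<beta> p + 2 \<le> s - l s" by (auto simp: eventually_at_top_linorder)
    obtain c where c: "c \<in> chains G R 0" "aug c = aug x" "above \<beta> (s - l s) c" using l(2) by blast
    have "lift \<beta> 2 x c" by (rule lift_of_above[OF p above_mono[OF c(3) s]])
    then show "\<exists>c. (c \<in> chains G R 0 \<and> aug c = aug x) \<and> lift \<beta> 2 x c" using c by blast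
  qed auto
  then have ex: "\<exists>S. finite S \<and> (\<forall>c\<in>S. c \<in> chains G R 0 \<and> aug c = aug x) \<and>
      (\<forall>\<beta>\<in>B. \<exists>c\<in>S. lift \<beta> 1 x c)" if "x \<in> X 0" for x using that by (simp add: lift_def)
  define S where "S x = (SOME S. finite S \<and> (\<forall>c\<in>S. c \<in> chains G R 0 \<and> aug c = aug x) \<and>
      (\<forall>\<beta>\<in>B. \<exists>c\<in>S. lift \<beta> 1 x c))" for x
  note S_all = someI_ex[OF ex, folded S_def]
  have S: "finite (S x)" "c \<in> S x \<Longrightarrow> c \<in> chains G R 0 \<and> aug c = aug x"
    "\<beta> \<in> B \<Longrightarrow> \<exists>c\<in>S x. lift \<beta> 1 x c" if "x \<in> X 0" for x c \<beta>
    using S_all[OF that] by blast+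
  have z: "fin_eq (\<lambda>c. {0 :: 'f})"
    by (intro fin_eq_singleton) (simp add: additive.zero[OF additive_tr])
  have z': "sel (\<lambda>c. {0}) (\<lambda>c. 0)" by (simp add: sel_def Modules.additive_def)
  obtain \<Psi> where \<Psi>: "fin_eq \<Psi>" and ext: "\<forall>\<phi>0 t. sel (\<lambda>c. {0}) \<phi>0 \<longrightarrow> (\<forall>g\<in>carrier G. \<forall>x\<in>X 0. t g x \<in> tr g ` S x) \<longrightarrow>
    (\<exists>\<phi>. sel \<Psi> \<phi> \<and> (\<forall>i. i \<noteq> 0 \<longrightarrow> (\<forall>c\<in>chains G R i. \<phi> c = \<phi>0 c)) \<and>
      (\<forall>g\<in>carrier G. \<forall>x\<in>X 0. \<phi> (tr g x) = t g x))"
    using extend_degree[OF z, of 0 S] S(1) by blast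
  have "\<exists>\<phi>. sel \<Psi> \<phi> \<and> chain_map 0 \<phi> \<and> pushes 0 \<beta> 1 \<phi>" if \<beta>: "\<beta> \<in> B" for \<beta>
  proof -
    \<comment> \<open>The value at \<open>g x\<close> is chosen at \<open>x\<close> for
      \<open>\<beta> \<circ> \<rho> g\<close> and then moved by \<open>g\<close>. Choices for
      different \<open>g\<close> are unrelated, so the map is finitary but in general not
      equivariant.\<close>
    define u where "u g x = (SOME c. c \<in> S x \<and> lift (\<beta> \<circ> \<rho> g) 1 x c)" for g x
    have u: "u g x \<in> S x" "lift (\<beta> \<circ> \<rho> g) 1 x (u g x)" if "g \<in> carrier G" "x \<in> X 0" for g x
      using someI_ex[of "\<lambda>c. c \<in> S x \<and> lift (\<beta> \<circ> \<rho> g) 1 x c"] S(3)[OF that(2) inv[OF \<beta> that(1)]]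
      unfolding u_def by blast+
    have "\<forall>g\<in>carrier G. \<forall>x\<in>X 0. tr g (u g x) \<in> tr g ` S x" using u by blast
    then have "\<exists>\<phi>. sel \<Psi> \<phi> \<and> (\<forall>i. i \<noteq> 0 \<longrightarrow> (\<forall>c\<in>chains G R i. \<phi> c = 0)) \<and>
      (\<forall>g\<in>carrier G. \<forall>x\<in>X 0. \<phi> (tr g x) = tr g (u g x))"
      using ext z' by (elim allE[of _ "\<lambda>c. 0"] impE allE[of _ "\<lambda>g x. tr g (u g x)"])
    then obtain \<phi> where \<phi>: "sel \<Psi> \<phi>" "\<And>g x. g \<in> carrier G \<Longrightarrow> x \<in> X 0 \<Longrightarrow> \<phi> (tr g x) = tr g (u g x)"
      by blast
    have ad: "Modules.additive \<phi>" using \<phi>(1) by (simp add: sel_def)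
    have *: "c \<in> chains G R 0 \<and> \<phi> c \<in> chains G R 0 \<and> aug (\<phi> c) = aug c" if "c \<in> chains G R 0" for c
      using that
    proof (induction c rule: chains_induct)
      case (basis g x)
      have "u g x \<in> chains G R 0" "aug (u g x) = aug x" using S(2) u(1) basis by auto
      moreover have "x \<in> chains G R 0" using chains_basis[OF one_closed basis(2)] by simp
      ultimately show ?case using basis by (simp add: \<phi>(2) chains_tr aug_tr)
    qed (auto simp: additive.zero[OF ad] additive.add[OF ad] additive.minus[OF ad] chains_add chains_minus
        aug_add aug_minus)
    have "chain_map 0 \<phi>"
      using * ad by (auto simp: chain_map_def bd_chains_0 additive.zero[OF ad])
    moreover have "pushes 0 \<beta> 1 \<phi>"
      unfolding pushes_def
    proof (rule ballI, rule lift_skeleton[OF ad], assumption)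
      fix g i x assume "g \<in> carrier G" "i \<le> 0" "x \<in> X i"
      then show "lift \<beta> 1 (tr g x) (\<phi> (tr g x))" using u(2) by (simp add: \<phi>(2) lift_tr)
    qed
    ultimately show ?thesis using \<phi>(1) by blast
  qed
  then show ?thesis using \<Psi> by blast
qed

text \<open>The cycle is first pushed up so far that the lag function of \<open>\<beta>\<close>, over which there is no control,
  no longer matters.\<close>

lemma uniform_filling:
  assumes fin: "finite (\<Union>i\<le>k. X i)" and \<Phi>: "fin_eq \<Phi>" and "k < n"
  shows "\<exists>D\<ge>0. \<forall>\<beta> \<phi> s z. lipschitz1 \<beta> \<longrightarrow> acyclic_over n \<beta> \<longrightarrow> sel \<Phi> \<phi> \<longrightarrow> chain_map k \<phi> \<longrightarrow>
    pushes k \<beta> 1 \<phi> \<longrightarrow> z \<in> cycles G R k \<longrightarrow> above \<beta> s z \<longrightarrow>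
    (\<exists>c\<in>chains G R (Suc k). bd c = z \<and> above \<beta> (s - D) c)"
proof -
  obtain D T where D: "D \<ge> 0" and
    ul: "\<And>\<beta> \<phi> i z N. lipschitz1 \<beta> \<Longrightarrow> sel \<Phi> \<phi> \<Longrightarrow> chain_map k \<phi> \<Longrightarrow> pushes k \<beta> 0 \<phi> \<Longrightarrow> i \<le> k \<Longrightarrow>
      z \<in> cycles G R i \<Longrightarrow> \<exists>c\<in>T N z. c \<in> chains G R (Suc i) \<and> bd c = z - (\<phi> ^^ N) z \<and> lift \<beta> (- D) z c"
    using uniform_lag[OF \<Phi> fin] by metis
  have "\<exists>c\<in>chains G R (Suc k). bd c = z \<and> above \<beta> (s - D) c"
    if \<beta>: "lipschitz1 \<beta>" "acyclic_over n \<beta>" and \<phi>: "sel \<Phi> \<phi>" "chain_map k \<phi>" "pushes k \<beta> 1 \<phi>"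
      and z: "z \<in> cycles G R k" "above \<beta> s z" for \<beta> \<phi> s z
  proof -
    obtain l where l: "filterlim (\<lambda>s. s - l s) at_top at_top"
      "\<And>s i z. i < n \<Longrightarrow> z \<in> cycles G R i \<Longrightarrow> above \<beta> s z \<Longrightarrow>
        \<exists>c\<in>chains G R (Suc i). bd c = z \<and> above \<beta> (s - l s) c"
      using \<beta>(2) unfolding acyclic_over_def by blast
    have "\<forall>\<^sub>F s' in at_top. s - D \<le> s' - l s'" using l(1) by (simp add: filterlim_at_top)
    then obtain s1 where s1: "\<And>s'. s' \<ge> s1 \<Longrightarrow> s - D \<le> s' - l s'" by (auto simp: eventually_at_top_linorder)
    \<comment> \<open>\<open>N\<close> depends on the lag function of \<open>\<beta>\<close> and on
      \<open>s\<close>; the bound for the homotopy part \<open>c1\<close> is the same for every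
      \<open>N\<close>.\<close>
    obtain N :: nat where N: "s1 - s \<le> real N" using real_arch_simple by blast
    have y: "(\<phi> ^^ N) z \<in> cycles G R k" by (rule chain_map_cycles[OF chain_map_funpow[OF \<phi>(2)] order_refl z(1)])
    have "above \<beta> (s + real N) ((\<phi> ^^ N) z)"
      using pushes_funpow[OF \<phi>(2,3), of N] z chains_skeleton[OF order_refl cycles_chains[OF z(1)]]
      by (simp add: pushes_def lift_def)
    then obtain c2 where c2: "c2 \<in> chains G R (Suc k)" "bd c2 = (\<phi> ^^ N) z"
        "above \<beta> (s + real N - l (s + real N)) c2"
      using l(2)[OF \<open>k < n\<close> y] by blast
    then have "above \<beta> (s - D) c2" using s1[of "s + real N"] N by (intro above_mono[OF c2(3)]) simp
    moreover obtain c1 where c1: "c1 \<in> chains G R (Suc k)" "bd c1 = z - (\<phi> ^^ N) z" "lift \<beta> (- D) z c1"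
      using ul[OF \<beta>(1) \<phi>(1,2) pushes_mono[OF \<phi>(3)] order_refl z(1), of N] by auto
    moreover have "above \<beta> (s - D) c1" using c1(3) z(2) by (simp add: lift_def)
    ultimately show ?thesis using c2
      by (intro bexI[of _ "c1 + c2"]) (auto simp: additive.add[OF additive_bd] chains_add above_add)
  qed
  then show ?thesis using D by blast
qed

text \<open>The value on \<open>g x\<close> has to fill the image of its boundary.
  \<open>uniform_filling\<close> supplies one lag for all of \<open>B\<close>, as
  \<open>finitely_many_fillings\<close> demands, and a power of the given map pushes far enough to
  pay for it.\<close>

lemma push_degree_Suc:
  assumes lip: "\<And>\<beta>. \<beta> \<in> B \<Longrightarrow> lipschitz1 \<beta>"
    and inv: "\<And>\<beta> g. \<beta> \<in> B \<Longrightarrow> g \<in> carrier G \<Longrightarrow> \<beta> \<circ> \<rho> g \<in> B"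
    and cpt: "\<And>K \<epsilon>. (\<And>f. finite (K f)) \<Longrightarrow> \<epsilon> > 0 \<Longrightarrow> \<exists>F\<subseteq>B. finite F \<and> (\<forall>\<beta>\<in>B. \<exists>f\<in>F. near \<epsilon> (K f) f \<beta>)"
    and ca: "\<And>\<beta>. \<beta> \<in> B \<Longrightarrow> acyclic_over n \<beta>"
    and fin: "finite (\<Union>i\<le>Suc k. X i)" and "k < n"
    and IH: "fin_eq \<Phi>0" "\<And>\<beta>. \<beta> \<in> B \<Longrightarrow> \<exists>\<phi>. sel \<Phi>0 \<phi> \<and> chain_map k \<phi> \<and> pushes k \<beta> 1 \<phi>"
  shows "\<exists>\<Phi>. fin_eq \<Phi> \<and> (\<forall>\<beta>\<in>B. \<exists>\<phi>. sel \<Phi> \<phi> \<and> chain_map (Suc k) \<phi> \<and> pushes (Suc k) \<beta> 1 \<phi>)"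
proof -
  have fin': "finite (\<Union>i\<le>k. X i)" using fin by (rule rev_finite_subset) (intro UN_mono, auto)
  obtain D where D: "D \<ge> 0" and fillD: "\<And>\<beta> s z. \<beta> \<in> B \<Longrightarrow> z \<in> cycles G R k \<Longrightarrow> above \<beta> s z \<Longrightarrow>
      \<exists>c\<in>chains G R (Suc k). bd c = z \<and> above \<beta> (s - D) c"
    using uniform_filling[OF fin' IH(1) \<open>k < n\<close>] lip ca IH(2) by metis
  have fbd: "fin_eq (\<lambda>c. {bd c})" by (rule fin_eq_singleton) (rule bd_tr)
  have sbd: "sel (\<lambda>c. {bd c}) bd" by (simp add: sel_def additive_bd)
  obtain C where C: "C \<ge> 0" "\<And>\<beta> c. lipschitz1 \<beta> \<Longrightarrow> c \<in> skeleton G R (Suc k) \<Longrightarrow> lift \<beta> (- C) c (bd c)"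
    using finitary_lag[OF fbd fin] sbd by metis
  \<comment> \<open>\<open>C\<close> is lost by taking boundaries and \<open>D\<close> by filling. A
    filling must push by 2 before compactness, and the premise of
    \<open>finitely_many_fillings\<close> has a margin of 1.\<close>
  obtain N :: nat where N: "C + D + 3 \<le> real N" using real_arch_simple by blast
  define \<Phi>1 where "\<Phi>1 = iter_sel \<Phi>0 N"
  have \<Phi>1: "fin_eq \<Phi>1" unfolding \<Phi>1_def by (rule fin_eq_iter[OF IH(1)])
  have "\<exists>S. finite S \<and> (\<forall>c\<in>S. c \<in> chains G R (Suc k) \<and> bd c = b) \<and>
      (\<forall>\<beta>\<in>B. lift \<beta> (D + 2 + 1) x b \<longrightarrow> (\<exists>c\<in>S. lift \<beta> 1 x c))"
    if x: "x \<in> X (Suc k)" and b: "b \<in> cycles G R k" for x b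
  proof (rule finitely_many_fillings[OF cpt])
    fix \<beta> assume \<beta>: "\<beta> \<in> B" "lift \<beta> (D + 2) x b"
    obtain p where p: "p \<in> h x" "above \<beta> (\<beta> p) x" using ex_lowest[OF h_basis[OF x], of \<beta>] by blast
    have "above \<beta> (\<beta> p + (D + 2)) b" using \<beta>(2) p(2) by (simp add: lift_def)
    then obtain c where c: "c \<in> chains G R (Suc k)" "bd c = b" "above \<beta> (\<beta> p + (D + 2) - D) c"
      using fillD[OF \<beta>(1) b] by blast
    have "lift \<beta> 2 x c" by (rule lift_of_above[OF p(1)]) (use c(3) in simp)
    then show "\<exists>c. (c \<in> chains G R (Suc k) \<and> bd c = b) \<and> lift \<beta> 2 x c" using c by blast
  qed auto
  note ex = this
  define S0 where "S0 x b = (SOME S. finite S \<and> (\<forall>c\<in>S. c \<in> chains G R (Suc k) \<and> bd c = b) \<and>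
      (\<forall>\<beta>\<in>B. lift \<beta> (D + 2 + 1) x b \<longrightarrow> (\<exists>c\<in>S. lift \<beta> 1 x c)))" for x b
  note S_all = someI_ex[OF ex, folded S0_def]
  have S0: "finite (S0 x b)" "c \<in> S0 x b \<Longrightarrow> c \<in> chains G R (Suc k) \<and> bd c = b"
    "\<beta> \<in> B \<Longrightarrow> lift \<beta> (D + 2 + 1) x b \<Longrightarrow> \<exists>c\<in>S0 x b. lift \<beta> 1 x c"
    if "x \<in> X (Suc k)" "b \<in> cycles G R k" for x b c \<beta>
    using S_all[OF that] by blast+
  \<comment> \<open>Finite because the boundaries to be filled at \<open>x\<close> are among the
    finitely many elements of \<open>\<Phi>1 (bd x)\<close>; the intersection leaves those that have
    fillings.\<close>
  define S where "S x = (\<Union>b\<in>\<Phi>1 (bd x) \<inter> cycles G R k. S0 x b)" for x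
  have "finite (S x)" if "x \<in> X (Suc k)" for x
    using S0(1)[OF that] fin_eq_finite[OF \<Phi>1] by (auto simp: S_def)
  then obtain \<Psi> where \<Psi>: "fin_eq \<Psi>" and ext: "\<forall>\<phi>0 t. sel \<Phi>1 \<phi>0 \<longrightarrow>
      (\<forall>g\<in>carrier G. \<forall>x\<in>X (Suc k). t g x \<in> tr g ` S x) \<longrightarrow>
    (\<exists>\<phi>. sel \<Psi> \<phi> \<and> (\<forall>i. i \<noteq> Suc k \<longrightarrow> (\<forall>c\<in>chains G R i. \<phi> c = \<phi>0 c)) \<and>
      (\<forall>g\<in>carrier G. \<forall>x\<in>X (Suc k). \<phi> (tr g x) = t g x))"
    using extend_degree[OF \<Phi>1, of "Suc k" S] by blast
  have "\<exists>\<phi>. sel \<Psi> \<phi> \<and> chain_map (Suc k) \<phi> \<and> pushes (Suc k) \<beta> 1 \<phi>" if \<beta>: "\<beta> \<in> B" for \<beta>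
  proof -
    obtain \<phi>' where \<phi>': "sel \<Phi>0 \<phi>'" "chain_map k \<phi>'" "pushes k \<beta> 1 \<phi>'" using IH(2)[OF \<beta>] by blast
    define \<phi>0 where "\<phi>0 = \<phi>' ^^ N"
    have s0: "sel \<Phi>1 \<phi>0" unfolding \<phi>0_def \<Phi>1_def by (rule sel_funpow[OF \<phi>'(1)])
    have cm0: "chain_map k \<phi>0" unfolding \<phi>0_def by (rule chain_map_funpow[OF \<phi>'(2)])
    have p0: "pushes k \<beta> (real N) \<phi>0" using pushes_funpow[OF \<phi>'(2,3), of N] by (simp add: \<phi>0_def)
    \<comment> \<open>The boundary required at \<open>g x\<close>, moved back to \<open>x\<close>.
      It is the value at \<open>bd x\<close> of a conjugate of \<open>\<phi>0\<close>, hence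
      selected from \<open>\<Phi>1\<close> and pushed by \<open>N\<close> over
      \<open>\<beta> \<circ> \<rho> g\<close>.\<close>
    define b where "b g x = tr (inv\<^bsub>G\<^esub> g) (\<phi>0 (tr g (bd x)))" for g x
    define u where "u g x = (SOME c. c \<in> S0 x (b g x) \<and> lift (\<beta> \<circ> \<rho> g) 1 x c)" for g x
    have u: "u g x \<in> S x \<and> u g x \<in> chains G R (Suc k) \<and> bd (u g x) = b g x \<and> lift (\<beta> \<circ> \<rho> g) 1 x (u g x)"
      if g: "g \<in> carrier G" and x: "x \<in> X (Suc k)" for g x
    proof -
      have xc: "x \<in> chains G R (Suc k)" using chains_basis[OF one_closed x] by simp
      have bx: "bd x \<in> cycles G R k" by (rule bd_chains_Suc[OF xc])
      have 1: "b g x \<in> \<Phi>1 (bd x)" using sel_conj[OF \<Phi>1 s0 g] by (auto simp: sel_def b_def)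
      have 2: "b g x \<in> cycles G R k"
        unfolding b_def by (rule chain_map_cycles[OF chain_map_conj[OF cm0 g] order_refl bx])
      have "lift (\<beta> \<circ> \<rho> g) (- C + real N) x (b g x)"
      proof (rule lift_trans)
        show "lift (\<beta> \<circ> \<rho> g) (- C) x (bd x)"
          by (rule C(2)[OF lip[OF inv[OF \<beta> g]] chains_skeleton[OF order_refl xc]])
        show "lift (\<beta> \<circ> \<rho> g) (real N) (bd x) (b g x)"
          using pushes_conj[OF p0 g] chains_skeleton[OF order_refl cycles_chains[OF bx]]
          by (simp add: pushes_def b_def)
      qed
      then have "lift (\<beta> \<circ> \<rho> g) (D + 2 + 1) x (b g x)" by (rule lift_mono) (use N in simp)
      then have "\<exists>c. c \<in> S0 x (b g x) \<and> lift (\<beta> \<circ> \<rho> g) 1 x c"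
        using S0(3)[OF x 2 inv[OF \<beta> g]] by blast
      then have "u g x \<in> S0 x (b g x) \<and> lift (\<beta> \<circ> \<rho> g) 1 x (u g x)" unfolding u_def by (rule someI_ex)
      then show ?thesis using S0(2)[OF x 2] 1 2 by (auto simp: S_def)
    qed
    have "\<forall>g\<in>carrier G. \<forall>x\<in>X (Suc k). tr g (u g x) \<in> tr g ` S x" using u by blast
    then have "\<exists>\<phi>. sel \<Psi> \<phi> \<and> (\<forall>i. i \<noteq> Suc k \<longrightarrow> (\<forall>c\<in>chains G R i. \<phi> c = \<phi>0 c)) \<and>
      (\<forall>g\<in>carrier G. \<forall>x\<in>X (Suc k). \<phi> (tr g x) = tr g (u g x))"
      using ext[rule_format, OF s0, of "\<lambda>g x. tr g (u g x)"] by blast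
    then obtain \<phi> where \<phi>: "sel \<Psi> \<phi>" "\<And>i c. i \<noteq> Suc k \<Longrightarrow> c \<in> chains G R i \<Longrightarrow> \<phi> c = \<phi>0 c"
      "\<And>g x. g \<in> carrier G \<Longrightarrow> x \<in> X (Suc k) \<Longrightarrow> \<phi> (tr g x) = tr g (u g x)" by blast
    have ad: "Modules.additive \<phi>" and ad0: "Modules.additive \<phi>0" using \<phi>(1) s0 by (auto simp: sel_def)
    have \<phi>bd: "\<phi> (bd c) = \<phi>0 (bd c)" if "c \<in> chains G R i" "i \<le> Suc k" for i c
    proof (cases i)
      case 0
      then show ?thesis using that by (simp add: bd_chains_0 additive.zero[OF ad] additive.zero[OF ad0])
    next
      case (Suc j)
      then show ?thesis using \<phi>(2)[of j "bd c"] that bd_chains_Suc[of c j] cycles_chains by auto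
    qed
    have top: "\<phi> c \<in> chains G R (Suc k) \<and> bd (\<phi> c) = \<phi>0 (bd c)" if "c \<in> chains G R (Suc k)" for c
      using that
    proof (induction c rule: chains_induct)
      case (basis g x)
      have "bd (tr g (u g x)) = \<phi>0 (bd (tr g x))"
        using u[OF basis] basis by (simp add: bd_tr b_def)
      then show ?case using u[OF basis] basis by (simp add: \<phi>(3) chains_tr)
    qed (auto simp: additive.zero[OF ad] additive.add[OF ad] additive.minus[OF ad] chains_add chains_minus
        additive.zero[OF ad0] additive.add[OF ad0] additive.minus[OF ad0]
        additive.zero[OF additive_bd] additive.add[OF additive_bd] additive.minus[OF additive_bd])
    have "\<phi> c \<in> chains G R i \<and> bd (\<phi> c) = \<phi> (bd c)" if "i \<le> Suc k" "c \<in> chains G R i" for i c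
    proof (cases "i = Suc k")
      case True
      then show ?thesis using top[of c] \<phi>bd[of c i] that by simp
    next
      case False
      then show ?thesis
        using \<phi>(2)[of i c] \<phi>bd[of c i] that chain_map_chains[OF cm0, of i c] chain_map_bd[OF cm0, of i c]
        by simp
    qed
    then have "chain_map (Suc k) \<phi>"
      using \<phi>(2)[of 0] chain_map_aug[OF cm0] ad by (simp add: chain_map_def)
    moreover have "pushes (Suc k) \<beta> 1 \<phi>"
      unfolding pushes_def
    proof (rule ballI, rule lift_skeleton[OF ad], assumption)
      fix g i x assume g: "g \<in> carrier G" "i \<le> Suc k" "x \<in> X i"
      show "lift \<beta> 1 (tr g x) (\<phi> (tr g x))"
      proof (cases "i = Suc k")
        case True
        then show ?thesis using u[of g x] g by (simp add: \<phi>(3) lift_tr)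
      next
        case False
        have t: "tr g x \<in> chains G R i" by (rule chains_basis[OF g(1,3)])
        have "lift \<beta> (real N) (tr g x) (\<phi>0 (tr g x))"
          using p0 chains_skeleton[OF _ t, of k] False g by (simp add: pushes_def)
        \<comment> \<open>In lower degrees the new map is the power itself, and \<open>N\<close> is
          at least 1.\<close>
        then have "lift \<beta> 1 (tr g x) (\<phi>0 (tr g x))" by (rule lift_mono) (use N C D in simp)
        then show ?thesis using \<phi>(2)[OF False t] by simp
      qed
    qed
    ultimately show ?thesis using \<phi>(1) by blast
  qed
  then show ?thesis using \<Psi> by blast
qed

theorem push_of_acyclic:
  assumes lip: "\<And>\<beta>. \<beta> \<in> B \<Longrightarrow> lipschitz1 \<beta>"
    and inv: "\<And>\<beta> g. \<beta> \<in> B \<Longrightarrow> g \<in> carrier G \<Longrightarrow> \<beta> \<circ> \<rho> g \<in> B"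
    and cpt: "\<And>K \<epsilon>. (\<And>f. finite (K f)) \<Longrightarrow> \<epsilon> > 0 \<Longrightarrow> \<exists>F\<subseteq>B. finite F \<and> (\<forall>\<beta>\<in>B. \<exists>f\<in>F. near \<epsilon> (K f) f \<beta>)"
    and ca: "\<And>\<beta>. \<beta> \<in> B \<Longrightarrow> acyclic_over n \<beta>"
    and fin: "finite (\<Union>i\<le>n. X i)"
  shows "\<exists>\<Phi>. fin_eq \<Phi> \<and> (\<forall>\<beta>\<in>B. \<exists>\<phi>. sel \<Phi> \<phi> \<and> chain_map n \<phi> \<and> pushes n \<beta> 1 \<phi>)"
proof -
  have "k \<le> n \<Longrightarrow> \<exists>\<Phi>. fin_eq \<Phi> \<and> (\<forall>\<beta>\<in>B. \<exists>\<phi>. sel \<Phi> \<phi> \<and> chain_map k \<phi> \<and> pushes k \<beta> 1 \<phi>)" for k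
  proof (induction k)
    case 0
    show ?case by (rule push_degree_0[OF lip inv cpt ca])
  next
    case (Suc k)
    then obtain \<Phi> where "fin_eq \<Phi>" "\<And>\<beta>. \<beta> \<in> B \<Longrightarrow> \<exists>\<phi>. sel \<Phi> \<phi> \<and> chain_map k \<phi> \<and> pushes k \<beta> 1 \<phi>"
      by (meson Suc_leD)
    moreover have "finite (\<Union>i\<le>Suc k. X i)" using fin by (rule rev_finite_subset) (use Suc.prems in force)
    ultimately show ?case using Suc.prems by (intro push_degree_Suc[OF lip inv cpt ca]) auto
  qed
  then show ?thesis by blast
qed

end

section \<open>The invariants\<close>

locale CAT0_resolution = controlled_resolution G \<rho> act R h + proper_CAT0 "TYPE('m)"
  for G :: "('g, 'b) monoid_scheme"
    and \<rho> :: "'g \<Rightarrow> 'm::metric_space \<Rightarrow> 'm"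
    and act :: "'g \<Rightarrow> 'a::ab_group_add \<Rightarrow> 'a"
    and R :: "('g, 'f::ab_group_add, 'a) based_complex"
    and h :: "'f \<Rightarrow> 'm set"
begin

section \<open>The action on rays and the limit rays of an orbit\<close>

lemma ray_rho: "geodesic_ray \<gamma> \<Longrightarrow> g \<in> carrier G \<Longrightarrow> geodesic_ray (\<rho> g \<circ> \<gamma>)"
  by (simp add: geodesic_ray_def rho_isometry)

lemma asymptotic_rho: "(\<gamma>, \<gamma>') \<in> asymptotic \<Longrightarrow> g \<in> carrier G \<Longrightarrow> (\<rho> g \<circ> \<gamma>, \<rho> g \<circ> \<gamma>') \<in> asymptotic"
  by (simp add: asymptotic_iff ray_rho rho_isometry)

lemma busemann_rho:
  assumes "g \<in> carrier G" shows "busemann \<gamma> \<circ> \<rho> g = busemann (\<rho> (inv\<^bsub>G\<^esub> g) \<circ> \<gamma>)"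
proof
  fix x
  have "dist (\<rho> g x) y = dist x (\<rho> (inv\<^bsub>G\<^esub> g) y)" for y
    using rho_isometry[of "inv\<^bsub>G\<^esub> g" "\<rho> g x" y] assms by simp
  then show "(busemann \<gamma> \<circ> \<rho> g) x = busemann (\<rho> (inv\<^bsub>G\<^esub> g) \<circ> \<gamma>) x"
    by (simp add: busemann_def)
qed

lemma boundary_action_boundary:
  assumes e: "e \<in> visual_boundary" and g: "g \<in> carrier G"
  shows "boundary_action \<rho> g e \<in> visual_boundary"
proof -
  obtain \<gamma> where \<gamma>: "\<gamma> \<in> e" using visual_boundary_nonempty[OF e] by blast
  have "boundary_action \<rho> g e = asymptotic `` {\<rho> g \<circ> \<gamma>}"
  proof (intro equalityI subsetI)
    fix c assume "c \<in> boundary_action \<rho> g e"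
    then obtain c' where "c' \<in> e" "c = \<rho> g \<circ> c'" by (auto simp: boundary_action_def)
    then show "c \<in> asymptotic `` {\<rho> g \<circ> \<gamma>}"
      using asymptotic_rho[OF _ g] visual_boundary_mem_iff[OF e \<gamma>] by auto
  next
    fix c assume "c \<in> asymptotic `` {\<rho> g \<circ> \<gamma>}"
    then have "(\<rho> (inv\<^bsub>G\<^esub> g) \<circ> (\<rho> g \<circ> \<gamma>), \<rho> (inv\<^bsub>G\<^esub> g) \<circ> c) \<in> asymptotic"
      using g by (intro asymptotic_rho) auto
    moreover have "\<rho> (inv\<^bsub>G\<^esub> g) \<circ> (\<rho> g \<circ> \<gamma>) = \<gamma>" using g by (simp add: fun_eq_iff)
    ultimately have "\<rho> (inv\<^bsub>G\<^esub> g) \<circ> c \<in> e" using visual_boundary_mem_iff[OF e \<gamma>] by simp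
    moreover have "c = \<rho> g \<circ> (\<rho> (inv\<^bsub>G\<^esub> g) \<circ> c)" using g by (simp add: fun_eq_iff)
    ultimately show "c \<in> boundary_action \<rho> g e" unfolding boundary_action_def by blast
  qed
  then show ?thesis using visual_boundary_class ray_rho[OF visual_boundary_ray[OF e \<gamma>] g] by simp
qed

lemma orbit_boundary: "e \<in> visual_boundary \<Longrightarrow> orbit G (boundary_action \<rho>) e \<subseteq> visual_boundary"
  unfolding orbit_def using boundary_action_boundary by blast

text \<open>Rays with a common endpoint have the same Busemann function up to a constant, which
  \<open>near\<close> ignores. The orbit is therefore represented by the translates of the Busemann
  function of one ray.\<close>

lemma limit_rays_orbit:
  assumes e: "e \<in> visual_boundary" "\<gamma>0 \<in> e"
  shows "\<gamma> \<in> limit_rays (\<Union>(orbit G (boundary_action \<rho>) e)) \<longleftrightarrow> geodesic_ray \<gamma> \<and>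
    (\<forall>K \<epsilon>. finite K \<longrightarrow> \<epsilon> > 0 \<longrightarrow> (\<exists>g\<in>carrier G. near \<epsilon> K (busemann \<gamma>) (busemann \<gamma>0 \<circ> \<rho> g)))"
proof -
  have "(\<exists>\<gamma>'\<in>\<Union>(orbit G (boundary_action \<rho>) e). near \<epsilon> K (busemann \<gamma>) (busemann \<gamma>')) \<longleftrightarrow>
      (\<exists>g\<in>carrier G. near \<epsilon> K (busemann \<gamma>) (busemann \<gamma>0 \<circ> \<rho> g))" for K \<epsilon>
  proof
    assume "\<exists>\<gamma>'\<in>\<Union>(orbit G (boundary_action \<rho>) e). near \<epsilon> K (busemann \<gamma>) (busemann \<gamma>')"
    then obtain g c where g: "g \<in> carrier G" "c \<in> e" and n: "near \<epsilon> K (busemann \<gamma>) (busemann (\<rho> g \<circ> c))"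
      by (auto simp: orbit_def boundary_action_def)
    obtain a where a: "\<forall>x :: 'm. busemann \<gamma>0 x = busemann c x + a"
      using busemann_boundary_const[OF e g(2)] by blast
    have "busemann (\<rho> g \<circ> c) = busemann c \<circ> \<rho> (inv\<^bsub>G\<^esub> g)"
      using busemann_rho[of "inv\<^bsub>G\<^esub> g" c] g by simp
    then have "near \<epsilon> K (busemann \<gamma>) (busemann \<gamma>0 \<circ> \<rho> (inv\<^bsub>G\<^esub> g))"
      using a by (intro near_shift[OF n, of _ 0 _ a]) auto
    then show "\<exists>g\<in>carrier G. near \<epsilon> K (busemann \<gamma>) (busemann \<gamma>0 \<circ> \<rho> g)" using g by blast
  next
    assume "\<exists>g\<in>carrier G. near \<epsilon> K (busemann \<gamma>) (busemann \<gamma>0 \<circ> \<rho> g)"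
    then obtain g where g: "g \<in> carrier G" "near \<epsilon> K (busemann \<gamma>) (busemann (\<rho> (inv\<^bsub>G\<^esub> g) \<circ> \<gamma>0))"
      by (auto simp: busemann_rho)
    have "boundary_action \<rho> (inv\<^bsub>G\<^esub> g) e \<in> orbit G (boundary_action \<rho>) e"
      using g(1) unfolding orbit_def by blast
    moreover have "\<rho> (inv\<^bsub>G\<^esub> g) \<circ> \<gamma>0 \<in> boundary_action \<rho> (inv\<^bsub>G\<^esub> g) e"
      using e(2) unfolding boundary_action_def by blast
    ultimately show "\<exists>\<gamma>'\<in>\<Union>(orbit G (boundary_action \<rho>) e). near \<epsilon> K (busemann \<gamma>) (busemann \<gamma>')"
      using g(2) by blast
  qed
  then show ?thesis unfolding limit_rays_def by simp
qed

text \<open>An approximation on \<open>K\<close> is obtained from one on the image of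
  \<open>K\<close> under the inverse of \<open>g\<close>. This makes the family of Busemann
  functions closed under translation.\<close>

lemma limit_rays_orbit_invariant:
  assumes e: "e \<in> visual_boundary" and g: "g \<in> carrier G"
    and \<gamma>: "\<gamma> \<in> limit_rays (\<Union>(orbit G (boundary_action \<rho>) e))"
  shows "\<rho> g \<circ> \<gamma> \<in> limit_rays (\<Union>(orbit G (boundary_action \<rho>) e))"
proof -
  obtain \<gamma>0 where \<gamma>0: "\<gamma>0 \<in> e" using visual_boundary_nonempty[OF e] by blast
  note iff = limit_rays_orbit[OF e \<gamma>0]
  have "\<exists>k\<in>carrier G. near \<epsilon> K (busemann (\<rho> g \<circ> \<gamma>)) (busemann \<gamma>0 \<circ> \<rho> k)"
    if K: "finite K" "\<epsilon> > 0" for K \<epsilon>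
  proof -
    let ?g = "\<rho> (inv\<^bsub>G\<^esub> g)"
    have "finite (?g ` K)" using K(1) by simp
    then obtain k where k: "k \<in> carrier G" "near \<epsilon> (?g ` K) (busemann \<gamma>) (busemann \<gamma>0 \<circ> \<rho> k)"
      using \<gamma> K(2) unfolding iff by blast
    have "near \<epsilon> K (busemann \<gamma> \<circ> ?g) (busemann \<gamma>0 \<circ> \<rho> k \<circ> ?g)"
      using k(2) unfolding near_def by auto
    moreover have "busemann \<gamma> \<circ> ?g = busemann (\<rho> g \<circ> \<gamma>)" using busemann_rho[of "inv\<^bsub>G\<^esub> g" \<gamma>] g by simp
    moreover have "busemann \<gamma>0 \<circ> \<rho> k \<circ> ?g = busemann \<gamma>0 \<circ> \<rho> (k \<otimes>\<^bsub>G\<^esub> inv\<^bsub>G\<^esub> g)"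
      using k(1) g by (simp add: fun_eq_iff rho_mult)
    ultimately show ?thesis using k(1) g by (metis m_closed inv_closed)
  qed
  moreover have "geodesic_ray (\<rho> g \<circ> \<gamma>)" using \<gamma> ray_rho[OF _ g] unfolding iff by blast
  ultimately show ?thesis unfolding iff by blast
qed

section \<open>The invariants in terms of \<open>above\<close> and \<open>lift\<close>\<close>

lemma valuation_ge_iff: "ereal s \<le> valuation h \<gamma> c \<longleftrightarrow> above (busemann \<gamma>) s c"
proof (cases "c = 0")
  case False
  then show ?thesis using h_nonempty[OF False] h_finite[of c] by (simp add: valuation_def above_def)
qed (simp add: valuation_def)

lemma controlled_acyclic_iff:
  "controlled_acyclic k G R h \<gamma> \<longleftrightarrow> (\<exists>l :: real \<Rightarrow> real. (\<forall>s. l s \<ge> 0) \<and> filterlim (\<lambda>s. s - l s) at_top at_top \<and>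
    (\<forall>s. (\<forall>a. \<exists>c\<in>chains G R 0. aug c = a \<and> above (busemann \<gamma>) (s - l s) c) \<and>
      (\<forall>i. int i \<le> k \<longrightarrow> (\<forall>z\<in>cycles G R i. above (busemann \<gamma>) s z \<longrightarrow>
        (\<exists>c\<in>chains G R (Suc i). bd c = z \<and> above (busemann \<gamma>) (s - l s) c)))))"
  unfolding controlled_acyclic_def valuation_ge_iff ..

lemma gsh_pos_lift:
  assumes "gsh G R h n \<gamma> \<phi> > 0"
  shows "\<exists>d>0. \<forall>c\<in>skeleton G R n. c \<noteq> 0 \<longrightarrow> lift (busemann \<gamma>) d c (\<phi> c)"
proof -
  \<comment> \<open>\<open>gsh\<close> may be infinite, so a positive real is taken strictly below
    it.\<close>
  obtain d where d: "0 < ereal d" "ereal d < gsh G R h n \<gamma> \<phi>" using ereal_dense2[OF assms] by blast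
  have "lift (busemann \<gamma>) d c (\<phi> c)" if c: "c \<in> skeleton G R n" "c \<noteq> 0" for c
    unfolding lift_def
  proof (intro allI impI)
    fix s assume s: "above (busemann \<gamma>) s c"
    have "gsh G R h n \<gamma> \<phi> \<le> valuation h \<gamma> (\<phi> c) - valuation h \<gamma> c"
      unfolding gsh_def using c by (intro INF_lower) auto
    then have "ereal d \<le> valuation h \<gamma> (\<phi> c) - valuation h \<gamma> c" using d(2) by simp
    moreover obtain m where m: "valuation h \<gamma> c = ereal m" using c(2) by (simp add: valuation_def)
    moreover have "s \<le> m" using s valuation_ge_iff[of s \<gamma> c] m by simp
    ultimately have "ereal (s + d) \<le> valuation h \<gamma> (\<phi> c)"
      by (cases "valuation h \<gamma> (\<phi> c)") auto
    then show "above (busemann \<gamma>) (s + d) (\<phi> c)" using valuation_ge_iff by blast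
  qed
  then show ?thesis using d(1) by auto
qed

lemma pushes_gsh:
  assumes "pushes n (busemann \<gamma>) 1 \<phi>"
  shows "gsh G R h n \<gamma> \<phi> > 0"
proof -
  have "1 \<le> gsh G R h n \<gamma> \<phi>"
    unfolding gsh_def
  proof (rule INF_greatest)
    fix c assume c: "c \<in> skeleton G R n - {0}"
    obtain m where m: "valuation h \<gamma> c = ereal m" using c by (simp add: valuation_def)
    then have "above (busemann \<gamma>) m c" using valuation_ge_iff[of m \<gamma> c] by simp
    then have "above (busemann \<gamma>) (m + 1) (\<phi> c)" using assms c by (simp add: pushes_def lift_def)
    then have "ereal (m + 1) \<le> valuation h \<gamma> (\<phi> c)" using valuation_ge_iff by blast
    then show "1 \<le> valuation h \<gamma> (\<phi> c) - valuation h \<gamma> c"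
      unfolding m by (cases "valuation h \<gamma> (\<phi> c)") (auto simp: one_ereal_def)
  qed
  then show ?thesis using less_le_trans[of 0 "1 :: ereal"] by simp
qed

lemma lift_shift:
  assumes "lift \<beta> d x c" "\<forall>p. \<beta>' p = \<beta> p + a" shows "lift \<beta>' d x c"
proof -
  have "above \<beta>' s y \<longleftrightarrow> above \<beta> (s - a) y" for s y
    using assms(2) by (auto simp: above_def algebra_simps)
  moreover have "s - a + d = s + d - a" for s by simp
  ultimately show ?thesis using assms(1) unfolding lift_def by metis
qed

lemma lipschitz1_busemann: "geodesic_ray \<gamma> \<Longrightarrow> lipschitz1 (busemann \<gamma>)"
  by (simp add: lipschitz1_def busemann_lipschitz)

text \<open>The hypotheses describe \<open>\<phi>\<close> on the skeleton only, and as a function it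
  is arbitrary elsewhere. Sending the basis elements of degree above \<open>n\<close> to 0 gives an
  additive map and finite sets on the whole module.\<close>

lemma total_extension:
  assumes fin: "G_finitary G tr tr (skeleton G R n) (skeleton G R n) \<phi>"
    and cm: "skeleton_chain_map G R n \<phi>"
    and aug: "\<And>c. c \<in> chains G R 0 \<Longrightarrow> aug (\<phi> c) = aug c"
  shows "\<exists>\<Psi> \<psi>. fin_eq \<Psi> \<and> sel \<Psi> \<psi> \<and> chain_map n \<psi> \<and> (\<forall>c\<in>skeleton G R n. \<psi> c = \<phi> c)"
proof -
  have ad: "\<phi> (c + d) = \<phi> c + \<phi> d" if "c \<in> skeleton G R n" "d \<in> skeleton G R n" for c d
    using fin that by (simp add: G_finitary_def additive_on_def)
  have \<phi>0: "\<phi> 0 = 0" using ad[of 0 0] by simp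
  have neg: "\<phi> (- c) = - \<phi> c" if "c \<in> skeleton G R n" for c
    using ad[OF that skeleton_minus[OF that]] by (simp add: \<phi>0 eq_neg_iff_add_eq_0 add.commute)
  obtain \<Phi> where "\<forall>b\<in>skeleton G R n. finite (\<Phi> b) \<and> \<Phi> b \<subseteq> skeleton G R n \<and> \<phi> b \<in> \<Phi> b"
    and "G_map_on G tr (\<lambda>g. (`) (tr g)) (skeleton G R n) \<Phi>"
    using fin unfolding G_finitary_def by (elim conjE exE) (rule that)
  then have \<Phi>: "\<And>b. b \<in> skeleton G R n \<Longrightarrow> finite (\<Phi> b) \<and> \<phi> b \<in> \<Phi> b"
    and eqv: "\<And>g b. g \<in> carrier G \<Longrightarrow> b \<in> skeleton G R n \<Longrightarrow> \<Phi> (tr g b) = tr g ` \<Phi> b"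
    unfolding G_map_on_def by blast+
  define B where "B = (\<Union>i\<le>n. X i)"
  have BX: "x \<in> skeleton G R n" if x: "x \<in> B" for x
  proof -
    obtain i where i: "i \<le> n" "x \<in> X i" using x by (auto simp: B_def)
    show ?thesis using chains_skeleton[OF i(1) chains_basis[OF one_closed i(2)]] by simp
  qed
  define S where "S x = (if x \<in> B then \<Phi> x else {0})" for x
  define t where "t g x = (if x \<in> B then \<phi> (tr g x) else 0)" for g x
  have "finite (S x)" for x using \<Phi>[OF BX] by (simp add: S_def)
  then obtain \<Psi> where \<Psi>: "fin_eq \<Psi>" and ext: "\<forall>t. (\<forall>g\<in>carrier G. \<forall>x\<in>XX. t g x \<in> tr g ` S x) \<longrightarrow>
    (\<exists>\<phi>. sel \<Psi> \<phi> \<and> (\<forall>g\<in>carrier G. \<forall>x\<in>XX. \<phi> (tr g x) = t g x))"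
    using fin_eq_extension[of S] by blast
  have "\<forall>g\<in>carrier G. \<forall>x\<in>XX. t g x \<in> tr g ` S x"
  proof (intro ballI)
    fix g x assume g: "g \<in> carrier G"
    show "t g x \<in> tr g ` S x"
    proof (cases "x \<in> B")
      case True
      then show ?thesis using \<Phi>[OF skeleton_tr[OF g BX[OF True]]] eqv[OF g BX[OF True]]
        by (simp add: t_def S_def)
    next
      case False
      then show ?thesis by (simp add: t_def S_def additive.zero[OF additive_tr[OF g]])
    qed
  qed
  then have "\<exists>\<phi>. sel \<Psi> \<phi> \<and> (\<forall>g\<in>carrier G. \<forall>x\<in>XX. \<phi> (tr g x) = t g x)"
    using ext by (elim allE[of _ t] impE)
  then obtain \<psi> where \<psi>: "sel \<Psi> \<psi>" "\<And>g x. g \<in> carrier G \<Longrightarrow> x \<in> XX \<Longrightarrow> \<psi> (tr g x) = t g x" by blast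
  have ad': "Modules.additive \<psi>" using \<psi>(1) by (simp add: sel_def)
  have on_chains: "\<psi> c = \<phi> c \<and> c \<in> skeleton G R n" if "i \<le> n" "c \<in> chains G R i" for c i
    using that(2)
  proof (induction c rule: chains_induct)
    case (basis g x)
    then have "x \<in> B" using that(1) by (auto simp: B_def)
    then show ?case using basis BX skeleton_tr \<psi>(2)[of g x] by (auto simp: t_def)
  qed (auto simp: additive.zero[OF ad'] additive.add[OF ad'] additive.minus[OF ad'] \<phi>0 ad neg
      skeleton_add skeleton_minus)
  have eq: "\<psi> c = \<phi> c" if "c \<in> skeleton G R n" for c
  proof -
    have "\<psi> c = \<phi> c \<and> c \<in> skeleton G R n"
      using that
    proof (induction c rule: skeleton_induct)
      case (chain c i)
      then show ?case using on_chains by blast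
    qed (auto simp: additive.zero[OF ad'] additive.add[OF ad'] additive.minus[OF ad'] \<phi>0 ad neg
      skeleton_add skeleton_minus)
    then show ?thesis ..
  qed
  have "\<psi> c \<in> chains G R i \<and> bd (\<psi> c) = \<psi> (bd c)" if i: "i \<le> n" "c \<in> chains G R i" for i c
  proof -
    have c: "c \<in> skeleton G R n" by (rule chains_skeleton[OF i])
    have "bd c \<in> skeleton G R n"
    proof (cases i)
      case 0
      then show ?thesis using i by (simp add: bd_chains_0)
    next
      case (Suc j)
      then show ?thesis using i bd_chains_Suc[of c j] cycles_chains chains_skeleton[of j n] by auto
    qed
    moreover have "\<phi> c \<in> chains G R i" "bd (\<phi> c) = \<phi> (bd c)"
      using cm i c unfolding skeleton_chain_map_def by blast+
    ultimately show ?thesis using eq[OF c] eq by simp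
  qed
  moreover have "aug (\<psi> c) = aug c" if "c \<in> chains G R 0" for c
    using aug[OF that] eq[OF chains_skeleton[OF le0 that]] by simp
  ultimately have "chain_map n \<psi>" using ad' by (simp add: chain_map_def)
  then show ?thesis using \<Psi> \<psi>(1) eq by blast
qed

lemma Sigma_circ_closure:
  assumes fin: "finite (\<Union>i\<le>n. X i)" and e: "e \<in> Sigma_circ n G R h"
  shows "cone_topology x0 closure_of orbit G (boundary_action \<rho>) e \<subseteq> Sigma_inv n G R h"
proof
  fix e' assume "e' \<in> cone_topology x0 closure_of orbit G (boundary_action \<rho>) e"
  moreover have eb: "e \<in> visual_boundary" using e by (simp add: Sigma_circ_def)
  ultimately have e': "e' \<in> visual_boundary" "e' \<subseteq> limit_rays (\<Union>(orbit G (boundary_action \<rho>) e))"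
    using closure_eq_limit_rays[OF orbit_boundary] by auto
  obtain \<gamma>0 where \<gamma>0: "\<gamma>0 \<in> e" using visual_boundary_nonempty[OF eb] by blast
  obtain \<phi> where \<phi>: "G_finitary G tr tr (skeleton G R n) (skeleton G R n) \<phi>" "skeleton_chain_map G R n \<phi>"
    "\<And>c. c \<in> chains G R 0 \<Longrightarrow> aug (\<phi> c) = aug c" "gsh G R h n \<gamma>0 \<phi> > 0"
    using e \<gamma>0 unfolding Sigma_circ_def by blast
  obtain \<Psi> \<psi> where \<psi>: "fin_eq \<Psi>" "sel \<Psi> \<psi>" "chain_map n \<psi>" "\<And>c. c \<in> skeleton G R n \<Longrightarrow> \<psi> c = \<phi> c"
    using total_extension[OF \<phi>(1,2,3)] by blast
  obtain d where d: "d > 0" "\<And>c. c \<in> skeleton G R n \<Longrightarrow> c \<noteq> 0 \<Longrightarrow> lift (busemann \<gamma>0) d c (\<phi> c)"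
    using gsh_pos_lift[OF \<phi>(4)] by blast
  have p: "pushes n (busemann \<gamma>0) d \<psi>"
    unfolding pushes_def
  proof
    fix c assume c: "c \<in> skeleton G R n"
    show "lift (busemann \<gamma>0) d c (\<psi> c)"
    proof (cases "c = 0")
      case True
      then show ?thesis using \<psi>(2) by (simp add: lift_def sel_def additive.zero)
    qed (use d(2)[OF c] \<psi>(4)[OF c] in simp)
  qed
  have "controlled_acyclic k G R h \<gamma>" if k: "k < int n" and \<gamma>: "\<gamma> \<in> e'" for k \<gamma>
  proof -
    have lim: "geodesic_ray \<gamma>"
      "\<And>K \<epsilon>. finite K \<Longrightarrow> \<epsilon> > 0 \<Longrightarrow> \<exists>g\<in>carrier G. near \<epsilon> K (busemann \<gamma>) (busemann \<gamma>0 \<circ> \<rho> g)"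
      using e'(2) \<gamma> limit_rays_orbit[OF eb \<gamma>0] by blast+
    obtain D where D: "D \<ge> 0" "\<And>s. (\<forall>a. \<exists>c\<in>chains G R 0. aug c = a \<and> above (busemann \<gamma>) s c) \<and>
      (\<forall>i<n. \<forall>z\<in>cycles G R i. above (busemann \<gamma>) s z \<longrightarrow>
        (\<exists>c\<in>chains G R (Suc i). bd c = z \<and> above (busemann \<gamma>) (s - D) c))"
      using acyclic_of_push[OF fin lipschitz1_busemann[OF visual_boundary_ray[OF eb \<gamma>0]]
        lipschitz1_busemann[OF lim(1)] \<psi>(1,2,3) p d(1) lim(2)] by blast
    \<comment> \<open>A constant lag function, with value \<open>D\<close>, witnesses controlled
      acyclicity.\<close>
    have "filterlim (\<lambda>s. - D + s) at_top at_top"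
      by (rule filterlim_tendsto_add_at_top[OF tendsto_const filterlim_ident])
    then have "filterlim (\<lambda>s. s - D) at_top at_top" by simp
    moreover have "i < n" if "int i \<le> k" for i using that k by simp
    ultimately show ?thesis
      unfolding controlled_acyclic_iff using D by (intro exI[of _ "\<lambda>_. D"]) blast
  qed
  then show "e' \<in> Sigma_inv n G R h" using e'(1) by (simp add: Sigma_inv_def)
qed

text \<open>A map for \<open>\<gamma>0\<close> cannot be built in isolation: its values on
  translates of basis elements are governed by translates of the Busemann function. So
  \<open>push_of_acyclic\<close> is applied to all limit rays of the orbit, among which
  \<open>\<gamma>0\<close> occurs by taking the unit of \<open>G\<close>.\<close>

lemma Sigma_circ_of_closure:
  assumes fin: "finite (\<Union>i\<le>n. X i)" and eb: "e \<in> visual_boundary"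
    and cl: "cone_topology x0 closure_of orbit G (boundary_action \<rho>) e \<subseteq> Sigma_inv n G R h"
  shows "e \<in> Sigma_circ n G R h"
proof -
  define U where "U = limit_rays (\<Union>(orbit G (boundary_action \<rho>) e))"
  obtain \<gamma>0 where \<gamma>0: "\<gamma>0 \<in> e" using visual_boundary_nonempty[OF eb] by blast
  have rU: "geodesic_ray \<gamma>" if "\<gamma> \<in> U" for \<gamma> using that by (simp add: U_def limit_rays_def)
  have ca: "acyclic_over n (busemann \<gamma>)" if \<gamma>: "\<gamma> \<in> U" for \<gamma>
  proof -
    define e' where "e' = asymptotic `` {\<gamma>}"
    have e': "e' \<in> visual_boundary" "\<gamma> \<in> e'"
      using rU[OF \<gamma>] by (auto simp: e'_def visual_boundary_class asymptotic_refl)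
    then have "e' \<subseteq> U" using limit_rays_asymptotic[OF e'] \<gamma> unfolding U_def by blast
    then have "e' \<in> Sigma_inv n G R h"
      using cl e'(1) closure_eq_limit_rays[OF orbit_boundary[OF eb], of x0] unfolding U_def by blast
    \<comment> \<open>For \<open>n = 0\<close> this is degree -1 alone, the degree of the
      module.\<close>
    then have "controlled_acyclic (int n - 1) G R h \<gamma>"
      using e'(2) unfolding Sigma_inv_def by auto
    moreover have "int i \<le> int n - 1 \<longleftrightarrow> i < n" for i by auto
    ultimately show ?thesis unfolding controlled_acyclic_iff acyclic_over_def by auto
  qed
  have cpt: "\<exists>F\<subseteq>busemann ` U. finite F \<and> (\<forall>\<beta>\<in>busemann ` U. \<exists>f\<in>F. near \<epsilon> (K f) f \<beta>)"
    if "\<And>f. finite (K f)" "\<epsilon> > 0" for K \<epsilon>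
  proof (rule limit_rays_finite_subcover[OF that, of "\<Union>(orbit G (boundary_action \<rho>) e)"], unfold U_def[symmetric])
    fix F assume "finite F" "F \<subseteq> busemann ` U" "\<And>\<gamma>. \<gamma> \<in> U \<Longrightarrow> \<exists>f\<in>F. near \<epsilon> (K f) f (busemann \<gamma>)"
    then show ?thesis by blast
  qed
  have inv: "busemann \<gamma> \<circ> \<rho> g \<in> busemann ` U" if "\<gamma> \<in> U" "g \<in> carrier G" for \<gamma> g
    using limit_rays_orbit_invariant[OF eb _ that(1)[unfolded U_def], of "inv\<^bsub>G\<^esub> g"] that(2)
    by (simp add: busemann_rho U_def)
  have "\<exists>\<Phi>. fin_eq \<Phi> \<and> (\<forall>\<beta>\<in>busemann ` U. \<exists>\<phi>. sel \<Phi> \<phi> \<and> chain_map n \<phi> \<and> pushes n \<beta> 1 \<phi>)"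
    by (rule push_of_acyclic[OF _ _ cpt _ fin]) (auto simp: lipschitz1_busemann rU inv ca)
  then obtain \<Phi> where \<Phi>: "fin_eq \<Phi>" "\<forall>\<beta>\<in>busemann ` U. \<exists>\<phi>. sel \<Phi> \<phi> \<and> chain_map n \<phi> \<and> pushes n \<beta> 1 \<phi>" by blast
  have "\<gamma>0 \<in> U"
  proof -
    have "near \<epsilon> K (busemann \<gamma>0) (busemann \<gamma>0 \<circ> \<rho> \<one>\<^bsub>G\<^esub>)" if "\<epsilon> > 0" for K \<epsilon>
      using that unfolding near_def by (intro exI[of _ 0]) simp
    then show ?thesis
      unfolding U_def limit_rays_orbit[OF eb \<gamma>0] using visual_boundary_ray[OF eb \<gamma>0] one_closed by blast
  qed
  then obtain \<phi> where \<phi>: "sel \<Phi> \<phi>" "chain_map n \<phi>" "pushes n (busemann \<gamma>0) 1 \<phi>" using \<Phi>(2) by blast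
  have ad: "Modules.additive \<phi>" using \<phi>(1) by (simp add: sel_def)
  have "G_finitary G tr tr (skeleton G R n) (skeleton G R n) \<phi>"
    unfolding G_finitary_def
  \<comment> \<open>The finite sets have to lie in the skeleton; intersecting keeps them
    equivariant, because the skeleton is invariant under \<open>G\<close>.\<close>
  proof (intro conjI exI[of _ "\<lambda>b. \<Phi> b \<inter> skeleton G R n"] ballI)
    show "additive_on (skeleton G R n) \<phi>" by (simp add: additive_on_def additive.add[OF ad])
    show "\<phi> \<in> skeleton G R n \<rightarrow> skeleton G R n" using chain_map_skeleton[OF \<phi>(2)] by blast
    show "G_map_on G tr (\<lambda>g. (`) (tr g)) (skeleton G R n) (\<lambda>b. \<Phi> b \<inter> skeleton G R n)"
      unfolding G_map_on_def
    proof (intro ballI equalityI subsetI)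
      fix g b y assume g: "g \<in> carrier G" and y: "y \<in> \<Phi> (tr g b) \<inter> skeleton G R n"
      then obtain p where p: "p \<in> \<Phi> b" "y = tr g p" using fin_eq_tr[OF \<Phi>(1) g] by blast
      then have "p \<in> skeleton G R n" using skeleton_tr[of "inv\<^bsub>G\<^esub> g" y] g y by simp
      then show "y \<in> tr g ` (\<Phi> b \<inter> skeleton G R n)" using p by blast
    qed (use fin_eq_tr[OF \<Phi>(1)] skeleton_tr in auto)
  qed (use \<phi>(1) chain_map_skeleton[OF \<phi>(2)] fin_eq_finite[OF \<Phi>(1)] in \<open>auto simp: sel_def\<close>)
  moreover have "skeleton_chain_map G R n \<phi>"
  proof -
    have "bd (\<phi> c) = \<phi> (bd c)" if "c \<in> skeleton G R n" for c
      using that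
    proof (induction c rule: skeleton_induct)
      case (chain c i)
      then show ?case using chain_map_bd[OF \<phi>(2)] by blast
    qed (simp_all add: additive.zero[OF ad] additive.add[OF ad] additive.minus[OF ad]
        additive.zero[OF additive_bd] additive.add[OF additive_bd] additive.minus[OF additive_bd])
    then show ?thesis
      using chain_map_chains[OF \<phi>(2)] by (auto simp: skeleton_chain_map_def additive_on_def additive.add[OF ad])
  qed
  moreover have "gsh G R h n \<gamma> \<phi> > 0" if \<gamma>: "\<gamma> \<in> e" for \<gamma>
  proof (rule pushes_gsh)
    obtain a where a: "\<forall>x. busemann \<gamma> x = busemann \<gamma>0 x + a"
      using busemann_boundary_const[OF eb \<gamma> \<gamma>0] by blast
    then show "pushes n (busemann \<gamma>) 1 \<phi>" using \<phi>(3) lift_shift[OF _ a] unfolding pushes_def by blast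
  qed
  ultimately show ?thesis
    using eb chain_map_aug[OF \<phi>(2)] unfolding Sigma_circ_def by blast
qed

end

theorem theorem1p1:
  fixes n :: nat
    and G :: "('g, 'b) monoid_scheme"
    and \<rho> :: "'g \<Rightarrow> 'm::metric_space \<Rightarrow> 'm"
    and act :: "'g \<Rightarrow> 'a::ab_group_add \<Rightarrow> 'a"
    and R :: "('g, 'f::ab_group_add, 'a) based_complex"
    and h :: "'f \<Rightarrow> 'm set"
    and x0 :: 'm
  assumes "CAT0 TYPE('m)"
    and "proper_space TYPE('m)"
    and "\<not> compact (UNIV :: 'm set)"
    and "group G"
    and "isometric_action G \<rho>"
    and "G_module G act"
    and "FP_resolution n G act R"
    and "control_map G \<rho> R h"
  shows "Sigma_circ n G R h =
    {e \<in> visual_boundary.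
       cone_topology x0 closure_of orbit G (boundary_action \<rho>) e \<subseteq> Sigma_inv n G R h}"
proof -
  interpret CAT0_resolution G \<rho> act R h
    using assms
    by (intro CAT0_resolution.intro controlled_resolution.intro proper_CAT0.intro) (simp_all add: FP_resolution_def)
  have fin: "finite (\<Union>i\<le>n. res_basis R i)"
    using assms by (intro basis_finite) (simp add: FP_resolution_def)
  show ?thesis
  proof (intro equalityI subsetI)
    fix e assume e: "e \<in> Sigma_circ n G R h"
    moreover have "e \<in> visual_boundary" using e by (simp add: Sigma_circ_def)
    ultimately show "e \<in> {e \<in> visual_boundary.
       cone_topology x0 closure_of orbit G (boundary_action \<rho>) e \<subseteq> Sigma_inv n G R h}"
      using Sigma_circ_closure[OF fin] by blast
  next
    fix e assume "e \<in> {e \<in> visual_boundary.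
       cone_topology x0 closure_of orbit G (boundary_action \<rho>) e \<subseteq> Sigma_inv n G R h}"
    then show "e \<in> Sigma_circ n G R h" using Sigma_circ_of_closure[OF fin] by blast
  qed
qed

end
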